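(* Let $\mathbf{A}\in C^{\infty}(\mathbb{T}^2;\mathbb{R}^2)$, $V\in C^{\infty}(\mathbb{T}^2;\mathbb{R})$ and let $\omega$ be a nonempty open subset of $\mathbb{T}^2$. Assume that there exist a periodic direction $\vec\gamma$ and a closed geodesic $\gamma$ with direction $\vec\gamma$ such that $\gamma\cap\overline{\omega}=\emptyset$, and that $A_\gamma$ has at least one non-degenerate critical point outside $\overline{\omega}_{\vec\gamma^\perp}$. Then for any $T>0$, the observability inequality at time $T$ from $\omega$ does not hold; that is, there is no constant $C>0$ such that $$\|u_0\|^2_{L^2(\mathbb{T}^2)}\leq C\int_0^T\int_{\omega}\left|e^{-itH_{\mathbf{A},V}}u_0(z)\right|^2\,dz\,dt\qquad\text{for all } u_0\in L^2(\mathbb{T}^2).$$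
   Context: $\mathbb{T}^2=\mathbb{R}^2/(2\pi\mathbb{Z})^2$. $H_{\mathbf{A},V}=\left(\frac1i\nabla-\mathbf{A}(z)\right)^2+V(z)$ is the (self-adjoint) electromagnetic Schrödinger operator on $L^2(\mathbb{T}^2)$, and $e^{-itH_{\mathbf{A},V}}$ is its unitary propagator. A periodic direction is a unit vector $\vec\gamma\in\mathbb{R}^2$ parallel to a nonzero vector of $\mathbb{Z}^2$, so that all geodesics $t\mapsto z+t\vec\gamma$ on $\mathbb{T}^2$ are closed. For an integrable $f$ on $\mathbb{T}^2$, $\langle f\rangle_{\vec\gamma}(z):=\lim_{S\to\infty}\frac1S\int_0^S f(z+t\vec\gamma)\,dt$. Define the scalar function $A_\gamma:=\langle \mathbf{A}\rangle_{\vec\gamma}\cdot\vec\gamma$; it is constant along $\vec\gamma$ and identified with a function of one transversal variable (direction $\vec\gamma^\perp$). A critical point of $A_\gamma$ is non-degenerate if the second derivative of $A_\gamma$ in the transversal variable does not vanish there. $\overline{\omega}_{\vec\gamma^\perp}$ is the projection of $\overline{\omega}$ on the direction $\vec\gamma^\perp$, i.e. its image in the quotient of $\mathbb{T}^2$ by the closed geodesics of direction $\vec\gamma$; a critical point represented by $z\in\mathbb{T}^2$ lies outside $\overline{\omega}_{\vec\gamma^\perp}$ if and only if $\{z+t\vec\gamma:t\in\mathbb{R}\}\cap\overline{\omega}=\emptyset$. *)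

theory Defs
  imports "HOL-Analysis.Analysis"
begin

text \<open>
  Objects on the torus \<open>T\<^sup>2 = R\<^sup>2 / (2 pi Z)\<^sup>2\<close> are represented by their lifts to the plane:
  functions are \<open>(2 pi Z)\<^sup>2\<close>-periodic functions on \<open>real^2\<close>, and a subset of the torus is its full
  preimage, i.e. a periodic subset of \<open>real^2\<close>.  Since the projection is an open covering map, a
  set is open iff its preimage is, and the preimage of the closure is the closure of the preimage.
\<close>

definition periodic :: "(real^2 \<Rightarrow> 'a) \<Rightarrow> bool" where
  "periodic f \<longleftrightarrow> (\<forall>z. \<forall>m :: int^2. f (z + (2 * pi) *\<^sub>R (\<chi> i. real_of_int (m $ i))) = f z)"

definition torus_open :: "(real^2) set \<Rightarrow> bool" where
  "torus_open W \<longleftrightarrow> open W \<and> periodic (\<lambda>z. z \<in> W)"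

definition torus_cell :: "(real^2) set" where
  "torus_cell = {z. \<forall>i. 0 \<le> z $ i \<and> z $ i < 2 * pi}"


subsection \<open>Smooth functions\<close>

text \<open>
  \<open>f\<close> is \<open>C\<^sup>k\<^sup>+\<^sup>1\<close> iff it is differentiable everywhere and all of its directional derivatives
  are \<open>C\<^sup>k\<close>.
\<close>

primrec Ck :: "nat \<Rightarrow> ('a::euclidean_space \<Rightarrow> 'b::real_normed_vector) \<Rightarrow> bool" where
  "Ck 0 f \<longleftrightarrow> continuous_on UNIV f"
| "Ck (Suc k) f \<longleftrightarrow>
     (\<forall>z. f differentiable at z) \<and> (\<forall>v. Ck k (\<lambda>z. frechet_derivative f (at z) v))"

definition torus_smooth :: "(real^2 \<Rightarrow> 'b::real_normed_vector) \<Rightarrow> bool" where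
  "torus_smooth f \<longleftrightarrow> periodic f \<and> (\<forall>k. Ck k f)"


subsection \<open>The space of square integrable functions\<close>

text \<open>
  Elements are individual functions; equality of \<open>L\<^sup>2\<close> classes is equality almost everywhere and
  is written out where it is needed.
\<close>

definition L2_torus :: "(real^2 \<Rightarrow> complex) set" where
  "L2_torus = {u. periodic u \<and> u \<in> borel_measurable lebesgue \<and>
                  set_integrable lebesgue torus_cell (\<lambda>z. (norm (u z))\<^sup>2)}"

definition L2_norm :: "(real^2 \<Rightarrow> complex) \<Rightarrow> real" where
  "L2_norm u = sqrt (LINT z:torus_cell|lebesgue. (norm (u z))\<^sup>2)"


subsection \<open>The electromagnetic Schroedinger operator and its propagator\<close>

definition magnetic_deriv ::
    "(real^2 \<Rightarrow> real^2) \<Rightarrow> 2 \<Rightarrow> (real^2 \<Rightarrow> complex) \<Rightarrow> real^2 \<Rightarrow> complex" where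
  "magnetic_deriv A j u z =
     (1 / \<i>) * frechet_derivative u (at z) (axis j 1) - complex_of_real (A z $ j) * u z"

definition schroedinger_expr ::
    "(real^2 \<Rightarrow> real^2) \<Rightarrow> (real^2 \<Rightarrow> real) \<Rightarrow> (real^2 \<Rightarrow> complex) \<Rightarrow> real^2 \<Rightarrow> complex" where
  "schroedinger_expr A V u z =
     (\<Sum>j\<in>UNIV. magnetic_deriv A j (magnetic_deriv A j u) z) + complex_of_real (V z) * u z"

text \<open>
  The graph of the unbounded self-adjoint operator \<open>H\<close>: the closure in \<open>L\<^sup>2 \<times> L\<^sup>2\<close> of the graph of
  the differential expression on smooth functions.  For smooth \<open>A\<close> and \<open>V\<close> the expression is
  essentially self-adjoint there and its closure has domain the Sobolev space \<open>H\<^sup>2\<close> of the torus.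
\<close>

definition schroedinger_graph ::
    "(real^2 \<Rightarrow> real^2) \<Rightarrow> (real^2 \<Rightarrow> real) \<Rightarrow>
     ((real^2 \<Rightarrow> complex) \<times> (real^2 \<Rightarrow> complex)) set" where
  "schroedinger_graph A V =
     {(u, w). u \<in> L2_torus \<and> w \<in> L2_torus \<and>
        (\<exists>\<phi>. (\<forall>n::nat. torus_smooth (\<phi> n)) \<and>
             (\<lambda>n. L2_norm (\<lambda>z. \<phi> n z - u z)) \<longlonglongrightarrow> 0 \<and>
             (\<lambda>n. L2_norm (\<lambda>z. schroedinger_expr A V (\<phi> n) z - w z)) \<longlonglongrightarrow> 0)}"

text \<open>
  Strongly continuous one-parameter unitary groups on \<open>L\<^sup>2\<close> of the torus.  Each operator
  respects almost-everywhere equality, by linearity and isometry; surjectivity follows from the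
  group law.
\<close>

definition unitary_group :: "(real \<Rightarrow> (real^2 \<Rightarrow> complex) \<Rightarrow> (real^2 \<Rightarrow> complex)) \<Rightarrow> bool" where
  "unitary_group U \<longleftrightarrow>
     (\<forall>t. \<forall>u\<in>L2_torus. U t u \<in> L2_torus \<and> L2_norm (U t u) = L2_norm u) \<and>
     (\<forall>t a b. \<forall>u\<in>L2_torus. \<forall>v\<in>L2_torus.
        AE z in lebesgue. U t (\<lambda>y. a * u y + b * v y) z = a * U t u z + b * U t v z) \<and>
     (\<forall>u\<in>L2_torus. AE z in lebesgue. U 0 u z = u z) \<and>
     (\<forall>s t. \<forall>u\<in>L2_torus. AE z in lebesgue. U (s + t) u z = U s (U t u) z) \<and>
     (\<forall>u\<in>L2_torus. ((\<lambda>t. L2_norm (\<lambda>z. U t u z - u z)) \<longlongrightarrow> 0) (at 0))"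

text \<open>
  \<open>(u, w)\<close> is in this graph iff \<open>t \<mapsto> U t u\<close> is differentiable at \<open>0\<close> in \<open>L\<^sup>2\<close> with derivative
  \<open>- \<i> w\<close>.
\<close>

definition generator_graph ::
    "(real \<Rightarrow> (real^2 \<Rightarrow> complex) \<Rightarrow> (real^2 \<Rightarrow> complex)) \<Rightarrow>
     ((real^2 \<Rightarrow> complex) \<times> (real^2 \<Rightarrow> complex)) set" where
  "generator_graph U =
     {(u, w). u \<in> L2_torus \<and> w \<in> L2_torus \<and>
        ((\<lambda>h. L2_norm (\<lambda>z. (U h u z - u z) / complex_of_real h - (- \<i> * w z))) \<longlongrightarrow> 0) (at 0)}"

text \<open>
  \<open>U t = exp (- \<i> t H)\<close>: by Stone's theorem there is exactly one strongly continuous unitary group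
  (up to almost-everywhere equality) whose generator is \<open>- \<i> H\<close>, namely this one.
\<close>

definition schroedinger_propagator ::
    "(real^2 \<Rightarrow> real^2) \<Rightarrow> (real^2 \<Rightarrow> real) \<Rightarrow>
     (real \<Rightarrow> (real^2 \<Rightarrow> complex) \<Rightarrow> (real^2 \<Rightarrow> complex)) \<Rightarrow> bool" where
  "schroedinger_propagator A V U \<longleftrightarrow>
     unitary_group U \<and> generator_graph U = schroedinger_graph A V"

definition observable ::
    "(real \<Rightarrow> (real^2 \<Rightarrow> complex) \<Rightarrow> (real^2 \<Rightarrow> complex)) \<Rightarrow> (real^2) set \<Rightarrow> real \<Rightarrow> bool" where
  "observable U W T \<longleftrightarrow>
     (\<exists>C>0. \<forall>u\<in>L2_torus.
        (L2_norm u)\<^sup>2 \<le>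
          C * (LINT t:{0..T}|lborel. LINT z:torus_cell \<inter> W|lebesgue. (norm (U t u z))\<^sup>2))"


subsection \<open>Closed geodesics and averages along them\<close>

definition periodic_direction :: "real^2 \<Rightarrow> bool" where
  "periodic_direction g \<longleftrightarrow>
     norm g = 1 \<and> (\<exists>m :: int^2. m \<noteq> 0 \<and> (\<exists>c. g = c *\<^sub>R (\<chi> i. real_of_int (m $ i))))"

text \<open>
  A line in the plane lifting the geodesic of direction \<open>g\<close> through \<open>z\<close>.  For a periodic set \<open>W\<close>,
  the geodesic avoids the corresponding subset of the torus iff this line avoids \<open>W\<close>.
\<close>

definition geodesic :: "real^2 \<Rightarrow> real^2 \<Rightarrow> (real^2) set" where
  "geodesic g z = range (\<lambda>t. z + t *\<^sub>R g)"

definition geodesic_average ::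
    "real^2 \<Rightarrow> (real^2 \<Rightarrow> 'b::real_normed_vector) \<Rightarrow> real^2 \<Rightarrow> 'b" where
  "geodesic_average g f z =
     Lim at_top (\<lambda>S. (1 / S) *\<^sub>R integral {0..S} (\<lambda>t. f (z + t *\<^sub>R g)))"

definition averaged_potential :: "(real^2 \<Rightarrow> real^2) \<Rightarrow> real^2 \<Rightarrow> real^2 \<Rightarrow> real" where
  "averaged_potential A g z = geodesic_average g A z \<bullet> g"

definition perp :: "real^2 \<Rightarrow> real^2" where
  "perp g = vector [- (g $ 2), g $ 1]"

text \<open>
  For \<open>f\<close> constant along \<open>g\<close>: the point \<open>z\<close> represents a non-degenerate critical point of \<open>f\<close>
  regarded as a function of the transversal variable, in direction \<open>perp g\<close>.
\<close>

definition nondegenerate_critical_point ::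
    "(real^2 \<Rightarrow> real) \<Rightarrow> real^2 \<Rightarrow> real^2 \<Rightarrow> bool" where
  "nondegenerate_critical_point f g z \<longleftrightarrow>
     (let h = (\<lambda>s::real. f (z + s *\<^sub>R perp g)) in deriv h 0 = 0 \<and> deriv (deriv h) 0 \<noteq> 0)"

end

theory Submission
  imports Defs "HOL-Real_Asymp.Real_Asymp"
begin

text \<open>
  Along the geodesic a wave \<open>exp(i N m \<bullet> z)\<close> of large frequency averages out the magnetic
  potential, and in the transversal variable \<open>y\<close> the operator becomes, up to a constant,
  \<open>D_y^2 - 2 K A_\<gamma>(y)\<close> with \<open>K = N |m|\<close>.  For one of the two signs of \<open>N\<close> the non-degenerate
  critical point is a potential well of strength \<open>|K|\<close>, which carries a Gaussian state of
  width \<open>|K|^(-1/4)\<close>.  A WKB ansatz \<open>u = exp (X + i Y)\<close> turns it into a quasimode: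
  expanding the well to fourth order and removing the terms that oscillate along the geodesic by
  primitives in the longitudinal variable gives \<open>\<parallel>(H - E) u\<parallel> = o(\<parallel>u\<parallel>)\<close> with \<open>u\<close> exponentially
  small on \<open>\<omega>\<close>.  Since \<open>\<parallel>exp(-i t H) u - exp(-i t E) u\<parallel> \<le> t \<parallel>(H - E) u\<parallel>\<close>, the solution
  with initial value \<open>u\<close> hardly meets \<open>\<omega>\<close> before time \<open>T\<close>.
\<close>

subsection \<open>Smooth functions\<close>

text \<open>The state lives at \<open>r\<close> of order \<open>k^(-1/2)\<close>, so a term
  \<open>k^a r^b\<close> is negligible when \<open>b > 2 a\<close>. This fixes what may be left
  over: \<open>k^2 r^5\<close>, \<open>k r^3\<close>, \<open>r\<close> and \<open>1/k\<close>. Every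
  larger term has to cancel or be constant, since only a residual \<open>o(1)\<close> is allowed for
  an operator of size \<open>k^4\<close>. The cancellation along the geodesic rests on the
  longitudinal frequency: it multiplies the derivative in \<open>s\<close> of a corrector by
  \<open>k^2\<close>, so correctors of size \<open>1/k\<close> and \<open>1/k^2\<close> act on the
  orders \<open>k\<close> and \<open>1\<close>. An equation in \<open>s\<close> has a periodic
  solution only if its right side has mean zero. In the real part the means are balanced by the
  profile of the Gaussian and by the energy. In the imaginary part the component of \<open>A\<close>
  across the geodesic is the obstacle; the additive constants of \<open>\<phi> 1\<close> and
  \<open>\<phi> 2\<close>, a gauge freedom in the transversal variable, bring the relevant means to
  zero. The ansatz is global: polynomials in \<open>sin r\<close> and a phase that stays positive
  away from the geodesic replace cut-off functions, so one explicit formula describes the action of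
  the operator on the whole torus.\<close>

definition smooth :: "('a::euclidean_space \<Rightarrow> 'b::real_normed_vector) \<Rightarrow> bool" where
  "smooth f \<longleftrightarrow> (\<forall>k. Ck k f)"

definition dderiv :: "('a::euclidean_space \<Rightarrow> 'b::real_normed_vector) \<Rightarrow> 'a \<Rightarrow> 'a \<Rightarrow> 'b" where
  "dderiv f v z = frechet_derivative f (at z) v"

lemma dderiv_eq: "(f has_derivative D) (at z) \<Longrightarrow> dderiv f v z = D v"
  by (simp add: dderiv_def frechet_derivative_at[symmetric])

lemma Ck_SucI:
  assumes "\<And>z. (f has_derivative D z) (at z)" "\<And>v. Ck k (\<lambda>z. D z v)"
  shows "Ck (Suc k) f"
proof -
  have "frechet_derivative f (at z) = D z" for z
    using assms(1) by (simp add: frechet_derivative_at[symmetric])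
  then show ?thesis using assms by (auto simp: differentiable_def)
qed

lemma Ck_SucD:
  assumes "Ck (Suc k) f"
  shows "(f has_derivative (\<lambda>v. dderiv f v z)) (at z)" "Ck k (\<lambda>z. dderiv f v z)"
  using assms by (simp_all add: frechet_derivative_works dderiv_def)

lemma Ck_continuous: "Ck k f \<Longrightarrow> continuous_on UNIV f"
  by (cases k) (auto simp: continuous_at_imp_continuous_on differentiable_imp_continuous_within)

lemma Ck_mono: "Ck (Suc k) f \<Longrightarrow> Ck k f"
proof (induction k arbitrary: f)
  case 0
  then show ?case by (metis Ck.simps(1) Ck_continuous)
next
  case (Suc k)
  note D = Ck_SucD[OF Suc.prems]
  show ?case
    by (rule Ck_SucI[OF D(1)]) (rule Suc.IH[OF D(2)])
qed

lemma Ck_const: "Ck k (\<lambda>z. c)"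
proof (induction k arbitrary: c)
  case (Suc k)
  show ?case by (rule Ck_SucI[OF has_derivative_const Suc])
qed simp

lemma Ck_add: "Ck k f \<Longrightarrow> Ck k g \<Longrightarrow> Ck k (\<lambda>z. f z + g z)"
proof (induction k arbitrary: f g)
  case 0
  then show ?case by (simp add: continuous_on_add)
next
  case (Suc k)
  note D = Ck_SucD[OF Suc.prems(1)]
  note E = Ck_SucD[OF Suc.prems(2)]
  show ?case
    by (rule Ck_SucI[OF has_derivative_add[OF D(1) E(1)]]) (intro Suc.IH D E)
qed

lemma Ck_linear: "bounded_linear L \<Longrightarrow> Ck k f \<Longrightarrow> Ck k (\<lambda>z. L (f z))"
proof (induction k arbitrary: f)
  case 0
  then show ?case by (simp add: bounded_linear.continuous_on)
next
  case (Suc k)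
  note D = Ck_SucD[OF Suc.prems(2)]
  show ?case
    by (rule Ck_SucI[OF bounded_linear.has_derivative[OF Suc.prems(1) D(1)]])
      (intro Suc.IH D Suc.prems(1))
qed

lemma Ck_bilinear:
  assumes "bounded_bilinear B"
  shows "Ck k f \<Longrightarrow> Ck k g \<Longrightarrow> Ck k (\<lambda>z. B (f z) (g z))"
proof (induction k arbitrary: f g)
  case 0
  then show ?case by (simp add: bounded_bilinear.continuous_on[OF assms])
next
  case (Suc k)
  note D = Ck_SucD[OF Suc.prems(1)]
  note E = Ck_SucD[OF Suc.prems(2)]
  show ?case
    by (rule Ck_SucI[OF bounded_bilinear.FDERIV[OF assms D(1) E(1)]])
      (intro Suc.IH D E Ck_add Ck_mono[OF Suc.prems(1)] Ck_mono[OF Suc.prems(2)])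
qed

lemma Ck_compose_affine:
  assumes "bounded_linear L"
  shows "Ck k f \<Longrightarrow> Ck k (\<lambda>z. f (c + L z))"
proof (induction k arbitrary: f)
  case 0
  have "continuous_on UNIV (\<lambda>z. c + L z)"
    by (intro continuous_intros bounded_linear.continuous_on[OF assms])
  then show ?case using 0 by (auto intro: continuous_on_compose2)
next
  case (Suc k)
  note D = Ck_SucD[OF Suc.prems]
  have "((\<lambda>z. c + L z) has_derivative L) (at z)" for z
    using has_derivative_add[OF has_derivative_const bounded_linear_imp_has_derivative[OF assms]]
    by force
  then have "((\<lambda>z. f (c + L z)) has_derivative (\<lambda>v. dderiv f (L v) (c + L z))) (at z)" for z
    by (rule has_derivative_compose) (rule D)
  then show ?case
    by (rule Ck_SucI) (rule Suc.IH[OF D(2)])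
qed

lemma Ck_exp:
  fixes f :: "'a::euclidean_space \<Rightarrow> complex"
  shows "Ck k f \<Longrightarrow> Ck k (\<lambda>z. exp (f z))"
proof (induction k)
  case 0
  then show ?case by (auto intro: continuous_intros)
next
  case (Suc k)
  note D = Ck_SucD[OF Suc.prems]
  have "((\<lambda>z. exp (f z)) has_derivative (\<lambda>v. exp (f z) * dderiv f v z)) (at z)" for z
    by (rule has_derivative_compose[OF D(1)])
      (use DERIV_exp[of "f z"] in \<open>simp add: has_field_derivative_def\<close>)
  then show ?case
    by (rule Ck_SucI)
      (intro Ck_bilinear[OF bounded_bilinear_mult] Suc.IH Ck_mono[OF Suc.prems] D)
qed

lemma smooth_const: "smooth (\<lambda>z. c)"
  by (simp add: smooth_def Ck_const)

lemma smooth_add: "smooth f \<Longrightarrow> smooth g \<Longrightarrow> smooth (\<lambda>z. f z + g z)"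
  by (simp add: smooth_def Ck_add)

lemma smooth_linear: "bounded_linear L \<Longrightarrow> smooth f \<Longrightarrow> smooth (\<lambda>z. L (f z))"
  by (simp add: smooth_def Ck_linear)

lemma smooth_minus: "smooth f \<Longrightarrow> smooth (\<lambda>z. - f z)"
  using smooth_linear[OF bounded_linear_minus[OF bounded_linear_ident]] .

lemma smooth_diff: "smooth f \<Longrightarrow> smooth g \<Longrightarrow> smooth (\<lambda>z. f z - g z)"
  using smooth_add[OF _ smooth_minus, of f g] by simp

lemma smooth_mult:
  fixes f g :: "_ \<Rightarrow> 'b::real_normed_algebra"
  shows "smooth f \<Longrightarrow> smooth g \<Longrightarrow> smooth (\<lambda>z. f z * g z)"
  by (simp add: smooth_def Ck_bilinear[OF bounded_bilinear_mult])

lemma smooth_power: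
  fixes f :: "_ \<Rightarrow> 'b::real_normed_algebra_1"
  shows "smooth f \<Longrightarrow> smooth (\<lambda>z. f z ^ k)"
  by (induction k) (auto intro: smooth_const smooth_mult)

lemma smooth_exp:
  fixes f :: "_ \<Rightarrow> complex"
  shows "smooth f \<Longrightarrow> smooth (\<lambda>z. exp (f z))"
  by (simp add: smooth_def Ck_exp)

lemma smooth_compose_affine: "bounded_linear L \<Longrightarrow> smooth f \<Longrightarrow> smooth (\<lambda>z. f (c + L z))"
  by (simp add: smooth_def Ck_compose_affine)

lemma smooth_continuous: "smooth f \<Longrightarrow> continuous_on S f"
  using Ck_continuous continuous_on_subset unfolding smooth_def by blast

lemma smooth_has_derivative: "smooth f \<Longrightarrow> (f has_derivative (\<lambda>v. dderiv f v z)) (at z)"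
  unfolding smooth_def using Ck_SucD(1) by blast

lemma smooth_dderiv: "smooth f \<Longrightarrow> smooth (dderiv f v)"
  unfolding smooth_def using Ck_SucD(2) by blast

lemma smooth_real_deriv:
  fixes f :: "real \<Rightarrow> real"
  assumes "\<And>x. (f has_real_derivative g x) (at x)" "smooth g"
  shows "smooth f"
  unfolding smooth_def
proof
  fix k
  show "Ck k f"
  proof (cases k)
    case 0
    then show ?thesis using assms(1) 
      by (auto intro!: continuous_at_imp_continuous_on DERIV_isCont)
  next
    case (Suc j)
    have "Ck (Suc j) f"
    proof (rule Ck_SucI)
      show "(f has_derivative (\<lambda>v. g z * v)) (at z)" for z
        using assms(1) by (simp add: has_field_derivative_def)
      show "Ck j (\<lambda>z. g z * v)" for v
        using assms(2) unfolding smooth_def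
        by (intro Ck_bilinear[OF bounded_bilinear_mult] Ck_const) simp
    qed
    then show ?thesis using Suc by simp
  qed
qed

lemma smooth_deriv:
  fixes f :: "real \<Rightarrow> real"
  assumes "smooth f"
  obtains g where "\<And>x. (f has_real_derivative g x) (at x)" "smooth g"
proof
  show "smooth (dderiv f 1)" using assms by (rule smooth_dderiv)
  have "linear (\<lambda>v. dderiv f v x)" for x
    using smooth_has_derivative[OF assms] has_derivative_linear by blast
  then have "dderiv f v x = dderiv f 1 x * v" for v x
    using linear_scale[of "\<lambda>v. dderiv f v x" v 1] by (simp add: mult.commute)
  then have eq: "(\<lambda>v. dderiv f v x) = (*) (dderiv f 1 x)" for x by (intro ext)
  show "(f has_real_derivative dderiv f 1 x) (at x)" for x
    using smooth_has_derivative[OF assms, of x] unfolding has_field_derivative_def eq .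
qed

lemma smooth_sin_cos: "smooth (sin :: real \<Rightarrow> real)" "smooth (cos :: real \<Rightarrow> real)"
proof -
  have "Ck k (sin :: real \<Rightarrow> real) \<and> Ck k (cos :: real \<Rightarrow> real)" for k
  proof (induction k)
    case (Suc k)
    have "Ck (Suc k) (sin :: real \<Rightarrow> real)"
    proof (rule Ck_SucI)
      show "(sin has_derivative (\<lambda>v. v * cos z)) (at z)" for z :: real
        by (auto intro!: derivative_eq_intros)
      show "Ck k (\<lambda>z. v * cos z)" for v :: real
        by (intro Ck_bilinear[OF bounded_bilinear_mult] Ck_const) (use Suc in blast)
    qed
    moreover have "Ck (Suc k) (cos :: real \<Rightarrow> real)"
    proof (rule Ck_SucI)
      show "(cos has_derivative (\<lambda>v. (- v) * sin z)) (at z)" for z :: real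
        by (auto intro!: derivative_eq_intros)
      show "Ck k (\<lambda>z. (- v) * sin z)" for v :: real
        by (intro Ck_bilinear[OF bounded_bilinear_mult] Ck_const) (use Suc in blast)
    qed
    ultimately show ?case by blast
  qed (auto intro: continuous_intros)
  then show "smooth (sin :: real \<Rightarrow> real)" "smooth (cos :: real \<Rightarrow> real)"
    by (auto simp: smooth_def)
qed

lemmas smooth_intros = smooth_const smooth_add smooth_minus smooth_diff smooth_mult smooth_power
  smooth_exp

subsection \<open>Square integrable functions on the torus\<close>

lemma torus_cell_meas [measurable]: "torus_cell \<in> sets lebesgue"
proof -
  have "torus_cell = (\<Inter>i\<in>UNIV. {z::real^2. 0 \<le> z $ i} \<inter> {z. z $ i < 2 * pi})"
    by (auto simp: torus_cell_def)
  moreover have "{z::real^2. 0 \<le> z $ i} \<inter> {z. z $ i < 2 * pi} \<in> sets borel" for i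
    by (intro sets.Int borel_closed borel_open closed_Collect_le open_Collect_less continuous_intros)
  then have "(\<Inter>i\<in>UNIV. {z::real^2. 0 \<le> z $ i} \<inter> {z. z $ i < 2 * pi}) \<in> sets borel"
    by (intro sets.countable_INT') auto
  ultimately have "torus_cell \<in> sets borel" by metis
  then show ?thesis by auto
qed

lemma torus_cell_subset: "torus_cell \<subseteq> cbox (vec 0) (vec (2 * pi))"
  by (auto simp: torus_cell_def mem_box_cart less_imp_le)

lemma torus_cell_finite: "emeasure lebesgue torus_cell < \<infinity>"
proof -
  have "emeasure lebesgue torus_cell \<le> emeasure lebesgue (cbox (vec 0) (vec (2 * pi) :: real^2))"
    by (intro emeasure_mono torus_cell_subset) auto
  also have "\<dots> < \<infinity>" by (simp add: emeasure_lborel_cbox_eq)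
  finally show ?thesis .
qed

abbreviation period :: "int^2 \<Rightarrow> real^2" where
  "period l \<equiv> (2 * pi) *\<^sub>R (\<chi> i. real_of_int (l $ i))"

lemma periodic_shift:
  assumes "periodic f"
  shows "f (z + period m) = f z"
  using assms by (simp add: periodic_def)

lemma torus_cell_rep:
  fixes z :: "real^2"
  obtains m :: "int^2" where "z + period m \<in> torus_cell"
proof
  define m :: "int^2" where "m = (\<chi> i. - \<lfloor>z $ i / (2 * pi)\<rfloor>)"
  have "0 \<le> z $ i - 2 * pi * \<lfloor>z $ i / (2 * pi)\<rfloor>" "z $ i - 2 * pi * \<lfloor>z $ i / (2 * pi)\<rfloor> < 2 * pi" for i
  proof -
    define x where "x = z $ i / (2 * pi)"
    have z: "z $ i = 2 * pi * x" by (simp add: x_def)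
    have "0 \<le> 2 * pi * (x - \<lfloor>x\<rfloor>)" by simp
    then show "0 \<le> z $ i - 2 * pi * \<lfloor>z $ i / (2 * pi)\<rfloor>"
      unfolding x_def[symmetric] z by (simp add: algebra_simps)
    have "2 * pi * (x - \<lfloor>x\<rfloor>) < 2 * pi * 1"
      by (intro mult_strict_left_mono) (linarith, simp)
    then show "z $ i - 2 * pi * \<lfloor>z $ i / (2 * pi)\<rfloor> < 2 * pi"
      unfolding x_def[symmetric] z by (simp add: algebra_simps)
  qed
  then show "z + period m \<in> torus_cell"
    by (simp add: torus_cell_def m_def)
qed

lemma periodic_continuous_bounded:
  fixes f :: "real^2 \<Rightarrow> 'b::real_normed_vector"
  assumes "periodic f" "continuous_on UNIV f"
  obtains B where "B > 0" "\<And>z. norm (f z) \<le> B"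
proof -
  have "compact (f ` cbox (vec 0) (vec (2 * pi)))"
    by (intro compact_continuous_image continuous_on_subset[OF assms(2)]) auto
  then have "bounded (f ` cbox (vec 0) (vec (2 * pi)))"
    by (rule compact_imp_bounded)
  then obtain B where B: "B > 0" "\<forall>y\<in>f ` cbox (vec 0) (vec (2 * pi)). norm y \<le> B"
    unfolding bounded_pos by blast
  have "norm (f z) \<le> B" for z
  proof -
    obtain m where "z + period m \<in> torus_cell"
      by (rule torus_cell_rep)
    then show ?thesis
      using B(2) subsetD[OF torus_cell_subset] periodic_shift[OF assms(1), of z m]
      by (metis image_eqI)
  qed
  then show ?thesis by (rule that[OF B(1)])
qed

lemma torus_smoothD:
  assumes "torus_smooth f" shows "periodic f" "smooth f"
  using assms by (auto simp: torus_smooth_def smooth_def)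

lemma torus_smoothI: "periodic f \<Longrightarrow> smooth f \<Longrightarrow> torus_smooth f"
  by (auto simp: torus_smooth_def smooth_def)

lemma set_integrable_sq_bound:
  fixes f :: "real^2 \<Rightarrow> real"
  assumes "set_integrable lebesgue S f" "g \<in> borel_measurable lebesgue" "S \<in> sets lebesgue"
    "\<And>z. z \<in> S \<Longrightarrow> \<bar>g z\<bar> \<le> \<bar>f z\<bar>"
  shows "set_integrable lebesgue S g"
  using assms(1) unfolding set_integrable_def
proof (rule Bochner_Integration.integrable_bound)
  show "(\<lambda>x. indicat_real S x *\<^sub>R g x) \<in> borel_measurable lebesgue"
    using assms by auto
  show "AE x in lebesgue. norm (indicat_real S x *\<^sub>R g x) \<le> norm (indicat_real S x *\<^sub>R f x)"
    using assms(4) by (auto simp: indicator_def)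
qed

lemma set_integrable_cell_bounded:
  fixes g :: "real^2 \<Rightarrow> real"
  assumes "g \<in> borel_measurable lebesgue" "\<And>z. \<bar>g z\<bar> \<le> B"
  shows "set_integrable lebesgue torus_cell g"
proof (rule set_integrable_sq_bound)
  show "set_integrable lebesgue torus_cell (\<lambda>z. B)"
    unfolding set_integrable_def using torus_cell_finite by simp
  show "\<bar>g z\<bar> \<le> \<bar>B\<bar>" for z using assms(2)[of z] by simp
qed (use assms in auto)

lemma continuous_lebesgue_measurable:
  "continuous_on UNIV f \<Longrightarrow> f \<in> borel_measurable lebesgue"
  for f :: "real^2 \<Rightarrow> 'b::real_normed_vector"
  using borel_measurable_continuous_onI[of f] by (simp add: measurable_completion)

lemma torus_smooth_L2:
  assumes "torus_smooth u" shows "u \<in> L2_torus"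
proof -
  have u: "periodic u" "continuous_on UNIV u"
    using torus_smoothD[OF assms] smooth_continuous by auto
  obtain B where B: "\<And>z. norm (u z) \<le> B"
    using periodic_continuous_bounded[OF u] by blast
  have m: "u \<in> borel_measurable lebesgue"
    using u by (intro continuous_lebesgue_measurable)
  have "set_integrable lebesgue torus_cell (\<lambda>z. (norm (u z))^2)"
  proof (rule set_integrable_cell_bounded[where B = "B^2"])
    show "(\<lambda>z. (norm (u z))^2) \<in> borel_measurable lebesgue" using m by measurable
    show "\<bar>(norm (u z))^2\<bar> \<le> B^2" for z using B[of z] by (simp add: power_mono)
  qed
  then show ?thesis using u m by (simp add: L2_torus_def)
qed

text \<open>The weight \<open>l\<close> stays free because it has two uses: \<open>l = 1\<close>
  gives the crude bound of the square of a sum, and the optimal \<open>l\<close> yields the triangle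
  inequality for \<open>L2_norm\<close> after integration.\<close>

lemma norm_sum_sq_le:
  fixes x y :: "'a::real_normed_vector"
  assumes "l > 0"
  shows "(norm (x + y))^2 \<le> (1 + l) * (norm x)^2 + (1 + 1 / l) * (norm y)^2"
proof -
  let ?a = "norm x" and ?b = "norm y"
  have "(norm (x + y))^2 \<le> (?a + ?b)^2"
    by (intro power_mono norm_triangle_ineq) auto
  also have "\<dots> \<le> (1 + l) * ?a^2 + (1 + 1 / l) * ?b^2"
  proof -
    have "0 \<le> (l * ?a - ?b)^2 / l" using assms by simp
    also have "\<dots> = l * ?a^2 + ?b^2 / l - 2 * ?a * ?b"
      using assms by (simp add: field_simps power2_eq_square)
    finally show ?thesis by (simp add: algebra_simps power2_eq_square)
  qed
  finally show ?thesis .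
qed

lemma L2_torusD:
  assumes "u \<in> L2_torus"
  shows "periodic u" "u \<in> borel_measurable lebesgue"
    "set_integrable lebesgue torus_cell (\<lambda>z. (norm (u z))^2)"
  using assms by (auto simp: L2_torus_def)

lemma L2_lincomb:
  assumes "u \<in> L2_torus" "v \<in> L2_torus"
  shows "(\<lambda>z. a * u z + b * v z) \<in> L2_torus"
proof -
  note [measurable] = L2_torusD(2)[OF assms(1)] L2_torusD(2)[OF assms(2)]
  have "set_integrable lebesgue torus_cell (\<lambda>z. (norm (a * u z + b * v z))^2)"
  proof (rule set_integrable_sq_bound)
    show "set_integrable lebesgue torus_cell
        (\<lambda>z. 2 * (norm a)^2 * (norm (u z))^2 + 2 * (norm b)^2 * (norm (v z))^2)"
      using assms by (intro set_integral_add set_integrable_mult_right) (auto dest: L2_torusD)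
    show "\<bar>(norm (a * u z + b * v z))^2\<bar>
        \<le> \<bar>2 * (norm a)^2 * (norm (u z))^2 + 2 * (norm b)^2 * (norm (v z))^2\<bar>" for z
      using norm_sum_sq_le[of 1 "a * u z" "b * v z"] by (simp add: norm_mult power_mult_distrib)
  qed auto
  then show ?thesis using assms by (auto simp: L2_torus_def periodic_def)
qed

lemma L2_diff: "u \<in> L2_torus \<Longrightarrow> v \<in> L2_torus \<Longrightarrow> (\<lambda>z. u z - v z) \<in> L2_torus"
  using L2_lincomb[of u v 1 "- 1"] by simp

lemma L2_add: "u \<in> L2_torus \<Longrightarrow> v \<in> L2_torus \<Longrightarrow> (\<lambda>z. u z + v z) \<in> L2_torus"
  using L2_lincomb[of u v 1 1] by simp

lemma L2_scale: "u \<in> L2_torus \<Longrightarrow> (\<lambda>z. c * u z) \<in> L2_torus"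
  using L2_lincomb[of u u c 0] by simp

lemma L2_norm_nonneg [simp]: "0 \<le> L2_norm u"
  unfolding L2_norm_def set_lebesgue_integral_def by (auto intro!: integral_nonneg_AE)

lemma L2_norm_sq: "(L2_norm u)^2 = (LINT z:torus_cell|lebesgue. (norm (u z))^2)"
  unfolding L2_norm_def set_lebesgue_integral_def
  by (intro real_sqrt_pow2) (auto intro!: integral_nonneg_AE)

lemma L2_norm_scale: "L2_norm (\<lambda>z. c * u z) = norm c * L2_norm u"
  by (simp add: L2_norm_def norm_mult power_mult_distrib real_sqrt_mult)

lemma set_integrable_subset_cell:
  assumes "set_integrable lebesgue torus_cell (f :: real^2 \<Rightarrow> real)" "S \<in> sets lebesgue"
  shows "set_integrable lebesgue (torus_cell \<inter> S) f"
  using assms by (intro set_integrable_subset[OF assms(1)]) auto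

lemma L2_local_le:
  assumes u: "u \<in> L2_torus" and v: "v \<in> L2_torus" and S: "S \<in> sets lebesgue" and l: "l > 0"
  shows "(LINT z:torus_cell \<inter> S|lebesgue. (norm (u z + v z))^2)
    \<le> (1 + l) * (LINT z:torus_cell \<inter> S|lebesgue. (norm (u z))^2)
      + (1 + 1 / l) * (LINT z:torus_cell \<inter> S|lebesgue. (norm (v z))^2)"
proof -
  note i = set_integrable_subset_cell[OF L2_torusD(3)[OF u] S]
    set_integrable_subset_cell[OF L2_torusD(3)[OF v] S]
  have "(LINT z:torus_cell \<inter> S|lebesgue. (norm (u z + v z))^2)
    \<le> (LINT z:torus_cell \<inter> S|lebesgue. (1 + l) * (norm (u z))^2 + (1 + 1 / l) * (norm (v z))^2)"
  proof (rule set_integral_mono)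
    show "set_integrable lebesgue (torus_cell \<inter> S) (\<lambda>z. (norm (u z + v z))^2)"
      by (rule set_integrable_subset_cell[OF L2_torusD(3)[OF L2_add[OF u v]] S])
    show "set_integrable lebesgue (torus_cell \<inter> S)
        (\<lambda>z. (1 + l) * (norm (u z))^2 + (1 + 1 / l) * (norm (v z))^2)"
      by (intro set_integral_add set_integrable_mult_right i)
  qed (rule norm_sum_sq_le[OF l])
  also have "\<dots> = (1 + l) * (LINT z:torus_cell \<inter> S|lebesgue. (norm (u z))^2)
      + (1 + 1 / l) * (LINT z:torus_cell \<inter> S|lebesgue. (norm (v z))^2)"
    by (subst set_integral_add) (simp_all add: i set_integrable_mult_right)
  finally show ?thesis .
qed

lemma L2_local_mono:
  assumes u: "u \<in> L2_torus" and S: "S \<in> sets lebesgue"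
  shows "(LINT z:torus_cell \<inter> S|lebesgue. (norm (u z))^2) \<le> (L2_norm u)^2"
  unfolding L2_norm_sq
  set_lebesgue_integral_def
proof (rule integral_mono)
  show "integrable lebesgue (\<lambda>z. indicat_real (torus_cell \<inter> S) z *\<^sub>R (norm (u z))^2)"
    using set_integrable_subset_cell[OF L2_torusD(3)[OF u] S] by (simp add: set_integrable_def)
  show "integrable lebesgue (\<lambda>z. indicat_real torus_cell z *\<^sub>R (norm (u z))^2)"
    using L2_torusD(3)[OF u] by (simp add: set_integrable_def)
qed (auto simp: indicator_def)

lemma L2_triangle:
  assumes u: "u \<in> L2_torus" and v: "v \<in> L2_torus"
  shows "L2_norm (\<lambda>z. u z + v z) \<le> L2_norm u + L2_norm v"
proof (rule field_le_epsilon)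
  fix e :: real assume e: "e > 0"
  \<comment> \<open>The summand \<open>e / 2\<close> keeps \<open>a\<close> and \<open>b\<close>
    positive, so that the optimal weight \<open>b / a\<close> makes sense even if one of the norms
    is zero.\<close>
  define a where "a = L2_norm u + e / 2"
  define b where "b = L2_norm v + e / 2"
  have ab: "a > 0" "b > 0" using e by (auto simp: a_def b_def add_nonneg_pos)
  have "(L2_norm (\<lambda>z. u z + v z))^2 \<le> (1 + b / a) * (L2_norm u)^2 + (1 + 1 / (b / a)) * (L2_norm v)^2"
    using L2_local_le[OF u v, of UNIV "b / a"] ab unfolding L2_norm_sq by simp
  also have "\<dots> \<le> (1 + b / a) * a^2 + (1 + 1 / (b / a)) * b^2"
    using e ab by (intro add_mono mult_left_mono power_mono) (auto simp: a_def b_def)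
  also have "\<dots> = (a + b)^2" using ab by (simp add: field_simps power2_eq_square)
  finally have "L2_norm (\<lambda>z. u z + v z) \<le> a + b"
    by (rule power2_le_imp_le) (use ab in auto)
  then show "L2_norm (\<lambda>z. u z + v z) \<le> L2_norm u + L2_norm v + e"
    by (simp add: a_def b_def)
qed

lemma L2_norm_cong_AE:
  assumes "AE z in lebesgue. u z = v z" "u \<in> L2_torus" "v \<in> L2_torus"
  shows "L2_norm u = L2_norm v"
proof -
  note [measurable] = L2_torusD(2)[OF assms(2)] L2_torusD(2)[OF assms(3)]
  show ?thesis
    unfolding L2_norm_def set_lebesgue_integral_def
    using assms(1) by (intro arg_cong[where f = sqrt] integral_cong_AE) auto
qed

subsection \<open>From quasimodes to non-observability\<close>

locale propagator =
  fixes U :: "real \<Rightarrow> (real^2 \<Rightarrow> complex) \<Rightarrow> (real^2 \<Rightarrow> complex)"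
  assumes unitary: "unitary_group U"
begin

lemma U_L2: "u \<in> L2_torus \<Longrightarrow> U t u \<in> L2_torus"
  and U_norm: "u \<in> L2_torus \<Longrightarrow> L2_norm (U t u) = L2_norm u"
  using unitary by (auto simp: unitary_group_def)

lemma U_lin: "u \<in> L2_torus \<Longrightarrow> v \<in> L2_torus \<Longrightarrow>
    AE z in lebesgue. U t (\<lambda>y. a * u y + b * v y) z = a * U t u z + b * U t v z"
  using unitary unfolding unitary_group_def by blast

lemma U_0: "u \<in> L2_torus \<Longrightarrow> AE z in lebesgue. U 0 u z = u z"
  using unitary unfolding unitary_group_def by blast

lemma U_add: "u \<in> L2_torus \<Longrightarrow> AE z in lebesgue. U (s + t) u z = U s (U t u) z"
  using unitary unfolding unitary_group_def by blast

definition drift :: "(real^2 \<Rightarrow> complex) \<Rightarrow> real \<Rightarrow> real \<Rightarrow> real" where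
  "drift u E t = L2_norm (\<lambda>z. U t u z - exp (- \<i> * t * E) * u z)"

lemma drift_0: "u \<in> L2_torus \<Longrightarrow> drift u E 0 = 0"
proof -
  assume u: "u \<in> L2_torus"
  have "drift u E 0 = L2_norm (\<lambda>z. U 0 u z - 1 * u z)" by (simp add: drift_def)
  also have "\<dots> = L2_norm (\<lambda>z. 0 * u z)"
    using U_0[OF u] by (intro L2_norm_cong_AE L2_diff L2_scale U_L2 u) auto
  finally show ?thesis by (simp only: L2_norm_scale) simp
qed

text \<open>Telescoping: run the group for time \<open>h\<close> and replace the result by the phase
  factor times \<open>u\<close>, then do the same for time \<open>t\<close>. The first error is
  carried along by the isometry \<open>U t\<close>, the second is multiplied by a number of modulus
  one.\<close>

lemma drift_add:
  assumes u: "u \<in> L2_torus"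
  shows "drift u E (t + h) \<le> drift u E t + drift u E h"
proof -
  define e where "e t = exp (- \<i> * complex_of_real t * E)" for t
  have e_add: "e (t + h) = e h * e t" "e (h + t) = e h * e t"
    by (simp_all add: e_def exp_add[symmetric] algebra_simps)
  have norm_e: "norm (e t) = 1" for t by (simp add: e_def norm_exp_eq_Re)
  have d: "drift u E t = L2_norm (\<lambda>z. U t u z - e t * u z)" for t by (simp add: drift_def e_def)
  have Uh: "U h u \<in> L2_torus" using u by (rule U_L2)
  note L2s = U_L2 u Uh L2_diff L2_scale L2_add
  have "drift u E (t + h) = L2_norm (\<lambda>z. (U t (U h u) z - e h * U t u z) + e h * (U t u z - e t * u z))"
    unfolding d using U_add[OF u, of t h]
    by (intro L2_norm_cong_AE L2s) (auto simp: e_add algebra_simps)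
  also have "\<dots> \<le> L2_norm (\<lambda>z. U t (U h u) z - e h * U t u z)
      + L2_norm (\<lambda>z. e h * (U t u z - e t * u z))"
    by (intro L2_triangle L2s)
  also have "L2_norm (\<lambda>z. e h * (U t u z - e t * u z)) = drift u E t"
    by (simp only: L2_norm_scale norm_e d mult_1)
  also have "L2_norm (\<lambda>z. U t (U h u) z - e h * U t u z)
      = L2_norm (U t (\<lambda>y. 1 * U h u y + (- e h) * u y))"
  proof (rule L2_norm_cong_AE)
    show "AE z in lebesgue. U t (U h u) z - e h * U t u z = U t (\<lambda>y. 1 * U h u y + (- e h) * u y) z"
      using U_lin[OF Uh u, of t 1 "- e h"] by auto
    show "(\<lambda>z. U t (U h u) z - e h * U t u z) \<in> L2_torus" by (intro L2s)
    show "U t (\<lambda>y. 1 * U h u y + (- e h) * u y) \<in> L2_torus"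
      by (rule U_L2[OF L2_lincomb[OF Uh u]])
  qed
  also have "\<dots> = drift u E h"
    unfolding d using U_norm[OF L2_lincomb[OF Uh u], of t 1 "- e h"] by simp
  finally show ?thesis by simp
qed

lemma drift_mult:
  assumes u: "u \<in> L2_torus"
  shows "drift u E (real n * h) \<le> real n * drift u E h"
proof (induction n)
  case (Suc n)
  have "drift u E (real (Suc n) * h) \<le> drift u E (real n * h) + drift u E h"
    using drift_add[OF u, of E "real n * h" h] by (simp add: algebra_simps)
  then show ?case using Suc by (simp add: algebra_simps)
qed (simp add: drift_0[OF u])

text \<open>The difference divided by \<open>h\<close> splits into the error of the difference
  quotient of \<open>U\<close>, the term \<open>- \<i> * (w - E * u)\<close>, and the error of the
  difference quotient of the scalar exponential. The first and third tend to 0, and the strict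
  inequality for \<open>\<eta>\<close> leaves room for them.\<close>

lemma drift_small:
  assumes g: "(u, w) \<in> generator_graph U" and eta: "L2_norm (\<lambda>z. w z - of_real E * u z) < \<eta>"
  shows "eventually (\<lambda>h. drift u E h \<le> \<bar>h\<bar> * \<eta>) (at 0)"
proof -
  have u: "u \<in> L2_torus" and w: "w \<in> L2_torus"
    and lim: "((\<lambda>h. L2_norm (\<lambda>z. (U h u z - u z) / complex_of_real h - (- \<i> * w z))) \<longlongrightarrow> 0) (at 0)"
    using g by (auto simp: generator_graph_def)
  define r where "r h = (1 - exp (- \<i> * of_real h * E)) / of_real h - \<i> * E" for h :: real
  have "((\<lambda>h::complex. (exp (- \<i> * h * E) - exp (- \<i> * 0 * E)) / h) \<longlongrightarrow> - \<i> * E) (at 0)"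
  proof -
    have "((\<lambda>h. exp (- \<i> * h * E)) has_field_derivative - \<i> * E) (at 0)"
      by (auto intro!: derivative_eq_intros)
    then show ?thesis by (simp add: has_field_derivative_iff)
  qed
  moreover have "filterlim complex_of_real (at 0) (at 0)"
    by (auto simp: filterlim_at eventually_at intro!: tendsto_eq_intros exI[of _ 1])
  ultimately have "((\<lambda>h::real. (exp (- \<i> * of_real h * E) - exp (- \<i> * 0 * E)) / of_real h)
      \<longlongrightarrow> - \<i> * E) (at 0)"
    by (rule filterlim_compose)
  then have "((\<lambda>h::real. (exp (- \<i> * of_real h * E) - 1) / of_real h) \<longlongrightarrow> - \<i> * E) (at 0)"
    by simp
  from tendsto_minus[OF this] have "((\<lambda>h::real. (1 - exp (- \<i> * of_real h * E)) / of_real h) \<longlongrightarrow> \<i> * E) (at 0)"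
    by (simp add: minus_divide_left)
  then have "(r \<longlongrightarrow> 0) (at 0)"
    unfolding r_def using LIM_zero by blast
  then have "((\<lambda>h. norm (r h) * L2_norm u) \<longlongrightarrow> 0) (at 0)"
    by (intro tendsto_mult_left_zero tendsto_norm_zero)
  from tendsto_add[OF lim this] have
    "((\<lambda>h. L2_norm (\<lambda>z. (U h u z - u z) / complex_of_real h - (- \<i> * w z)) + norm (r h) * L2_norm u) \<longlongrightarrow> 0) (at 0)"
    by simp
  then have "eventually (\<lambda>h. L2_norm (\<lambda>z. (U h u z - u z) / complex_of_real h - (- \<i> * w z)) + norm (r h) * L2_norm u
      < \<eta> - L2_norm (\<lambda>z. w z - of_real E * u z)) (at 0)"
    by (rule order_tendstoD) (use eta in simp)
  moreover have "eventually (\<lambda>h::real. h \<noteq> 0) (at 0)"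
    by (rule eventually_neq_at_within)
  ultimately show ?thesis
  proof eventually_elim
    case (elim h)
    define f1 where "f1 z = (U h u z - u z) / complex_of_real h - (- \<i> * w z)" for z
    define f2 where "f2 z = (- \<i>) * (w z - of_real E * u z)" for z
    define f3 where "f3 z = r h * u z" for z
    have f1_eq: "f1 = (\<lambda>z. (1 / of_real h) * (U h u z - u z) - (- \<i>) * w z)"
      by (auto simp: f1_def)
    have f1: "f1 \<in> L2_torus"
      unfolding f1_eq by (intro L2_diff L2_scale U_L2 u w)
    have f2: "f2 \<in> L2_torus" unfolding f2_def by (intro L2_diff L2_scale u w)
    have f3: "f3 \<in> L2_torus" unfolding f3_def by (intro L2_diff L2_scale u w)
    have "drift u E h = L2_norm (\<lambda>z. of_real h * (f1 z + (f2 z + f3 z)))"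
      unfolding drift_def using elim(2)
      by (intro arg_cong[where f = L2_norm] ext)
        (simp add: f1_def f2_def f3_def r_def field_simps)
    also have "\<dots> = \<bar>h\<bar> * L2_norm (\<lambda>z. f1 z + (f2 z + f3 z))"
      by (simp only: L2_norm_scale) simp
    also have "L2_norm (\<lambda>z. f1 z + (f2 z + f3 z)) \<le> L2_norm f1 + (L2_norm f2 + L2_norm f3)"
      using L2_triangle[OF f1 L2_add[OF f2 f3]] L2_triangle[OF f2 f3] by simp
    also have "\<dots> \<le> \<eta>"
    proof -
      have "L2_norm f2 = L2_norm (\<lambda>z. w z - of_real E * u z)"
        unfolding f2_def by (simp only: L2_norm_scale) simp
      moreover have "L2_norm f3 = norm (r h) * L2_norm u"
        unfolding f3_def by (simp only: L2_norm_scale)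
      ultimately show ?thesis using elim(1) unfolding f1_def by linarith
    qed
    finally show ?case by (simp add: mult_left_mono)
  qed
qed

text \<open>
  Subadditivity of the drift upgrades its infinitesimal bound to all times, so no differential
  inequality is needed.
\<close>

lemma drift_le:
  assumes g: "(u, w) \<in> generator_graph U" and eta: "L2_norm (\<lambda>z. w z - of_real E * u z) < \<eta>"
    and t: "0 \<le> t"
  shows "drift u E t \<le> t * \<eta>"
proof (cases "t = 0")
  case True
  then show ?thesis using drift_0[of u] g by (simp add: generator_graph_def)
next
  case False
  then have t: "t > 0" using t by simp
  have u: "u \<in> L2_torus" using g by (simp add: generator_graph_def)
  obtain d where d: "d > 0" "\<And>h. h \<noteq> 0 \<Longrightarrow> dist h 0 < d \<Longrightarrow> drift u E h \<le> \<bar>h\<bar> * \<eta>"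
    using drift_small[OF g eta] unfolding eventually_at by auto
  obtain n :: nat where n: "t / d < real n" using reals_Archimedean2 by blast
  have n0: "n > 0" using n t d by (cases n) (auto simp: divide_less_0_iff)
  have "drift u E t = drift u E (real n * (t / real n))" using n0 by simp
  also have "\<dots> \<le> real n * drift u E (t / real n)" by (rule drift_mult[OF u])
  also have "\<dots> \<le> real n * (\<bar>t / real n\<bar> * \<eta>)"
    using n n0 t d by (intro mult_left_mono d(2)) (auto simp: field_simps)
  also have "\<dots> = t * \<eta>" using n0 t by simp
  finally show ?thesis .
qed

end

text \<open>This form asks for no integrability in \<open>t\<close>: an integrand that is not
  integrable has integral 0 by the default value, and 0 obeys the bound as well.\<close>

lemma set_integral_le_const:
  fixes f :: "real \<Rightarrow> real"
  assumes "\<And>t. t \<in> {0..T} \<Longrightarrow> f t \<le> c" "0 \<le> c" "0 \<le> T"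
  shows "(LINT t:{0..T}|lborel. f t) \<le> T * c"
proof (cases "set_integrable lborel {0..T} f")
  case True
  have "(LINT t:{0..T}|lborel. f t) \<le> (LINT t:{0..T}|lborel. c)"
    using True assms by (intro set_integral_mono) (auto simp: set_integrable_def)
  also have "\<dots> = T * c" using assms by (simp add: set_lebesgue_integral_def)
  finally show ?thesis .
next
  case False
  then show ?thesis using assms
    by (simp add: set_integrable_def set_lebesgue_integral_def not_integrable_integral_eq)
qed

text \<open>Both errors are measured relative to the norm of \<open>u\<close>, so the states are
  never normalised.\<close>

definition localized_quasimode ::
    "(real^2 \<Rightarrow> real^2) \<Rightarrow> (real^2 \<Rightarrow> real) \<Rightarrow> (real^2) set \<Rightarrow> real \<Rightarrow> bool" where
  "localized_quasimode A V W \<epsilon> \<longleftrightarrow>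
     (\<exists>u w E. (u, w) \<in> schroedinger_graph A V \<and> L2_norm u > 0 \<and>
        L2_norm (\<lambda>z. w z - complex_of_real E * u z) \<le> \<epsilon> * L2_norm u \<and>
        (LINT z:torus_cell \<inter> W|lebesgue. (norm (u z))^2) \<le> \<epsilon> * (L2_norm u)^2)"

text \<open>The factor \<open>exp (- \<i> * t * E)\<close> has modulus one, so the approximate
  solution keeps its small mass on \<open>\<omega>\<close> at all times, and the exact one differs
  from it by the drift only.\<close>

lemma not_observable_of_quasimodes:
  assumes pr: "schroedinger_propagator A V U" and \<omega>: "torus_open \<omega>" and T: "T > 0"
    and quasi: "\<And>\<epsilon>::real. \<epsilon> > 0 \<Longrightarrow> localized_quasimode A V \<omega> \<epsilon>"
  shows "\<not> observable U \<omega> T"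
proof
  assume "observable U \<omega> T"
  then obtain C where C: "C > 0" "\<And>u. u \<in> L2_torus \<Longrightarrow> (L2_norm u)^2 \<le>
          C * (LINT t:{0..T}|lborel. LINT z:torus_cell \<inter> \<omega>|lebesgue. (norm (U t u z))^2)"
    unfolding observable_def by blast
  interpret propagator U
    using pr by unfold_locales (simp add: schroedinger_propagator_def)
  have \<omega>m: "\<omega> \<in> sets lebesgue" using \<omega> by (auto simp: torus_open_def)
  \<comment> \<open>The observed share of the norm: \<open>2 * \<epsilon>\<close> comes from the
    state itself, the square from its drift \<open>2 * T * \<epsilon>\<close> up to time
    \<open>T\<close>; the factors \<open>T\<close> and \<open>C\<close> come from the time integral
    and from the inequality to be refuted.\<close>
  define b where "b \<epsilon> = C * (T * (2 * \<epsilon> + 2 * (T * (2 * \<epsilon>))^2))" for \<epsilon>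
  have "((\<lambda>\<epsilon>. b \<epsilon>) \<longlongrightarrow> b 0) (at_right 0)"
    unfolding b_def by (intro tendsto_intros)
  then have "eventually (\<lambda>\<epsilon>. b \<epsilon> < 1) (at_right 0)"
    by (rule order_tendstoD) (simp add: b_def)
  moreover have "eventually (\<lambda>\<epsilon>::real. \<epsilon> > 0) (at_right 0)" by (rule eventually_at_right_less)
  ultimately have "eventually (\<lambda>\<epsilon>. b \<epsilon> < 1 \<and> \<epsilon> > 0) (at_right 0)"
    by eventually_elim simp
  then obtain \<epsilon> where \<epsilon>: "\<epsilon> > 0" "b \<epsilon> < 1"
    using eventually_happens'[OF trivial_limit_at_right_real] by blast
  obtain u w E where uw: "(u, w) \<in> schroedinger_graph A V" and u0: "L2_norm u > 0" and
    E: "L2_norm (\<lambda>z. w z - complex_of_real E * u z) \<le> \<epsilon> * L2_norm u" and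
    I: "(LINT z:torus_cell \<inter> \<omega>|lebesgue. (norm (u z))^2) \<le> \<epsilon> * (L2_norm u)^2"
    using quasi[OF \<epsilon>(1)] unfolding localized_quasimode_def by blast
  have g: "(u, w) \<in> generator_graph U"
    using uw pr by (simp add: schroedinger_propagator_def)
  have u: "u \<in> L2_torus" using g by (simp add: generator_graph_def)
  define N where "N = L2_norm u"
  \<comment> \<open>Doubling \<open>\<epsilon>\<close> makes the inequality strict, as
    \<open>drift_le\<close> demands.\<close>
  have E': "L2_norm (\<lambda>z. w z - of_real E * u z) < 2 * \<epsilon> * N"
  proof -
    have "\<epsilon> * N > 0" using \<epsilon> u0 by (simp add: N_def)
    then show ?thesis using E by (simp add: N_def)
  qed
  have "(LINT z:torus_cell \<inter> \<omega>|lebesgue. (norm (U t u z))^2) \<le> (2 * \<epsilon> + 2 * (T * (2 * \<epsilon>))^2) * N^2"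
    if t: "t \<in> {0..T}" for t
  proof -
    define e where "e = exp (- \<i> * complex_of_real t * E)"
    have ne: "norm e = 1" by (simp add: e_def norm_exp_eq_Re)
    have d: "(\<lambda>z. U t u z - e * u z) \<in> L2_torus" by (intro L2_diff U_L2 u L2_scale)
    have "(LINT z:torus_cell \<inter> \<omega>|lebesgue. (norm (U t u z))^2)
      = (LINT z:torus_cell \<inter> \<omega>|lebesgue. (norm (e * u z + (U t u z - e * u z)))^2)" by simp
    also have "\<dots> \<le> (1 + 1) * (LINT z:torus_cell \<inter> \<omega>|lebesgue. (norm (e * u z))^2)
      + (1 + 1 / 1) * (LINT z:torus_cell \<inter> \<omega>|lebesgue. (norm (U t u z - e * u z))^2)"
      by (rule L2_local_le) (auto intro: L2_scale u d \<omega>m)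
    also have "(LINT z:torus_cell \<inter> \<omega>|lebesgue. (norm (e * u z))^2) \<le> \<epsilon> * N^2"
      using I by (simp add: norm_mult ne N_def)
    also have "(LINT z:torus_cell \<inter> \<omega>|lebesgue. (norm (U t u z - e * u z))^2) \<le> (drift u E t)^2"
      unfolding drift_def e_def[symmetric] by (rule L2_local_mono[OF d \<omega>m])
    also have "\<dots> \<le> (T * (2 * \<epsilon> * N))^2"
    proof (rule power_mono)
      have "drift u E t \<le> t * (2 * \<epsilon> * N)" using drift_le[OF g E'] t by simp
      also have "\<dots> \<le> T * (2 * \<epsilon> * N)"
        using t \<epsilon> u0 by (intro mult_right_mono) (auto simp: N_def)
      finally show "drift u E t \<le> T * (2 * \<epsilon> * N)" .
      show "0 \<le> drift u E t" by (simp add: drift_def)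
    qed
    finally show ?thesis by (simp add: algebra_simps power2_eq_square)
  qed
  then have "(LINT t:{0..T}|lborel. LINT z:torus_cell \<inter> \<omega>|lebesgue. (norm (U t u z))^2)
      \<le> T * ((2 * \<epsilon> + 2 * (T * (2 * \<epsilon>))^2) * N^2)"
    using T \<epsilon> by (intro set_integral_le_const) auto
  from mult_left_mono[OF this less_imp_le[OF C(1)]] C(2)[OF u]
  have "N^2 \<le> C * (T * ((2 * \<epsilon> + 2 * (T * (2 * \<epsilon>))^2) * N^2))"
    unfolding N_def by (rule order_trans[rotated])
  also have "\<dots> = b \<epsilon> * N^2" by (simp add: b_def)
  also have "\<dots> < N^2" using \<epsilon> u0 by (simp add: N_def)
  finally show False by simp
qed

subsection \<open>Functions of given order in the transversal variable\<close>

text \<open>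
  The orders are uniform in the frequency parameter \<open>k \<ge> 1\<close> and in \<open>s\<close>; only the power of the
  transversal variable \<open>r\<close>, taken in one period, is recorded.
\<close>

definition vanish :: "nat \<Rightarrow> (real \<Rightarrow> real \<Rightarrow> real \<Rightarrow> real) \<Rightarrow> bool" where
  "vanish n g \<longleftrightarrow> (\<exists>C\<ge>0. \<forall>k\<ge>1. \<forall>s r. \<bar>r\<bar> \<le> pi \<longrightarrow> \<bar>g k s r\<bar> \<le> C * \<bar>r\<bar> ^ n)"

lemma vanish_I:
  assumes "\<And>k s r. k \<ge> 1 \<Longrightarrow> \<bar>r\<bar> \<le> pi \<Longrightarrow> \<bar>g k s r\<bar> \<le> C * \<bar>r\<bar> ^ n"
  shows "vanish n g"
proof -
  have "\<bar>g k s r\<bar> \<le> \<bar>C\<bar> * \<bar>r\<bar> ^ n" if "k \<ge> 1" "\<bar>r\<bar> \<le> pi" for k s r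
    using assms[OF that] by (meson abs_ge_self dual_order.trans mult_right_mono zero_le_power abs_ge_zero)
  then show ?thesis unfolding vanish_def by (intro exI[of _ "\<bar>C\<bar>"]) auto
qed

lemma vanish_E:
  assumes "vanish n g"
  obtains C where "C \<ge> 0" "\<And>k s r. k \<ge> 1 \<Longrightarrow> \<bar>r\<bar> \<le> pi \<Longrightarrow> \<bar>g k s r\<bar> \<le> C * \<bar>r\<bar> ^ n"
  using assms unfolding vanish_def by blast

lemma vanish_cong: "vanish n h \<Longrightarrow> (\<And>k s r. k \<ge> 1 \<Longrightarrow> g k s r = h k s r) \<Longrightarrow> vanish n g"
  unfolding vanish_def by simp

lemma vanish_add: "vanish n g \<Longrightarrow> vanish n h \<Longrightarrow> vanish n (\<lambda>k s r. g k s r + h k s r)"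
proof -
  assume "vanish n g" "vanish n h"
  then obtain C D where "\<And>k s r. k \<ge> 1 \<Longrightarrow> \<bar>r\<bar> \<le> pi \<Longrightarrow> \<bar>g k s r\<bar> \<le> C * \<bar>r\<bar> ^ n"
    and "\<And>k s r. k \<ge> 1 \<Longrightarrow> \<bar>r\<bar> \<le> pi \<Longrightarrow> \<bar>h k s r\<bar> \<le> D * \<bar>r\<bar> ^ n"
    by (metis vanish_E)
  then show ?thesis
    by (intro vanish_I[where C = "C + D"])
      (auto simp: distrib_right intro!: order_trans[OF abs_triangle_ineq] add_mono)
qed

lemma vanish_mult_eq:
  assumes "vanish m g" "vanish n h"
  shows "vanish (m + n) (\<lambda>k s r. g k s r * h k s r)"
proof -
  obtain C D where "C \<ge> 0" "\<And>k s r. k \<ge> 1 \<Longrightarrow> \<bar>r\<bar> \<le> pi \<Longrightarrow> \<bar>g k s r\<bar> \<le> C * \<bar>r\<bar> ^ m"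
    and "\<And>k s r. k \<ge> 1 \<Longrightarrow> \<bar>r\<bar> \<le> pi \<Longrightarrow> \<bar>h k s r\<bar> \<le> D * \<bar>r\<bar> ^ n"
    using assms by (metis vanish_E)
  then have "\<bar>g k s r * h k s r\<bar> \<le> (C * \<bar>r\<bar> ^ m) * (D * \<bar>r\<bar> ^ n)" if "k \<ge> 1" "\<bar>r\<bar> \<le> pi" for k s r
    using that by (auto simp: abs_mult intro!: mult_mono)
  then show ?thesis
    by (intro vanish_I[where C = "C * D"]) (auto simp: power_add ac_simps)
qed

text \<open>Each lost power of \<open>r\<close> costs a factor \<open>pi\<close>; this is where the
  restriction to one period enters.\<close>

lemma vanish_weaken:
  assumes "vanish n g" "m \<le> n"
  shows "vanish m g"
proof -
  obtain C where C: "C \<ge> 0" "\<And>k s r. k \<ge> 1 \<Longrightarrow> \<bar>r\<bar> \<le> pi \<Longrightarrow> \<bar>g k s r\<bar> \<le> C * \<bar>r\<bar> ^ n"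
    using assms(1) by (metis vanish_E)
  have "\<bar>r\<bar> ^ n \<le> pi ^ (n - m) * \<bar>r\<bar> ^ m" if "\<bar>r\<bar> \<le> pi" for r :: real
  proof -
    have "\<bar>r\<bar> ^ n = \<bar>r\<bar> ^ (n - m) * \<bar>r\<bar> ^ m" using assms(2) by (simp flip: power_add)
    also have "\<dots> \<le> pi ^ (n - m) * \<bar>r\<bar> ^ m" using that by (intro mult_right_mono power_mono) auto
    finally show ?thesis .
  qed
  then have "\<bar>g k s r\<bar> \<le> C * (pi ^ (n - m) * \<bar>r\<bar> ^ m)" if "k \<ge> 1" "\<bar>r\<bar> \<le> pi" for k s r
    using that C by (meson mult_left_mono order_trans)
  then show ?thesis by (intro vanish_I[where C = "C * pi ^ (n - m)"]) (auto simp: ac_simps)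
qed

lemma vanish_mult: "vanish m g \<Longrightarrow> vanish n h \<Longrightarrow> l \<le> m + n \<Longrightarrow> vanish l (\<lambda>k s r. g k s r * h k s r)"
  using vanish_mult_eq vanish_weaken by blast

lemma vanish_minus: "vanish n g \<Longrightarrow> vanish n (\<lambda>k s r. - g k s r)"
  unfolding vanish_def by simp

lemma vanish_diff: "vanish n g \<Longrightarrow> vanish n h \<Longrightarrow> vanish n (\<lambda>k s r. g k s r - h k s r)"
  using vanish_add[OF _ vanish_minus, of n g h] by simp

lemma vanish_const: "vanish 0 (\<lambda>k s r. c)"
  by (rule vanish_I[where C = "\<bar>c\<bar>"]) auto

lemma vanish_zero: "vanish n (\<lambda>k s r. 0)"
  by (rule vanish_I[where C = 0]) auto

lemma vanish_inverse: "vanish 0 (\<lambda>k s r. 1 / k)"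
  by (rule vanish_I[where C = 1]) (auto simp: divide_le_eq_1)

lemma vanish_sin: "vanish 1 (\<lambda>k s r. sin r)"
  by (rule vanish_I[where C = 1]) (auto simp: abs_sin_x_le_abs_x)

lemma vanish_cos: "vanish 0 (\<lambda>k s r. cos r)"
  by (rule vanish_I[where C = 1]) auto

lemma vanish_cos_1: "vanish 2 (\<lambda>k s r. 1 - cos r)"
proof (rule vanish_I[where C = 1])
  fix r :: real
  have "1 - cos r = 2 * (sin (r / 2))^2"
    using cos_double_sin[of "r / 2"] by simp
  also have "\<dots> \<le> 2 * (\<bar>r / 2\<bar>)^2"
    using power_mono[OF abs_sin_x_le_abs_x[of "r / 2"], of 2] by simp
  also have "\<dots> \<le> 1 * \<bar>r\<bar>^2" by (simp add: power_divide)
  finally show "\<bar>1 - cos r\<bar> \<le> 1 * \<bar>r\<bar>^2" by simp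
qed

lemma vanish_power: "vanish m g \<Longrightarrow> l \<le> m * j \<Longrightarrow> vanish l (\<lambda>k s r. g k s r ^ j)"
proof (induction j arbitrary: l)
  case 0
  then show ?case using vanish_const[of 1] by simp
next
  case (Suc j)
  have "vanish (m * j) (\<lambda>k s r. g k s r ^ j)" using Suc by simp
  from vanish_mult[OF Suc.prems(1) this, of l] show ?case using Suc.prems by simp
qed

lemma vanish_sin_power: "l \<le> j \<Longrightarrow> vanish l (\<lambda>k s r. sin r ^ j)"
  using vanish_power[OF vanish_sin, of l j] by simp

lemma vanish_cos_1_power: "l \<le> 2 * j \<Longrightarrow> vanish l (\<lambda>k s r. (1 - cos r) ^ j)"
  using vanish_power[OF vanish_cos_1, of l j] by simp

lemma vanish_cos_power: "vanish 0 (\<lambda>k s r. cos r ^ j)"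
  using vanish_power[OF vanish_cos, of 0 j] by simp

lemma vanish_0: "vanish n g \<Longrightarrow> vanish 0 g"
  by (rule vanish_weaken) auto

lemma vanish_bounded: "bounded (range h) \<Longrightarrow> vanish 0 (\<lambda>k s r. h s)"
proof -
  assume "bounded (range h)"
  then obtain C where "\<And>s. \<bar>h s\<bar> \<le> C" unfolding bounded_iff by auto
  then show ?thesis by (intro vanish_I[where C = C]) auto
qed

lemma vanish_times: "vanish 0 g \<Longrightarrow> vanish n h \<Longrightarrow> vanish n (\<lambda>k s r. g k s r * h k s r)"
  using vanish_mult[of 0 g n h n] by simp

lemma vanish_times': "vanish n g \<Longrightarrow> vanish 0 h \<Longrightarrow> vanish n (\<lambda>k s r. g k s r * h k s r)"
  using vanish_mult[of n g 0 h n] by simp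

lemmas vanish_0_intros = vanish_add vanish_diff vanish_minus vanish_const vanish_cos vanish_sin[THEN vanish_0] vanish_sin_power
  vanish_cos_power vanish_cos_1_power

subsection \<open>The WKB expansion\<close>

text \<open>
  The functions \<open>f\<close>, \<open>p\<close>, \<open>v\<close> stand for \<open>A \<bullet> m\<close>, \<open>A \<bullet> mp\<close>, \<open>V\<close> in coordinates \<open>z = z0 + s m + r n\<close>,
  where \<open>mp\<close> is \<open>m\<close> turned by a right angle, \<open>\<mu> = m \<bullet> m\<close> and \<open>d = m \<bullet> n\<close>; the derivative along \<open>mp\<close>
  is \<open>\<mu> \<partial>_r - d \<partial>_s\<close>.  The longitudinal frequency is \<open>\<sigma> k^2\<close>.  In \<open>P_re\<close> below the assumptions \<open>c2\<close>,
  \<open>c3\<close>, \<open>c4\<close> cancel the coefficients of \<open>k^2 r^2\<close>, \<open>k^2 r^3\<close>, \<open>k^2 r^4\<close>, then \<open>t0\<close>, \<open>t1\<close> those of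
  \<open>k r\<close>, \<open>k r^2\<close>, and \<open>\<eta>\<close> the constant one; in \<open>P_im\<close> the assumptions \<open>\<rho>1\<close>, \<open>\<rho>2\<close>, \<open>\<rho>0\<close> cancel those of
  \<open>k r\<close>, \<open>k r^2\<close> and \<open>1\<close>.  Powers of \<open>sin r\<close> replace those of \<open>r\<close> to keep everything periodic.
\<close>

locale quasimode =
  fixes \<mu> d \<sigma> c c2 c3 t0 t1 M e :: real and b :: "nat \<Rightarrow> real"
    and \<alpha> \<alpha>' \<phi> \<phi>' \<phi>'' \<rho> \<rho>' \<rho>'' :: "nat \<Rightarrow> real \<Rightarrow> real"
    and \<eta> \<eta>' \<eta>'' \<beta>0 \<beta>0' \<beta>1 v0 :: "real \<Rightarrow> real"
    and f fs p ps pr v :: "real \<Rightarrow> real \<Rightarrow> real"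
  assumes \<sigma>: "\<sigma>^2 = 1"
    and f: "vanish 5 (\<lambda>k s r. f s r - (\<alpha> 0 s + \<alpha> 1 s * sin r + \<alpha> 2 s * sin r ^ 2 + \<alpha> 3 s * sin r ^ 3 + \<alpha> 4 s * sin r ^ 4))"
    and fs: "vanish 1 (\<lambda>k s r. fs s r - \<alpha>' 0 s)"
    and p: "vanish 2 (\<lambda>k s r. p s r - (\<beta>0 s + \<beta>1 s * sin r))"
    and ps: "vanish 1 (\<lambda>k s r. ps s r - \<beta>0' s)"
    and pr: "vanish 1 (\<lambda>k s r. pr s r - \<beta>1 s)"
    and v: "vanish 1 (\<lambda>k s r. v s r - v0 s)"
    and bdd: "\<And>j. bounded (range (\<phi> j))" "\<And>j. bounded (range (\<phi>' j))" "\<And>j. bounded (range (\<phi>'' j))"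
      "\<And>j. bounded (range (\<rho> j))" "\<And>j. bounded (range (\<rho>' j))" "\<And>j. bounded (range (\<rho>'' j))"
      "bounded (range \<eta>)" "bounded (range \<eta>')" "bounded (range \<eta>'')"
      "bounded (range \<beta>0)" "bounded (range \<beta>0')" "bounded (range \<beta>1)" "bounded (range v0)"
    and \<phi>': "\<And>j s. \<phi>' j s = \<alpha> j s - b j" and \<phi>''0: "\<And>s. \<phi>'' 0 s = \<alpha>' 0 s"
    and b1: "b 1 = 0"
    and c2: "\<mu>^2 * c^2 = - 2 * \<sigma> * b 2"
    and c3: "\<mu>^2 * (2 * c * c2) = - 2 * \<sigma> * b 3"
    and c4: "\<mu>^2 * (c2^2 + 2 * c * c3 - c^2) = - 2 * \<sigma> * b 4"
    and t0: "c * t0 = c2" and t1: "3 * c3 - 2 * c = 2 * (t0 * c2 + t1 * c)"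
    and \<rho>1: "\<And>s. \<rho>' 1 s = - \<mu> * c * (\<beta>0 s - \<mu> * \<phi> 1 s + d * \<phi>' 0 s)"
    and \<rho>2: "\<And>s. \<rho>' 2 s = - \<mu> * (c2 * (\<beta>0 s - \<mu> * \<phi> 1 s + d * \<phi>' 0 s)
                + c * (\<beta>1 s - 2 * \<mu> * \<phi> 2 s + d * \<phi>' 1 s))"
    and \<rho>0: "\<And>s. 2 * \<rho>' 0 s = \<mu> * (\<beta>1 s - 2 * \<mu> * \<phi> 2 s + d * \<phi>' 1 s)
                - d * (\<beta>0' s - \<mu> * \<phi>' 1 s + d * \<phi>'' 0 s) - 2 * \<mu> * t0 * (\<beta>0 s - \<mu> * \<phi> 1 s + d * \<phi>' 0 s)"
    and \<eta>: "\<And>s. 2 * \<eta>' s = e - (\<beta>0 s - \<mu> * \<phi> 1 s + d * \<phi>' 0 s)^2 - \<mu> * v0 s"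
begin

text \<open>\<open>exp (- k * \<Phi>)\<close> is the Gaussian with its anharmonic corrections, and
  \<open>\<tau>\<close> is the derivative of its first amplitude correction. All derivatives are
  introduced as explicit formulas, so that the expansion is pure algebra; that they really are
  derivatives is shown later, by the lemmas on \<open>partials\<close>.\<close>

definition \<Phi> where "\<Phi> r = c * sin r ^ 2 / 2 + c2 * sin r ^ 3 / 3 + c3 * sin r ^ 4 / 4 + M * (1 - cos r) ^ 3"
definition Q where "Q r = c * sin r + c2 * sin r ^ 2 + c3 * sin r ^ 3"
definition \<Phi>' where "\<Phi>' r = Q r * cos r + 3 * M * (1 - cos r) ^ 2 * sin r"
definition \<Phi>'' where "\<Phi>'' r = (c + 2 * c2 * sin r + 3 * c3 * sin r ^ 2) * cos r ^ 2 - Q r * sin r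
  + 3 * M * (2 * (1 - cos r) * sin r ^ 2 + (1 - cos r) ^ 2 * cos r)"
definition \<tau> where "\<tau> r = (t0 + t1 * sin r) * cos r"
definition \<tau>' where "\<tau>' r = t1 * cos r ^ 2 - (t0 + t1 * sin r) * sin r"

definition ph where "ph s r = \<phi> 0 s + \<phi> 1 s * sin r + \<phi> 2 s * sin r ^ 2 + \<phi> 3 s * sin r ^ 3 + \<phi> 4 s * sin r ^ 4"
definition ph_s where "ph_s s r = \<phi>' 0 s + \<phi>' 1 s * sin r + \<phi>' 2 s * sin r ^ 2 + \<phi>' 3 s * sin r ^ 3 + \<phi>' 4 s * sin r ^ 4"
definition ph_ss where "ph_ss s r = \<phi>'' 0 s + \<phi>'' 1 s * sin r + \<phi>'' 2 s * sin r ^ 2 + \<phi>'' 3 s * sin r ^ 3 + \<phi>'' 4 s * sin r ^ 4"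
definition ph_r where "ph_r s r = (\<phi> 1 s + 2 * \<phi> 2 s * sin r + 3 * \<phi> 3 s * sin r ^ 2 + 4 * \<phi> 4 s * sin r ^ 3) * cos r"
definition ph_sr where "ph_sr s r = (\<phi>' 1 s + 2 * \<phi>' 2 s * sin r + 3 * \<phi>' 3 s * sin r ^ 2 + 4 * \<phi>' 4 s * sin r ^ 3) * cos r"
definition ph_rr where "ph_rr s r = (2 * \<phi> 2 s + 6 * \<phi> 3 s * sin r + 12 * \<phi> 4 s * sin r ^ 2) * cos r ^ 2
  - (\<phi> 1 s + 2 * \<phi> 2 s * sin r + 3 * \<phi> 3 s * sin r ^ 2 + 4 * \<phi> 4 s * sin r ^ 3) * sin r"

definition X where "X k s r = - (k * \<Phi> r + t0 * sin r + t1 * sin r ^ 2 / 2)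
  + \<sigma> / k * (\<rho> 1 s * sin r + \<rho> 2 s * sin r ^ 2) + \<sigma> / k^2 * \<rho> 0 s"
definition X_s where "X_s k s r = \<sigma> / k * (\<rho>' 1 s * sin r + \<rho>' 2 s * sin r ^ 2) + \<sigma> / k^2 * \<rho>' 0 s"
definition X_ss where "X_ss k s r = \<sigma> / k * (\<rho>'' 1 s * sin r + \<rho>'' 2 s * sin r ^ 2) + \<sigma> / k^2 * \<rho>'' 0 s"
definition X_r where "X_r k s r = - (k * \<Phi>' r + \<tau> r) + \<sigma> / k * ((\<rho> 1 s + 2 * \<rho> 2 s * sin r) * cos r)"
definition X_sr where "X_sr k s r = \<sigma> / k * ((\<rho>' 1 s + 2 * \<rho>' 2 s * sin r) * cos r)"
definition X_rr where "X_rr k s r = - (k * \<Phi>'' r + \<tau>' r)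
  + \<sigma> / k * (2 * \<rho> 2 s * cos r ^ 2 - (\<rho> 1 s + 2 * \<rho> 2 s * sin r) * sin r)"

text \<open>\<open>Bf\<close> is the component of \<open>A\<close> along \<open>mp\<close> after the
  gauge change by \<open>ph\<close>, and \<open>B0\<close>, \<open>B1\<close> are its first two
  coefficients in powers of \<open>sin r\<close>. These are the functions of \<open>s\<close> that
  the correctors \<open>\<rho>\<close> have to absorb.\<close>

definition Bf where "Bf s r = p s r - (\<mu> * ph_r s r - d * ph_s s r)"
definition B0 where "B0 s = \<beta>0 s - \<mu> * \<phi> 1 s + d * \<phi>' 0 s"
definition B1 where "B1 s = \<beta>1 s - 2 * \<mu> * \<phi> 2 s + d * \<phi>' 1 s"

text \<open>The energy for \<open>\<mu> H\<close>: kinetic energy of the longitudinal wave with the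
  averaged potential \<open>b 0\<close>, the ground state energy \<open>\<mu>^2 * k * c\<close> of
  the harmonic oscillator, and the constants of order one.\<close>

definition E where "E k = k ^ 4 - 2 * \<sigma> * k^2 * b 0 + (b 0)^2 + e - \<mu>^2 * t0^2 + \<mu>^2 * k * c + \<mu>^2 * t1"

text \<open>
  For \<open>u = exp (X + i Y)\<close> with \<open>Y\<close> of longitudinal derivative \<open>\<sigma> k^2 + ph_s + \<sigma> \<eta>' / k^2\<close>, one has
  \<open>\<mu> H u = (P_re - i P_im) u\<close>.
\<close>

definition P_re where "P_re k s r = (\<sigma> * k^2 + ph_s s r + \<sigma> / k^2 * \<eta>' s - f s r)^2
  + (\<mu> * ph_r s r - d * (ph_s s r + \<sigma> / k^2 * \<eta>' s) - p s r)^2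
  - (X_s k s r)^2 - (\<mu> * X_r k s r - d * X_s k s r)^2
  - X_ss k s r - (\<mu>^2 * X_rr k s r - 2 * \<mu> * d * X_sr k s r + d^2 * X_ss k s r) + \<mu> * v s r"

definition P_im where "P_im k s r =
  2 * ((\<sigma> * k^2 + ph_s s r + \<sigma> / k^2 * \<eta>' s - f s r) * X_s k s r
    + (\<mu> * ph_r s r - d * (ph_s s r + \<sigma> / k^2 * \<eta>' s) - p s r) * (\<mu> * X_r k s r - d * X_s k s r))
  + (ph_ss s r + \<sigma> / k^2 * \<eta>'' s - fs s r)
  + (\<mu>^2 * ph_rr s r - 2 * \<mu> * d * ph_sr s r + d^2 * (ph_ss s r + \<sigma> / k^2 * \<eta>'' s) - (\<mu> * pr s r - d * ps s r))"

definition e5 where "e5 s r = f s r - (\<alpha> 0 s + \<alpha> 1 s * sin r + \<alpha> 2 s * sin r ^ 2 + \<alpha> 3 s * sin r ^ 3 + \<alpha> 4 s * sin r ^ 4)"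

section \<open>Cancellation of the expansion, one power of the frequency at a time\<close>

definition q where "q s r = f s r - ph_s s r - b 0"

text \<open>The primitives \<open>\<phi>\<close> remove the oscillation along the geodesic, so only
  the means \<open>b j\<close> survive; the linear one is zero at the critical point.\<close>

lemma q_eq: "q s r = b 2 * sin r ^ 2 + b 3 * sin r ^ 3 + b 4 * sin r ^ 4 + e5 s r"
  by (simp add: q_def ph_s_def \<phi>' e5_def b1[simplified] algebra_simps)

lemmas vanish_bdd = bdd[THEN vanish_bounded]

lemma cos_sq: "(cos r)^2 = 1 - (sin r)^2" for r :: real
  by (simp add: cos_squared_eq)

lemma vanish_Q: "vanish 1 (\<lambda>k s r. Q r)"
  unfolding Q_def
  by (intro vanish_add vanish_times vanish_const vanish_sin vanish_sin_power) auto

lemma vanish_\<Phi>': "vanish 1 (\<lambda>k s r. \<Phi>' r)"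
  unfolding \<Phi>'_def
  by (intro vanish_add vanish_times vanish_times'[OF vanish_Q] vanish_const vanish_cos vanish_sin vanish_mult vanish_cos_1_power) auto

lemma vanish_\<tau>: "vanish 0 (\<lambda>k s r. \<tau> r)"
  unfolding \<tau>_def by (intro vanish_0_intros vanish_times; simp)

lemma vanish_\<tau>': "vanish 0 (\<lambda>k s r. \<tau>' r)"
  unfolding \<tau>'_def by (intro vanish_0_intros vanish_times; simp)

text \<open>The eikonal equation, at order \<open>k^2\<close>. The summand \<open>- c^2\<close> in
  \<open>c4\<close> arises because \<open>\<Phi>'\<close> contains the factor \<open>cos r\<close>,
  whose square \<open>1 - (sin r)^2\<close> shifts the quadratic coefficient to order four. The term
  with \<open>M\<close> enters beyond the orders that are matched.\<close>

lemma vanish_re2: "vanish 5 (\<lambda>k s r. - 2 * \<sigma> * q s r - \<mu>^2 * (\<Phi>' r)^2)"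
proof -
  define R1 where "R1 r = 2 * c2 * c3 - 2 * c * c2 + (c3^2 - c2^2 - 2 * c * c3) * sin r
    - 2 * c2 * c3 * sin r ^ 2 - c3^2 * sin r ^ 3" for r
  define R2 where "R2 r = sin r * (6 * M * Q r * cos r + 9 * M^2 * (1 - cos r) ^ 2 * sin r)" for r
  have 1: "(\<Phi>' r)^2 = (c^2 * sin r ^ 2 + 2 * c * c2 * sin r ^ 3 + (c2^2 + 2 * c * c3 - c^2) * sin r ^ 4)
      + (sin r ^ 5 * R1 r + (1 - cos r) ^ 2 * R2 r)" for r
  proof -
    have "(\<Phi>' r)^2 = (Q r)^2 * (cos r)^2 + (1 - cos r) ^ 2 * R2 r"
      unfolding \<Phi>'_def R2_def by algebra
    also have "(Q r)^2 * (cos r)^2 = c^2 * sin r ^ 2 + 2 * c * c2 * sin r ^ 3 + (c2^2 + 2 * c * c3 - c^2) * sin r ^ 4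
      + sin r ^ 5 * R1 r"
      unfolding cos_sq Q_def R1_def by algebra
    finally show ?thesis by simp
  qed
  have 2: "- 2 * \<sigma> * q s r - \<mu>^2 * (\<Phi>' r)^2 = - 2 * \<sigma> * e5 s r
      - \<mu>\<^sup>2 * (sin r ^ 5 * R1 r + (1 - cos r) ^ 2 * R2 r)" for s r
  proof -
    have "- 2 * \<sigma> * q s r - \<mu>^2 * (\<Phi>' r)^2 = (- 2 * \<sigma> * b 2 - \<mu>^2 * c^2) * sin r ^ 2
      + (- 2 * \<sigma> * b 3 - \<mu>^2 * (2 * c * c2)) * sin r ^ 3
      + (- 2 * \<sigma> * b 4 - \<mu>^2 * (c2^2 + 2 * c * c3 - c^2)) * sin r ^ 4
      - 2 * \<sigma> * e5 s r - \<mu>^2 * (sin r ^ 5 * R1 r + (1 - cos r) ^ 2 * R2 r)"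
      unfolding q_eq 1 by (simp only: ring_distribs mult.assoc mult.left_commute add.assoc)
    then show ?thesis unfolding c2 c3 c4 by simp
  qed
  have R: "vanish 0 (\<lambda>k s r. R1 r)" "vanish 1 (\<lambda>k s r. R2 r)"
    unfolding R1_def R2_def
    by (intro vanish_0_intros vanish_times vanish_0[OF vanish_Q]; simp)
      (intro vanish_times'[OF vanish_sin] vanish_0_intros vanish_times vanish_0[OF vanish_Q]; simp)
  show ?thesis
    unfolding 2
    by (intro vanish_diff vanish_add vanish_times[OF vanish_const] f[folded e5_def] R
        vanish_times'[OF vanish_sin_power] vanish_mult[OF vanish_cos_1_power[of 4] R(2)]) auto
qed

text \<open>The transport equation, at order \<open>k\<close>, after the oscillator energy
  \<open>c\<close> has been subtracted. The summand \<open>- 2 * c\<close> in \<open>t1\<close> has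
  two equal sources: \<open>c * cos r ^ 2 - c\<close> and \<open>- Q r * sin r\<close>.\<close>

lemma vanish_re1: "vanish 3 (\<lambda>k s r. - 2 * \<Phi>' r * \<tau> r + \<Phi>'' r - c)"
proof -
  define R1 where "R1 r = - 2 * (c2 * t1 + c3 * t0 + c3 * t1 * sin r) - 2 * c2 - 3 * c3 * sin r
       + 2 * (c + c2 * sin r + c3 * sin r ^ 2) * (t0 + t1 * sin r) - c2 - c3 * sin r" for r
  define R2 where "R2 r = 3 * M * cos r - 6 * M * sin r * \<tau> r" for r
  have eq: "- 2 * \<Phi>' r * \<tau> r + \<Phi>'' r - c =
     sin r ^ 3 * R1 r + (1 - cos r) ^ 2 * R2 r + (1 - cos r) ^ 1 * sin r ^ 2 * (6 * M)" for r
  proof -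
    have "- 2 * \<Phi>' r * \<tau> r + \<Phi>'' r - c =
      (- 2 * Q r * (t0 + t1 * sin r) * (cos r)^2 + (c + 2 * c2 * sin r + 3 * c3 * sin r ^ 2) * (cos r)^2
      - Q r * sin r - c)
      + ((1 - cos r) ^ 2 * R2 r + (1 - cos r) ^ 1 * sin r ^ 2 * (6 * M))"
      unfolding \<Phi>'_def \<Phi>''_def \<tau>_def R2_def by algebra
    also have "- 2 * Q r * (t0 + t1 * sin r) * (cos r)^2 + (c + 2 * c2 * sin r + 3 * c3 * sin r ^ 2) * (cos r)^2
      - Q r * sin r - c = sin r ^ 3 * R1 r
       + 2 * sin r * (c2 - c * t0) + sin r ^ 2 * (3 * c3 - 2 * c - 2 * (t0 * c2 + t1 * c))"
      unfolding cos_sq Q_def R1_def by algebra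
    also have "2 * sin r * (c2 - c * t0) = 0" using t0 by simp
    also have "sin r ^ 2 * (3 * c3 - 2 * c - 2 * (t0 * c2 + t1 * c)) = 0" using t1 by simp
    finally show ?thesis by simp
  qed
  have R: "vanish 0 (\<lambda>k s r. R1 r)" "vanish 0 (\<lambda>k s r. R2 r)"
    unfolding R1_def R2_def by (intro vanish_0_intros vanish_times vanish_\<tau>; simp)+
  have 3: "vanish 3 (\<lambda>k s r. (1 - cos r) ^ 1 * sin r ^ 2)"
    by (rule vanish_mult[OF vanish_cos_1_power[of 2] vanish_sin_power[of 2]]) auto
  show ?thesis
    unfolding eq
    by (intro vanish_add vanish_times'[OF vanish_sin_power R(1)] vanish_times'[OF vanish_cos_1_power R(2)]
        vanish_times'[OF 3 vanish_const]) auto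
qed

lemma Bf_eq: "Bf s r - (B0 s + B1 s * sin r) =
   (p s r - (\<beta>0 s + \<beta>1 s * sin r))
   + (1 - cos r) ^ 1 * (\<mu> * (\<phi> 1 s + 2 * \<phi> 2 s * sin r + 3 * \<phi> 3 s * sin r ^ 2 + 4 * \<phi> 4 s * sin r ^ 3))
   + sin r ^ 2 * (d * (\<phi>' 2 s + \<phi>' 3 s * sin r + \<phi>' 4 s * sin r ^ 2) - \<mu> * (3 * \<phi> 3 s + 4 * \<phi> 4 s * sin r))"
  unfolding Bf_def B0_def B1_def ph_r_def ph_s_def by algebra

lemma vanish_Bf_rem: "vanish 2 (\<lambda>k s r. Bf s r - (B0 s + B1 s * sin r))"
proof -
  have 1: "vanish 0 (\<lambda>k s r. \<mu> * (\<phi> 1 s + 2 * \<phi> 2 s * sin r + 3 * \<phi> 3 s * sin r ^ 2 + 4 * \<phi> 4 s * sin r ^ 3))"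
    and 2: "vanish 0 (\<lambda>k s r. d * (\<phi>' 2 s + \<phi>' 3 s * sin r + \<phi>' 4 s * sin r ^ 2) - \<mu> * (3 * \<phi> 3 s + 4 * \<phi> 4 s * sin r))"
    by (intro vanish_0_intros vanish_times vanish_bdd; simp)+
  show ?thesis
    unfolding Bf_eq
    by (intro vanish_add p vanish_times'[OF vanish_cos_1_power 1] vanish_times'[OF vanish_sin_power 2]) auto
qed

lemma vanish_B: "vanish 0 (\<lambda>k s r. B0 s)" "vanish 0 (\<lambda>k s r. B1 s)"
  unfolding B0_def B1_def by (intro vanish_0_intros vanish_times vanish_bdd)+

lemma vanish_Bf1: "vanish 1 (\<lambda>k s r. Bf s r - B0 s)"
proof -
  have "vanish 1 (\<lambda>k s r. (Bf s r - (B0 s + B1 s * sin r)) + B1 s * sin r)"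
    by (intro vanish_add vanish_weaken[OF vanish_Bf_rem] vanish_times vanish_B vanish_sin) auto
  then show ?thesis by simp
qed

lemma vanish_Bf: "vanish 0 (\<lambda>k s r. Bf s r)"
proof -
  have "vanish 0 (\<lambda>k s r. (Bf s r - B0 s) + B0 s)"
    by (intro vanish_add vanish_0[OF vanish_Bf1] vanish_B)
  then show ?thesis by simp
qed

text \<open>The correctors \<open>\<rho> 1\<close>, \<open>\<rho> 2\<close> are only of size
  \<open>1 / k\<close>, but the frequency \<open>k^2\<close> lifts their longitudinal derivatives to
  order \<open>k\<close>, where they cancel the transport \<open>2 * \<mu> * Bf * \<Phi>'\<close>
  across the geodesic.\<close>

lemma vanish_im1: "vanish 3 (\<lambda>k s r. 2 * (\<rho>' 1 s * sin r + \<rho>' 2 s * sin r ^ 2) + 2 * \<mu> * Bf s r * \<Phi>' r)"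
proof -
  have eq: "2 * (\<rho>' 1 s * sin r + \<rho>' 2 s * sin r ^ 2) + 2 * \<mu> * Bf s r * \<Phi>' r =
     2 * \<mu> * ((Bf s r - (B0 s + B1 s * sin r)) * \<Phi>' r)
     + 2 * \<mu> * ((B0 s + B1 s * sin r) * ((1 - cos r) ^ 1 * (- Q r) + (1 - cos r) ^ 2 * (sin r * (3 * M)) + c3 * sin r ^ 3))
     + 2 * \<mu> * B1 s * (c2 * sin r ^ 3)" for s r
    unfolding \<Phi>'_def Q_def \<rho>1[folded B0_def] \<rho>2[folded B0_def, folded B1_def]
    by algebra
  have 1: "vanish 3 (\<lambda>k s r. (Bf s r - (B0 s + B1 s * sin r)) * \<Phi>' r)"
    by (rule vanish_mult[OF vanish_Bf_rem vanish_\<Phi>']) simp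
  have 2: "vanish 3 (\<lambda>k s r. (1 - cos r) ^ 1 * (- Q r))"
    by (rule vanish_mult[OF vanish_cos_1_power[of 2] vanish_minus[OF vanish_Q]]) auto
  have 3: "vanish 3 (\<lambda>k s r. (1 - cos r) ^ 2 * (sin r * (3 * M)))"
    by (rule vanish_times'[OF vanish_cos_1_power]) (auto intro!: vanish_times vanish_const vanish_0[OF vanish_sin])
  have 4: "vanish 0 (\<lambda>k s r. B0 s + B1 s * sin r)"
    by (intro vanish_add vanish_times vanish_B vanish_0[OF vanish_sin])
  have 5: "vanish 3 (\<lambda>k s r. c3 * sin r ^ 3)" "vanish 3 (\<lambda>k s r. c2 * sin r ^ 3)"
    by (intro vanish_times[OF vanish_const] vanish_sin_power; simp)+
  show ?thesis unfolding eq
    by (intro vanish_add vanish_times[OF vanish_const] 1 vanish_times[OF 4] 2 3 5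
        vanish_times[OF vanish_times[OF vanish_const vanish_B(2)]])
qed

text \<open>Only the values at \<open>r = 0\<close> matter at this order. There \<open>ph_ss\<close>
  and \<open>fs\<close> cancel, and the second line is minus the derivative of \<open>Bf\<close>
  along \<open>mp\<close>; the condition \<open>\<rho>0\<close> balances it together with
  \<open>2 * \<mu> * t0 * B0\<close>. The functions \<open>R1\<close> to \<open>R4\<close> are the
  deviations from the values at \<open>r = 0\<close>.\<close>

lemma vanish_im0: "vanish 1 (\<lambda>k s r. 2 * \<rho>' 0 s + 2 * \<mu> * Bf s r * \<tau> r + (ph_ss s r - fs s r)
    + (\<mu>^2 * ph_rr s r - 2 * \<mu> * d * ph_sr s r + d^2 * ph_ss s r - (\<mu> * pr s r - d * ps s r)))"
proof -
  define R1 where "R1 s r = sin r * (\<phi>'' 1 s + \<phi>'' 2 s * sin r + \<phi>'' 3 s * sin r ^ 2 + \<phi>'' 4 s * sin r ^ 3)" for s r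
  define R2 where "R2 s r = sin r * (6 * \<phi> 3 s + 12 * \<phi> 4 s * sin r - (2 * \<phi> 2 s + 6 * \<phi> 3 s * sin r + 12 * \<phi> 4 s * sin r ^ 2) * sin r
    - (\<phi> 1 s + 2 * \<phi> 2 s * sin r + 3 * \<phi> 3 s * sin r ^ 2 + 4 * \<phi> 4 s * sin r ^ 3))" for s r
  define R3 where "R3 s r = (1 - cos r) ^ 1 * (- \<phi>' 1 s) + sin r * ((2 * \<phi>' 2 s + 3 * \<phi>' 3 s * sin r + 4 * \<phi>' 4 s * sin r ^ 2) * cos r)" for s r
  define R4 where "R4 r = sin r * (t1 * cos r) + (1 - cos r) ^ 1 * (- t0)" for r
  have R12: "vanish 1 (\<lambda>k s r. R1 s r)" "vanish 1 (\<lambda>k s r. R2 s r)"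
    unfolding R1_def R2_def
    by (intro vanish_times'[OF vanish_sin] vanish_0_intros vanish_times vanish_bdd; simp)+
  have R34: "vanish 1 (\<lambda>k s r. R3 s r)" "vanish 1 (\<lambda>k s r. R4 r)"
    unfolding R3_def R4_def
    by (rule vanish_add; (rule vanish_times'[OF vanish_sin] vanish_times'[OF vanish_cos_1_power]);
        (intro vanish_0_intros vanish_times vanish_bdd)?; simp)+
  have ss: "ph_ss s r = \<phi>'' 0 s + R1 s r" for s r
    unfolding ph_ss_def R1_def by algebra
  have rr: "ph_rr s r = 2 * \<phi> 2 s + R2 s r" for s r
    unfolding ph_rr_def R2_def cos_sq by algebra
  have sr: "ph_sr s r = \<phi>' 1 s + R3 s r" for s r
    unfolding ph_sr_def R3_def by algebra
  have ta: "\<tau> r = t0 + R4 r" for r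
    unfolding \<tau>_def R4_def by algebra
  have eq: "2 * \<rho>' 0 s + 2 * \<mu> * Bf s r * \<tau> r + (ph_ss s r - fs s r)
    + (\<mu>^2 * ph_rr s r - 2 * \<mu> * d * ph_sr s r + d^2 * ph_ss s r - (\<mu> * pr s r - d * ps s r))
    = 2 * \<mu> * t0 * (Bf s r - B0 s) + 2 * \<mu> * (Bf s r * R4 r) + R1 s r - (fs s r - \<alpha>' 0 s)
      + (\<mu>^2 * R2 s r - 2 * \<mu> * d * R3 s r + d^2 * R1 s r - (\<mu> * (pr s r - \<beta>1 s) - d * (ps s r - \<beta>0' s)))" for s r
    unfolding ss rr sr ta \<rho>0 B0_def \<phi>''0[symmetric] by algebra
  show ?thesis
    unfolding eq
    by (intro vanish_add vanish_diff vanish_times[OF vanish_const] R12 R34 vanish_Bf1 vanish_times[OF vanish_Bf] fs pr ps)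
qed

lemma vanish_q: "vanish 1 (\<lambda>k s r. q s r)"
  unfolding q_eq by (intro vanish_add vanish_times vanish_const vanish_sin_power vanish_weaken[OF f[folded e5_def]]) auto

text \<open>The part of \<open>\<mu> * X_r - d * X_s\<close> that is due to \<open>\<rho>\<close>,
  multiplied by \<open>k\<close> to make it of order one. Below, \<open>Z\<close> and
  \<open>W\<close> rescale \<open>X_s\<close> and \<open>X_ss\<close> in the same way.\<close>

definition Y where "Y k s r = \<mu> * \<sigma> * ((\<rho> 1 s + 2 * \<rho> 2 s * sin r) * cos r)
  - d * (\<sigma> * (\<rho>' 1 s * sin r + \<rho>' 2 s * sin r ^ 2) + 1 / k * (\<sigma> * \<rho>' 0 s))"

lemma vanish_Y: "vanish 0 (\<lambda>k s r. Y k s r)"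
  unfolding Y_def by (intro vanish_0_intros vanish_times vanish_bdd vanish_inverse; simp)

text \<open>At \<open>r = 0\<close> the terms depending on \<open>s\<close> are \<open>B0\<close>
  squared and \<open>\<mu> * v0\<close>; the longitudinal primitive \<open>\<eta>\<close> absorbs
  their oscillation and \<open>e\<close> their mean. The cross term with \<open>Y\<close> contains
  \<open>\<Phi>'\<close> and so vanishes at \<open>r = 0\<close> by itself.\<close>

lemma vanish_re0: "vanish 1 (\<lambda>k s r. (b 0 + q s r)^2 - (b 0)^2 + 2 * \<eta>' s + (Bf s r)^2 - \<mu>^2 * (\<tau> r)^2 + 2 * \<mu> * \<Phi>' r * Y k s r
   + \<mu>^2 * \<tau>' r + \<mu> * v s r - e + \<mu>^2 * t0^2 - \<mu>^2 * t1)"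
proof -
  define R4 where "R4 r = sin r * (t1 * cos r) + (1 - cos r) ^ 1 * (- t0)" for r
  define R5 where "R5 r = sin r * (- t1 * sin r - (t0 + t1 * sin r))" for r
  have R: "vanish 1 (\<lambda>k s r. R4 r)" "vanish 1 (\<lambda>k s r. R5 r)"
    unfolding R4_def R5_def
    by (rule vanish_add, rule vanish_times'[OF vanish_sin], (intro vanish_0_intros vanish_times; simp),
        rule vanish_times'[OF vanish_cos_1_power], simp, intro vanish_0_intros)
      (rule vanish_times'[OF vanish_sin], intro vanish_0_intros vanish_times; simp)
  have ta: "\<tau> r = t0 + R4 r" for r
    unfolding \<tau>_def R4_def by algebra
  have ta': "\<tau>' r = t1 + R5 r" for r
    unfolding \<tau>'_def R5_def cos_sq by algebra
  have eq: "(b 0 + q s r)^2 - (b 0)^2 + 2 * \<eta>' s + (Bf s r)^2 - \<mu>^2 * (\<tau> r)^2 + 2 * \<mu> * \<Phi>' r * Y k s r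
   + \<mu>^2 * \<tau>' r + \<mu> * v s r - e + \<mu>^2 * t0^2 - \<mu>^2 * t1 =
   q s r * (2 * b 0 + q s r) + (Bf s r - B0 s) * (Bf s r + B0 s) - R4 r * (\<mu>^2 * (2 * t0 + R4 r))
   + \<Phi>' r * (2 * \<mu> * Y k s r) + \<mu>^2 * R5 r + \<mu> * (v s r - v0 s)" for k s r
    unfolding ta ta' \<eta>[folded B0_def] by algebra
  show ?thesis unfolding eq
    by (intro vanish_add vanish_diff[of 1] vanish_times'[OF vanish_q] vanish_times'[OF vanish_Bf1] vanish_times'[OF R(1)] vanish_times'[OF vanish_\<Phi>']
        vanish_times vanish_const R vanish_0[OF vanish_q] vanish_Bf vanish_B vanish_0[OF R(1)] vanish_Y v)
qed

section \<open>Bounds for the real and imaginary parts of the conjugated operator\<close>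

definition weight :: "real \<Rightarrow> real \<Rightarrow> real" where
  "weight k r = 1 / k + \<bar>r\<bar> + k * \<bar>r\<bar> ^ 3 + k^2 * \<bar>r\<bar> ^ 5"

lemma weight_bound:
  assumes "vanish 5 g2" "vanish 3 g1" "vanish 1 g0" "vanish 0 gi"
  obtains C where "\<And>k s r. k \<ge> 1 \<Longrightarrow> \<bar>r\<bar> \<le> pi \<Longrightarrow>
    \<bar>k^2 * g2 k s r + k * g1 k s r + g0 k s r + 1 / k * gi k s r\<bar> \<le> C * weight k r"
proof -
  obtain C2 where C2: "C2 \<ge> 0" "\<And>k s r. k \<ge> 1 \<Longrightarrow> \<bar>r\<bar> \<le> pi \<Longrightarrow> \<bar>g2 k s r\<bar> \<le> C2 * \<bar>r\<bar> ^ 5"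
    using vanish_E[OF assms(1)] by metis
  obtain C1 where C1: "C1 \<ge> 0" "\<And>k s r. k \<ge> 1 \<Longrightarrow> \<bar>r\<bar> \<le> pi \<Longrightarrow> \<bar>g1 k s r\<bar> \<le> C1 * \<bar>r\<bar> ^ 3"
    using vanish_E[OF assms(2)] by metis
  obtain C0 where C0: "C0 \<ge> 0" "\<And>k s r. k \<ge> 1 \<Longrightarrow> \<bar>r\<bar> \<le> pi \<Longrightarrow> \<bar>g0 k s r\<bar> \<le> C0 * \<bar>r\<bar> ^ 1"
    using vanish_E[OF assms(3)] by metis
  obtain Ci where Ci: "Ci \<ge> 0" "\<And>k s r. k \<ge> 1 \<Longrightarrow> \<bar>r\<bar> \<le> pi \<Longrightarrow> \<bar>gi k s r\<bar> \<le> Ci * \<bar>r\<bar> ^ 0"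
    using vanish_E[OF assms(4)] by metis
  define C where "C = C2 + C1 + C0 + Ci"
  have "\<bar>k^2 * g2 k s r + k * g1 k s r + g0 k s r + 1 / k * gi k s r\<bar> \<le> C * weight k r"
    if k: "k \<ge> 1" "\<bar>r\<bar> \<le> pi" for k s r
  proof -
    have "\<bar>k^2 * g2 k s r\<bar> \<le> k^2 * (C * \<bar>r\<bar> ^ 5)"
      using C2(2)[OF k] C0(1) C1(1) Ci(1) unfolding abs_mult C_def
      by (intro mult_mono order_trans[OF C2(2)[OF k]] mult_right_mono) auto
    moreover have "\<bar>k * g1 k s r\<bar> \<le> k * (C * \<bar>r\<bar> ^ 3)"
      using k C0(1) C2(1) Ci(1) unfolding abs_mult C_def
      by (intro mult_mono order_trans[OF C1(2)[OF k]] mult_right_mono) auto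
    moreover have "\<bar>g0 k s r\<bar> \<le> C * \<bar>r\<bar> ^ 1"
      using C1(1) C2(1) Ci(1) unfolding C_def
      by (intro order_trans[OF C0(2)[OF k]] mult_right_mono) auto
    moreover have "\<bar>1 / k * gi k s r\<bar> \<le> 1 / k * (C * \<bar>r\<bar> ^ 0)"
      using k C0(1) C2(1) C1(1) unfolding abs_mult C_def
      by (intro mult_mono order_trans[OF Ci(2)[OF k]] mult_right_mono) auto
    moreover have "C * weight k r = 1 / k * (C * \<bar>r\<bar> ^ 0) + C * \<bar>r\<bar> ^ 1 + k * (C * \<bar>r\<bar> ^ 3) + k^2 * (C * \<bar>r\<bar> ^ 5)"
      by (simp add: weight_def algebra_simps)
    ultimately show ?thesis by linarith
  qed
  then show ?thesis by (rule that)
qed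

definition Z where "Z k s r = \<sigma> * (\<rho>' 1 s * sin r + \<rho>' 2 s * sin r ^ 2) + 1 / k * (\<sigma> * \<rho>' 0 s)"

lemma X_s_eq: "k \<ge> 1 \<Longrightarrow> X_s k s r = 1 / k * Z k s r"
  by (simp add: X_s_def Z_def field_simps power2_eq_square)

lemma X_p_eq: "k \<ge> 1 \<Longrightarrow> \<mu> * X_r k s r - d * X_s k s r = - \<mu> * (k * \<Phi>' r + \<tau> r) + 1 / k * Y k s r"
  by (simp add: X_s_def X_r_def Y_def field_simps power2_eq_square)

lemma vanish_Z: "vanish 0 (\<lambda>k s r. Z k s r)"
  unfolding Z_def by (intro vanish_0_intros vanish_times vanish_bdd vanish_inverse; simp)

definition W where "W k s r = \<sigma> * (\<rho>'' 1 s * sin r + \<rho>'' 2 s * sin r ^ 2) + 1 / k * (\<sigma> * \<rho>'' 0 s)"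

lemma X_ss_eq: "k \<ge> 1 \<Longrightarrow> X_ss k s r = 1 / k * W k s r"
  by (simp add: X_ss_def W_def field_simps power2_eq_square)

lemma vanish_W: "vanish 0 (\<lambda>k s r. W k s r)"
  unfolding W_def by (intro vanish_0_intros vanish_times vanish_bdd vanish_inverse; simp)

lemma momentum_eqs:
  "\<sigma> * k^2 + ph_s s r + \<sigma> / k^2 * \<eta>' s - f s r = \<sigma> * k^2 - (b 0 + q s r) + \<sigma> * (1 / k)^2 * \<eta>' s"
  "\<mu> * ph_r s r - d * (ph_s s r + \<sigma> / k^2 * \<eta>' s) - p s r = - Bf s r - \<sigma> * (1 / k)^2 * d * \<eta>' s"
  by (simp_all add: q_def Bf_def field_simps)

lemma P_re_bound:
  obtains C where "\<And>k s r. k \<ge> 1 \<Longrightarrow> \<bar>r\<bar> \<le> pi \<Longrightarrow> \<bar>P_re k s r - E k\<bar> \<le> C * weight k r"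
proof -
  \<comment> \<open>Everything that carries a factor \<open>1 / k\<close> after expansion by powers
    of \<open>k\<close>; boundedness is enough for it.\<close>
  define G where "G k s r = 1 / k * (- 2 * \<sigma> * (b 0 + q s r) * \<eta>' s + 1 / k * (1 / k * (\<eta>' s)^2))
    + 1 / k * (2 * \<sigma> * d * Bf s r * \<eta>' s + 1 / k * (1 / k * (d^2 * (\<eta>' s)^2)))
    - 1 / k * (Z k s r)^2 + (2 * \<mu> * \<tau> r * Y k s r - 1 / k * (Y k s r)^2) - (1 + d^2) * W k s r
    - (\<mu>^2 * (\<sigma> * (2 * \<rho> 2 s * cos r ^ 2 - (\<rho> 1 s + 2 * \<rho> 2 s * sin r) * sin r))
       - 2 * \<mu> * d * (\<sigma> * ((\<rho>' 1 s + 2 * \<rho>' 2 s * sin r) * cos r)))" for k s r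
  have vanish_G: "vanish 0 G"
    unfolding G_def power2_eq_square
    by (intro vanish_0_intros vanish_times vanish_bdd vanish_inverse vanish_0[OF vanish_q] vanish_Bf vanish_Z vanish_W vanish_Y vanish_\<tau>; simp)
  define T where "T k s r = k^2 * (- 2 * \<sigma> * q s r - \<mu>^2 * (\<Phi>' r)^2) + k * (\<mu>^2 * (- 2 * \<Phi>' r * \<tau> r + \<Phi>'' r - c))
     + ((b 0 + q s r)^2 - (b 0)^2 + 2 * \<eta>' s + (Bf s r)^2 - \<mu>^2 * (\<tau> r)^2 + 2 * \<mu> * \<Phi>' r * Y k s r
       + \<mu>^2 * \<tau>' r + \<mu> * v s r - e + \<mu>^2 * t0^2 - \<mu>^2 * t1) + 1 / k * G k s r" for k s r
  obtain C where C: "\<And>k s r. k \<ge> 1 \<Longrightarrow> \<bar>r\<bar> \<le> pi \<Longrightarrow> \<bar>T k s r\<bar> \<le> C * weight k r"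
    unfolding T_def using weight_bound[OF vanish_re2 vanish_times[OF vanish_const[of "\<mu>^2"] vanish_re1] vanish_re0 vanish_G] by metis
  have "P_re k s r - E k = T k s r"
    if k: "k \<ge> 1" for k s r
  proof -
    \<comment> \<open>With a name for \<open>1 / k\<close> the claim is a polynomial identity modulo
      \<open>i * k = 1\<close> and \<open>\<sigma>^2 = 1\<close>.\<close>
    define i where "i = 1 / k"
    have ik: "i * k = 1" using k by (simp add: i_def)
    have i1: "\<sigma> / k * x = \<sigma> * i * x" for x by (simp add: i_def)
    have rr: "\<mu>^2 * X_rr k s r - 2 * \<mu> * d * X_sr k s r + d^2 * X_ss k s r =
      - \<mu>\<^sup>2 * (k * \<Phi>'' r + \<tau>' r) + i * (\<mu>^2 * (\<sigma> * (2 * \<rho> 2 s * cos r ^ 2 - (\<rho> 1 s + 2 * \<rho> 2 s * sin r) * sin r))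
       - 2 * \<mu> * d * (\<sigma> * ((\<rho>' 1 s + 2 * \<rho>' 2 s * sin r) * cos r))) + d^2 * (i * W k s r)"
      unfolding X_rr_def X_sr_def X_ss_eq[OF k] i1 i_def[symmetric] by algebra
    show ?thesis
      unfolding P_re_def momentum_eqs rr X_p_eq[OF k] unfolding X_s_eq[OF k] X_ss_eq[OF k] T_def G_def E_def i_def[symmetric]
      using ik \<sigma> by algebra
  qed
  then show ?thesis using C by (intro that) auto
qed

lemma P_im_bound:
  obtains C where "\<And>k s r. k \<ge> 1 \<Longrightarrow> \<bar>r\<bar> \<le> pi \<Longrightarrow> \<bar>P_im k s r\<bar> \<le> C * weight k r"
proof -
  define G where "G k s r = - 2 * (b 0 + q s r) * Z k s r + 1 / k * (1 / k * (2 * \<sigma> * \<eta>' s * Z k s r))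
    - 2 * Bf s r * Y k s r + 2 * \<sigma> * d * \<eta>' s * \<mu> * (\<Phi>' r + 1 / k * \<tau> r) - 1 / k * (1 / k * (2 * \<sigma> * d * \<eta>' s * Y k s r))
    + 1 / k * (\<sigma> * (1 + d^2) * \<eta>'' s)" for k s r
  have vanish_G: "vanish 0 G"
    unfolding G_def
    by (intro vanish_0_intros vanish_times vanish_bdd vanish_inverse vanish_0[OF vanish_q] vanish_Bf vanish_Z vanish_Y vanish_\<tau> vanish_0[OF vanish_\<Phi>'])
  define T where "T k s r = k^2 * 0 + k * (2 * (\<rho>' 1 s * sin r + \<rho>' 2 s * sin r ^ 2) + 2 * \<mu> * Bf s r * \<Phi>' r)
     + (2 * \<rho>' 0 s + 2 * \<mu> * Bf s r * \<tau> r + (ph_ss s r - fs s r)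
    + (\<mu>^2 * ph_rr s r - 2 * \<mu> * d * ph_sr s r + d^2 * ph_ss s r - (\<mu> * pr s r - d * ps s r))) + 1 / k * G k s r" for k s r
  obtain C where C: "\<And>k s r. k \<ge> 1 \<Longrightarrow> \<bar>r\<bar> \<le> pi \<Longrightarrow> \<bar>T k s r\<bar> \<le> C * weight k r"
    unfolding T_def using weight_bound[OF vanish_zero vanish_im1 vanish_im0 vanish_G] by metis
  have "P_im k s r = T k s r"
    if k: "k \<ge> 1" for k s r
  proof -
    define i where "i = 1 / k"
    have ik: "i * k = 1" using k by (simp add: i_def)
    have i2: "\<sigma> / k^2 * x = \<sigma> * i^2 * x" for x by (simp add: i_def field_simps)
    have kZ: "2 * (\<sigma> * k^2 * (i * Z k s r)) = k * (2 * (\<rho>' 1 s * sin r + \<rho>' 2 s * sin r ^ 2)) + 2 * \<rho>' 0 s"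
      unfolding Z_def i_def[symmetric] using ik \<sigma> by algebra
    show ?thesis
      unfolding P_im_def momentum_eqs X_p_eq[OF k] unfolding X_s_eq[OF k] T_def G_def i2 i_def[symmetric]
      using ik kZ by algebra
  qed
  then show ?thesis using C by (intro that) auto
qed

end

section \<open>Growth of the phase over a whole period\<close>

lemma cos_quadratic_bound:
  fixes r :: real assumes "\<bar>r\<bar> \<le> pi" shows "r^2 / 8 \<le> 1 - cos r"
proof -
  define x where "x = \<bar>r\<bar> / 2"
  \<comment> \<open>\<open>8 / 5\<close> is a rational upper bound for \<open>pi / 2\<close>. Its
    square is below 3, so \<open>x - x ^ 3 / 6 \<le> sin x\<close> already gives
    \<open>x / 2 \<le> sin x\<close>.\<close>
  have x0: "0 \<le> x" "x \<le> 8 / 5" using assms pi_approx by (auto simp: x_def abs_if field_simps)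
  have "\<bar>sin x - x\<bar> \<le> x ^ 3 / 6"
    using Maclaurin_sin_bound[of x 3] x0
    by (simp add: eval_nat_numeral sin_coeff_def fact_numeral field_simps)
  moreover have "x ^ 3 \<le> 3 * x"
  proof -
    have "x ^ 2 \<le> (8 / 5) ^ 2" using x0 by (intro power_mono) auto
    then have "x * x ^ 2 \<le> x * 3" using x0 by (intro mult_left_mono) (auto simp: power2_eq_square)
    then show ?thesis by (simp add: power3_eq_cube power2_eq_square)
  qed
  ultimately have "x / 2 \<le> sin x" by linarith
  then have "(x / 2)^2 \<le> (sin x)^2" using x0 by (intro power_mono) auto
  moreover have "1 - cos r = 2 * (sin x)^2"
    using cos_double_sin[of x] by (simp add: x_def)
  moreover have "(x / 2)^2 = r^2 / 16" by (simp add: x_def power_divide)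
  ultimately show ?thesis by simp
qed

text \<open>
  The term \<open>M (1 - cos r)\<^sup>3\<close> is of order \<open>r\<^sup>6\<close>, hence invisible to the expansion at \<open>r = 0\<close>;
  it keeps the phase positive on the whole period and so replaces a cut-off.
\<close>

lemma phase_growth:
  fixes c c2 c3 :: real
  assumes c: "c > 0"
  obtains M \<delta> where "\<delta> > 0" "\<And>r. \<bar>r\<bar> \<le> pi \<Longrightarrow>
    \<delta> * r^2 \<le> c * sin r ^ 2 / 2 + c2 * sin r ^ 3 / 3 + c3 * sin r ^ 4 / 4 + M * (1 - cos r) ^ 3"
proof -
  \<comment> \<open>Two completed squares. With \<open>x = sin r\<close> and
    \<open>t = 1 - cos r\<close>, the cubic term is paid by \<open>c / 8 * x^2\<close> at the price
    \<open>a * x ^ 4\<close>. All losses of order \<open>t^2\<close> add up to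
    \<open>D * t^2\<close>, where \<open>3 * c / 8\<close> stems from
    \<open>x^2 = 2 * t - t^2\<close>; and \<open>M = D^2 / c\<close> makes
    \<open>c / 4 * t - D * t^2 + M * t ^ 3\<close> equal to \<open>t\<close> times a square.\<close>
  define a where "a = 2 * (c2 / 3)^2 / c"
  have a0: "a \<ge> 0" using c by (simp add: a_def)
  define D where "D = 4 * a + \<bar>c3\<bar> + 3 * c / 8"
  define M where "M = D^2 / c"
  have "c / 16 * r^2 \<le> c * sin r ^ 2 / 2 + c2 * sin r ^ 3 / 3 + c3 * sin r ^ 4 / 4 + M * (1 - cos r) ^ 3"
    if r: "\<bar>r\<bar> \<le> pi" for r
  proof -
    define t where "t = 1 - cos r"
    define x where "x = sin r"
    have t: "0 \<le> t" "r^2 / 8 \<le> t" using cos_quadratic_bound[OF r] by (auto simp: t_def)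
    have x2: "x^2 = 2 * t - t^2"
      unfolding x_def t_def sin_squared_eq by algebra
    have x4: "x ^ 4 \<le> 4 * t^2"
    proof -
      have "x^2 \<le> 2 * t" using x2 by simp
      then have "(x^2)^2 \<le> (2 * t)^2" by (intro power_mono) auto
      then show ?thesis by (simp add: power_mult_distrib flip: power_mult)
    qed
    have "0 \<le> c / 8 * (x + 4 * (c2 / 3) / c * x^2)^2" using c by simp
    also have "\<dots> = c / 8 * x^2 + c2 * x ^ 3 / 3 + a * x ^ 4"
      using c by (simp add: a_def field_simps power2_eq_square power3_eq_cube eval_nat_numeral)
    finally have 1: "- (c / 8 * x^2 + a * x ^ 4) \<le> c2 * x ^ 3 / 3" by simp
    have 2: "a * x ^ 4 \<le> a * (4 * t^2)"
      using a0 by (intro mult_left_mono x4) auto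
    have "\<bar>c3 * x ^ 4 / 4\<bar> \<le> \<bar>c3\<bar> * t^2"
      using mult_left_mono[OF x4, of "\<bar>c3\<bar>"] by (simp add: abs_mult)
    then have 3: "- (\<bar>c3\<bar> * t^2) \<le> c3 * x ^ 4 / 4" by linarith
    have "0 \<le> c * t * (1 / 2 - D * t / c)^2" using c t by simp
    also have "\<dots> = c / 4 * t - D * t^2 + M * t ^ 3"
      using c by (simp add: M_def field_simps power2_eq_square power3_eq_cube)
    finally have 4: "D * t^2 \<le> c / 4 * t + M * t ^ 3" by simp
    have "c * x^2 / 2 - c / 8 * x^2 = 3 / 4 * (c * t) - 3 / 8 * (c * t^2)"
      unfolding x2 by (simp add: field_simps)
    moreover have "D * t^2 = a * (4 * t^2) + \<bar>c3\<bar> * t^2 + 3 / 8 * (c * t^2)"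
      by (simp add: D_def field_simps)
    ultimately have "c / 2 * t \<le> c * x^2 / 2 + c2 * x ^ 3 / 3 + c3 * x ^ 4 / 4 + M * t ^ 3"
      using 1 2 3 4 by (simp add: algebra_simps)
    moreover have "c / 16 * r^2 \<le> c / 2 * t"
      using mult_left_mono[OF t(2), of "c / 2"] c by simp
    ultimately show ?thesis by (simp add: x_def t_def)
  qed
  then show ?thesis using that[of "c / 16" M] c by simp
qed

context quasimode
begin

lemma X_upper:
  assumes "\<And>r. \<bar>r\<bar> \<le> pi \<Longrightarrow> \<delta> * r^2 \<le> \<Phi> r"
  obtains C where "\<And>k s r. k \<ge> 1 \<Longrightarrow> \<bar>r\<bar> \<le> pi \<Longrightarrow> X k s r \<le> C - k * \<delta> * r^2"
proof -
  define G where "G k s r = - (t0 * sin r + (t1 / 2) * sin r ^ 2)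
    + (1 / k * (\<sigma> * (\<rho> 1 s * sin r + \<rho> 2 s * sin r ^ 2)) + 1 / k * (1 / k * (\<sigma> * \<rho> 0 s)))" for k s r
  have "vanish 0 G"
    unfolding G_def by (intro vanish_0_intros vanish_times vanish_bdd vanish_inverse; simp)
  then obtain C where C: "\<And>k s r. k \<ge> 1 \<Longrightarrow> \<bar>r\<bar> \<le> pi \<Longrightarrow> \<bar>G k s r\<bar> \<le> C * \<bar>r\<bar> ^ 0"
    by (metis vanish_E)
  have "X k s r \<le> C - k * \<delta> * r^2" if k: "k \<ge> 1" "\<bar>r\<bar> \<le> pi" for k s r
  proof -
    have "X k s r = - (k * \<Phi> r) + G k s r"
      using k by (simp add: X_def G_def field_simps power2_eq_square)
    moreover have "k * (\<delta> * r^2) \<le> k * \<Phi> r"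
      using assms k by (intro mult_left_mono) auto
    ultimately show ?thesis using C[OF k, of s] by (simp add: mult.assoc)
  qed
  then show ?thesis by (rule that)
qed

text \<open>Serves to bound the norm of the mode from below, on squares of side \<open>1 / k\<close>
  where \<open>k * r^2\<close> stays bounded.\<close>

lemma X_lower:
  obtains C where "\<And>k s r. k \<ge> 1 \<Longrightarrow> \<bar>r\<bar> \<le> pi \<Longrightarrow> - C * (1 + k * r^2) \<le> X k s r"
proof -
  define G where "G k s r = - (t0 * sin r + (t1 / 2) * sin r ^ 2)
    + (1 / k * (\<sigma> * (\<rho> 1 s * sin r + \<rho> 2 s * sin r ^ 2)) + 1 / k * (1 / k * (\<sigma> * \<rho> 0 s)))" for k s r
  have "vanish 0 G"
    unfolding G_def by (intro vanish_0_intros vanish_times vanish_bdd vanish_inverse; simp)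
  then obtain C where C: "C \<ge> 0" "\<And>k s r. k \<ge> 1 \<Longrightarrow> \<bar>r\<bar> \<le> pi \<Longrightarrow> \<bar>G k s r\<bar> \<le> C * \<bar>r\<bar> ^ 0"
    by (metis vanish_E)
  have "vanish 2 (\<lambda>k s r. c / 2 * sin r ^ 2 + c2 / 3 * sin r ^ 3 + c3 / 4 * sin r ^ 4 + M * (1 - cos r) ^ 3)"
    by (intro vanish_add vanish_times[OF vanish_const] vanish_sin_power vanish_cos_1_power) auto
  then obtain D where D: "D \<ge> 0" "\<forall>k\<ge>(1::real). \<forall>(s::real) r. \<bar>r\<bar> \<le> pi \<longrightarrow>
    \<bar>c / 2 * sin r ^ 2 + c2 / 3 * sin r ^ 3 + c3 / 4 * sin r ^ 4 + M * (1 - cos r) ^ 3\<bar> \<le> D * \<bar>r\<bar> ^ 2"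
    unfolding vanish_def by blast
  have D': "\<bar>\<Phi> r\<bar> \<le> D * r^2" if "\<bar>r\<bar> \<le> pi" for r
  proof -
    have "\<Phi> r = c / 2 * sin r ^ 2 + c2 / 3 * sin r ^ 3 + c3 / 4 * sin r ^ 4 + M * (1 - cos r) ^ 3"
      by (simp add: \<Phi>_def)
    then show ?thesis using D(2)[rule_format, of 1 r] that by simp
  qed
  have "- (C + D) * (1 + k * r^2) \<le> X k s r" if k: "k \<ge> 1" "\<bar>r\<bar> \<le> pi" for k s r
  proof -
    have X: "X k s r = - (k * \<Phi> r) + G k s r"
      using k by (simp add: X_def G_def field_simps power2_eq_square)
    have "k * \<Phi> r \<le> k * (D * r^2)"
      using D'[OF k(2)] k by (intro mult_left_mono) auto
    moreover have "0 \<le> C * (k * r^2)" using C k by simp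
    ultimately show ?thesis using X C(2)[OF k, of s] D(1) by (simp add: algebra_simps)
  qed
  then show ?thesis by (rule that)
qed

end

subsection \<open>Conjugation of the operator by a complex phase\<close>

lemma dderiv_linear: "smooth f \<Longrightarrow> linear (\<lambda>v. dderiv f v z)"
  using smooth_has_derivative has_derivative_linear by blast

lemma dderiv_add: "smooth f \<Longrightarrow> dderiv f (v + w) z = dderiv f v z + dderiv f w z"
  and dderiv_scale: "smooth f \<Longrightarrow> dderiv f (c *\<^sub>R v) z = c *\<^sub>R dderiv f v z"
  using dderiv_linear linear_add linear_scale by blast+

lemma vec2_decomp: "v = v $ 1 *\<^sub>R axis 1 1 + v $ 2 *\<^sub>R axis 2 1" for v :: "real^2"
  by (simp add: vec_eq_iff forall_2 axis_def)

lemma dderiv_vec2: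
  fixes f :: "real^2 \<Rightarrow> 'b::real_normed_vector"
  shows "smooth f \<Longrightarrow> dderiv f v z = v $ 1 *\<^sub>R dderiv f (axis 1 1) z + v $ 2 *\<^sub>R dderiv f (axis 2 1) z"
  by (subst vec2_decomp[of v]) (simp add: dderiv_add dderiv_scale)

lemma dderiv_dderiv_vec2:
  fixes f :: "real^2 \<Rightarrow> 'b::real_normed_vector"
  assumes f: "smooth f"
  shows "dderiv (dderiv f v) w z = w $ 1 *\<^sub>R (v $ 1 *\<^sub>R dderiv (dderiv f (axis 1 1)) (axis 1 1) z + v $ 2 *\<^sub>R dderiv (dderiv f (axis 2 1)) (axis 1 1) z)
    + w $ 2 *\<^sub>R (v $ 1 *\<^sub>R dderiv (dderiv f (axis 1 1)) (axis 2 1) z + v $ 2 *\<^sub>R dderiv (dderiv f (axis 2 1)) (axis 2 1) z)"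
proof -
  have "dderiv f v = (\<lambda>z. v $ 1 *\<^sub>R dderiv f (axis 1 1) z + v $ 2 *\<^sub>R dderiv f (axis 2 1) z)"
    using dderiv_vec2[OF f] by blast
  moreover have "((\<lambda>z. v $ 1 *\<^sub>R dderiv f (axis 1 1) z + v $ 2 *\<^sub>R dderiv f (axis 2 1) z) has_derivative
      (\<lambda>w. v $ 1 *\<^sub>R dderiv (dderiv f (axis 1 1)) w z + v $ 2 *\<^sub>R dderiv (dderiv f (axis 2 1)) w z)) (at z)"
    by (intro derivative_intros smooth_has_derivative smooth_dderiv f)
  ultimately have "dderiv (dderiv f v) w z = v $ 1 *\<^sub>R dderiv (dderiv f (axis 1 1)) w z + v $ 2 *\<^sub>R dderiv (dderiv f (axis 2 1)) w z"
    by (simp add: dderiv_eq)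
  then show ?thesis
    by (subst (asm) dderiv_vec2[OF smooth_dderiv[OF f], of _ w], subst (asm) dderiv_vec2[OF smooth_dderiv[OF f], of _ w])
      (simp add: algebra_simps)
qed

locale phase =
  fixes A :: "real^2 \<Rightarrow> real^2" and V :: "real^2 \<Rightarrow> real" and X Y :: "real^2 \<Rightarrow> real"
  assumes A: "smooth A" and X: "smooth X" and Y: "smooth Y"
begin

definition u :: "real^2 \<Rightarrow> complex" where
  "u z = exp (of_real (X z) + \<i> * of_real (Y z))"

lemma smooth_A_inner: "smooth (\<lambda>z. A z \<bullet> v)"
  by (rule smooth_linear[OF bounded_linear_inner_left A])

text \<open>The conjugated momentum: the magnetic derivative of \<open>u\<close> along
  \<open>v\<close> is \<open>u\<close> times \<open>q v\<close>. The function \<open>q' v\<close> is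
  the derivative of \<open>q v\<close> along \<open>v\<close>.\<close>

definition q :: "real^2 \<Rightarrow> real^2 \<Rightarrow> complex" where
  "q v z = of_real (dderiv Y v z - A z \<bullet> v) - \<i> * of_real (dderiv X v z)"

definition q' :: "real^2 \<Rightarrow> real^2 \<Rightarrow> complex" where
  "q' v z = of_real (dderiv (dderiv Y v) v z - dderiv (\<lambda>z. A z \<bullet> v) v z) - \<i> * of_real (dderiv (dderiv X v) v z)"

lemma u_deriv: "(u has_derivative (\<lambda>v. u z * (of_real (dderiv X v z) + \<i> * of_real (dderiv Y v z)))) (at z)"
proof -
  have "((\<lambda>z. of_real (X z) + \<i> * of_real (Y z) :: complex) has_derivative
      (\<lambda>v. of_real (dderiv X v z) + \<i> * of_real (dderiv Y v z))) (at z)"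
    by (intro derivative_intros smooth_has_derivative X Y)
  from has_derivative_compose[OF this DERIV_exp[unfolded has_field_derivative_def]]
  show ?thesis unfolding u_def .
qed

lemma q_deriv: "(q v has_derivative (\<lambda>w. of_real (dderiv (dderiv Y v) w z - dderiv (\<lambda>z. A z \<bullet> v) w z)
    - \<i> * of_real (dderiv (dderiv X v) w z))) (at z)"
  unfolding q_def by (intro derivative_intros smooth_has_derivative smooth_dderiv X Y smooth_A_inner)

lemma magnetic_u: "magnetic_deriv A j u z = u z * q (axis j 1) z"
proof -
  have "frechet_derivative u (at z) (axis j 1) = u z * (of_real (dderiv X (axis j 1) z) + \<i> * of_real (dderiv Y (axis j 1) z))"
    using dderiv_eq[OF u_deriv] by (simp add: dderiv_def)
  then show ?thesis
    by (simp add: magnetic_deriv_def q_def inner_axis field_simps)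
qed

lemma magnetic_magnetic_u:
  "magnetic_deriv A j (magnetic_deriv A j u) z = u z * ((q (axis j 1) z)^2 - \<i> * q' (axis j 1) z)"
proof -
  let ?v = "axis j 1 :: real^2"
  have "((\<lambda>z. u z * q ?v z) has_derivative (\<lambda>w. u z * (of_real (dderiv (dderiv Y ?v) w z - dderiv (\<lambda>z. A z \<bullet> ?v) w z)
    - \<i> * of_real (dderiv (dderiv X ?v) w z)) + u z * (of_real (dderiv X w z) + \<i> * of_real (dderiv Y w z)) * q ?v z)) (at z)"
    by (rule has_derivative_mult[OF u_deriv q_deriv])
  from dderiv_eq[OF this, of ?v]
  have 1: "frechet_derivative (\<lambda>z. u z * q ?v z) (at z) ?v =
    u z * q' ?v z + u z * (of_real (dderiv X ?v z) + \<i> * of_real (dderiv Y ?v z)) * q ?v z"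
    unfolding q'_def dderiv_def[of "\<lambda>z. u z * q ?v z"] .
  have 2: "magnetic_deriv A j u = (\<lambda>z. u z * q ?v z)" by (intro ext magnetic_u)
  have 3: "- \<i> * (of_real (dderiv X ?v z) + \<i> * of_real (dderiv Y ?v z)) - of_real (A z $ j) = q ?v z"
    by (simp add: q_def inner_axis algebra_simps)
  have "magnetic_deriv A j (magnetic_deriv A j u) z =
      u z * ((- \<i> * (of_real (dderiv X ?v z) + \<i> * of_real (dderiv Y ?v z)) - of_real (A z $ j)) * q ?v z - \<i> * q' ?v z)"
    unfolding magnetic_deriv_def[of A j "magnetic_deriv A j u"] unfolding 2 1
    by (simp add: algebra_simps)
  then show ?thesis unfolding 3 by (simp add: power2_eq_square)
qed

text \<open>\<open>m\<close> and \<open>mp\<close> are orthogonal and of equal length, so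
  derivatives along them reproduce the operator up to the factor \<open>m \<bullet> m\<close>, with
  integer directions and no square roots. The mixed second derivatives of the two directions
  cancel.\<close>

lemma schroedinger_u:
  assumes mp: "mp = vector [- (m $ 2), m $ 1]"
  shows "of_real (m \<bullet> m) * schroedinger_expr A V u z =
    u z * ((q m z)^2 + (q mp z)^2 - \<i> * (q' m z + q' mp z) + of_real ((m \<bullet> m) * V z))"
proof -
  define e1 where "e1 = (axis 1 1 :: real^2)"
  define e2 where "e2 = (axis 2 1 :: real^2)"
  have H: "schroedinger_expr A V u z =
      u z * ((q e1 z)^2 - \<i> * q' e1 z + ((q e2 z)^2 - \<i> * q' e2 z)) + of_real (V z) * u z"
    by (simp add: schroedinger_expr_def magnetic_magnetic_u sum_2 e1_def e2_def algebra_simps)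
  have mm: "m \<bullet> m = m $ 1 * m $ 1 + m $ 2 * m $ 2" by (simp add: inner_vec_def sum_2)
  have Av: "A z \<bullet> v = v $ 1 * (A z \<bullet> e1) + v $ 2 * (A z \<bullet> e2)" for v
    by (simp add: e1_def e2_def inner_axis) (simp add: inner_vec_def sum_2 mult.commute)
  have qv: "q v z = of_real (v $ 1) * q e1 z + of_real (v $ 2) * q e2 z" for v
    unfolding q_def Av[of v] dderiv_vec2[OF X, of v] dderiv_vec2[OF Y, of v] e1_def e2_def
    by (simp add: algebra_simps)
  have dA: "dderiv (\<lambda>z. A z \<bullet> v) w z = w $ 1 * (v $ 1 * dderiv (\<lambda>z. A z \<bullet> e1) e1 z + v $ 2 * dderiv (\<lambda>z. A z \<bullet> e2) e1 z)
     + w $ 2 * (v $ 1 * dderiv (\<lambda>z. A z \<bullet> e1) e2 z + v $ 2 * dderiv (\<lambda>z. A z \<bullet> e2) e2 z)" for v w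
  proof -
    have "(\<lambda>z. A z \<bullet> v) = (\<lambda>z. v $ 1 * (A z \<bullet> e1) + v $ 2 * (A z \<bullet> e2))"
      by (simp add: e1_def e2_def inner_axis) (simp add: inner_vec_def sum_2 mult.commute)
    moreover have "((\<lambda>z. v $ 1 * (A z \<bullet> e1) + v $ 2 * (A z \<bullet> e2)) has_derivative
      (\<lambda>w. v $ 1 * dderiv (\<lambda>z. A z \<bullet> e1) w z + v $ 2 * dderiv (\<lambda>z. A z \<bullet> e2) w z)) (at z)"
      by (intro derivative_intros smooth_has_derivative smooth_A_inner)
    ultimately have "dderiv (\<lambda>z. A z \<bullet> v) w z = v $ 1 * dderiv (\<lambda>z. A z \<bullet> e1) w z + v $ 2 * dderiv (\<lambda>z. A z \<bullet> e2) w z"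
      by (simp add: dderiv_eq)
    moreover have "dderiv (\<lambda>z. A z \<bullet> e) w z = w $ 1 * dderiv (\<lambda>z. A z \<bullet> e) e1 z + w $ 2 * dderiv (\<lambda>z. A z \<bullet> e) e2 z" for e
      using dderiv_vec2[OF smooth_A_inner[of e], of w z] by (simp add: e1_def e2_def)
    ultimately show ?thesis by (simp only:) (simp add: algebra_simps)
  qed
  have q'v: "q' m z + q' mp z = of_real (m \<bullet> m) * (q' e1 z + q' e2 z)"
    unfolding q'_def dA[of m] dA[of mp] dderiv_dderiv_vec2[OF X, of m] dderiv_dderiv_vec2[OF X, of mp]
      dderiv_dderiv_vec2[OF Y, of m] dderiv_dderiv_vec2[OF Y, of mp] e1_def[symmetric] e2_def[symmetric] mm
    by (simp add: mp vector_2 algebra_simps)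
  have qq: "(q m z)^2 + (q mp z)^2 = of_real (m \<bullet> m) * ((q e1 z)^2 + (q e2 z)^2)"
    unfolding qv[of m] qv[of mp] mm by (simp add: mp vector_2 algebra_simps power2_eq_square)
  show ?thesis unfolding H q'v qq by (simp add: algebra_simps)
qed

end

subsection \<open>Coordinates adapted to a closed geodesic\<close>

text \<open>Total differentiability in one statement with names for both partial derivatives, so
  that the chain rule through the coordinates \<open>sc\<close>, \<open>rc\<close> applies directly
  and can be iterated.\<close>

definition partials :: "(real \<Rightarrow> real \<Rightarrow> real) \<Rightarrow> (real \<Rightarrow> real \<Rightarrow> real) \<Rightarrow> (real \<Rightarrow> real \<Rightarrow> real) \<Rightarrow> bool" where
  "partials F Fs Fr \<longleftrightarrow> (\<forall>s r. ((\<lambda>p. F (fst p) (snd p)) has_derivative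
      (\<lambda>h. Fs s r * fst h + Fr s r * snd h)) (at (s, r)))"

lemma partials_cong:
  assumes "partials F Fs Fr" "\<And>s r. F' s r = F s r" "\<And>s r. Fs' s r = Fs s r" "\<And>s r. Fr' s r = Fr s r"
  shows "partials F' Fs' Fr'"
  using assms unfolding partials_def by simp

lemma partials_add:
  assumes "partials F Fs Fr" "partials G Gs Gr"
  shows "partials (\<lambda>s r. F s r + G s r) (\<lambda>s r. Fs s r + Gs s r) (\<lambda>s r. Fr s r + Gr s r)"
  unfolding partials_def
proof (intro allI)
  fix s r
  have "((\<lambda>p. F (fst p) (snd p) + G (fst p) (snd p)) has_derivative
      (\<lambda>h. (Fs s r * fst h + Fr s r * snd h) + (Gs s r * fst h + Gr s r * snd h))) (at (s, r))"
    using assms unfolding partials_def by (intro has_derivative_add) auto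
  then show "((\<lambda>p. F (fst p) (snd p) + G (fst p) (snd p)) has_derivative
      (\<lambda>h. (Fs s r + Gs s r) * fst h + (Fr s r + Gr s r) * snd h)) (at (s, r))"
    by (simp add: algebra_simps)
qed

lemma partials_prod:
  assumes "\<And>s. (c has_real_derivative c' s) (at s)" "\<And>r. (h has_real_derivative h' r) (at r)"
  shows "partials (\<lambda>s r. c s * h r) (\<lambda>s r. c' s * h r) (\<lambda>s r. c s * h' r)"
  unfolding partials_def
proof (intro allI)
  fix s r :: real
  have 1: "((\<lambda>p. c (fst p)) has_derivative (\<lambda>v. fst v * c' s)) (at (s, r))"
    by (rule DERIV_compose_FDERIV[OF _ has_derivative_fst[OF has_derivative_ident]]) (simp add: assms)
  have 2: "((\<lambda>p. h (snd p)) has_derivative (\<lambda>v. snd v * h' r)) (at (s, r))"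
    by (rule DERIV_compose_FDERIV[OF _ has_derivative_snd[OF has_derivative_ident]]) (simp add: assms)
  show "((\<lambda>p. c (fst p) * h (snd p)) has_derivative
      (\<lambda>v. c' s * h r * fst v + c s * h' r * snd v)) (at (s, r))"
    using has_derivative_mult[OF 1 2] by (simp add: algebra_simps)
qed

lemma partials_fst:
  assumes "\<And>s. (c has_real_derivative c' s) (at s)"
  shows "partials (\<lambda>s r. c s) (\<lambda>s r. c' s) (\<lambda>s r. 0)"
  using partials_prod[OF assms, of "\<lambda>r. 1" "\<lambda>r. 0"] by simp

lemma partials_snd:
  assumes "\<And>r. (h has_real_derivative h' r) (at r)"
  shows "partials (\<lambda>s r. h r) (\<lambda>s r. 0) (\<lambda>s r. h' r)"
  using partials_prod[of "\<lambda>s. 1" "\<lambda>s. 0", OF _ assms] by simp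

lemma partials_cmult:
  assumes "partials F Fs Fr" shows "partials (\<lambda>s r. a * F s r) (\<lambda>s r. a * Fs s r) (\<lambda>s r. a * Fr s r)"
  unfolding partials_def
proof (intro allI)
  fix s r
  have "((\<lambda>p. a * F (fst p) (snd p)) has_derivative
      (\<lambda>h. a * (Fs s r * fst h + Fr s r * snd h))) (at (s, r))"
    using assms unfolding partials_def by (intro has_derivative_mult_right) auto
  then show "((\<lambda>p. a * F (fst p) (snd p)) has_derivative
      (\<lambda>h. a * Fs s r * fst h + a * Fr s r * snd h)) (at (s, r))"
    by (simp add: algebra_simps)
qed

lemma periodic_int:
  fixes f :: "real \<Rightarrow> 'a"
  assumes "\<And>x. f (x + L) = f x"
  shows "f (x + L * of_int i) = f x"
proof (induction i rule: int_induct[where k = 0])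
  case (step1 i)
  then show ?case using assms[of "x + L * of_int i"] by (simp add: algebra_simps)
next
  case (step2 i)
  then show ?case using assms[of "x + L * of_int (i - 1)"] by (simp add: algebra_simps)
qed simp

text \<open>\<open>m\<close> and \<open>n\<close> form a basis of the integer lattice, so that
  periodicity on the torus is periodicity by \<open>2 * pi\<close> in each coordinate separately.
  The price is that \<open>n\<close> is in general not orthogonal to \<open>m\<close>, which brings
  \<open>m \<bullet> n\<close> into the transversal derivative.\<close>

locale lattice =
  fixes m1 m2 n1 n2 :: int and z0 :: "real^2"
  assumes det: "m1 * n2 - m2 * n1 = 1"
begin

definition m :: "real^2" where "m = vector [of_int m1, of_int m2]"
definition n :: "real^2" where "n = vector [of_int n1, of_int n2]"
definition mp :: "real^2" where "mp = vector [- of_int m2, of_int m1]"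

lemma comps [simp]: "m $ 1 = m1" "m $ 2 = m2" "n $ 1 = n1" "n $ 2 = n2" "mp $ 1 = - m2" "mp $ 2 = m1"
  by (simp_all add: m_def n_def mp_def)

lemma mp_eq: "mp = vector [- (m $ 2), m $ 1]"
  by (simp add: mp_def)

definition sl :: "real^2 \<Rightarrow> real" where "sl v = v $ 1 * n2 - v $ 2 * n1"
definition rl :: "real^2 \<Rightarrow> real" where "rl v = m1 * v $ 2 - m2 * v $ 1"
definition sc where "sc z = sl (z - z0)"
definition rc where "rc z = rl (z - z0)"
definition pt where "pt s r = z0 + s *\<^sub>R m + r *\<^sub>R n"

lemma detr: "real_of_int m1 * n2 - real_of_int m2 * n1 = 1"
  using det by (metis of_int_1 of_int_diff of_int_mult)

lemma bounded_linear_coords: "bounded_linear sl" "bounded_linear rl"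
  unfolding sl_def rl_def
  by (intro bounded_linear_sub bounded_linear_mult_left bounded_linear_mult_right
      bounded_linear_compose[OF bounded_linear_mult_left bounded_linear_vec_nth]
      bounded_linear_compose[OF bounded_linear_mult_right bounded_linear_vec_nth])+

lemma pt_coords [simp]: "pt (sc z) (rc z) = z"
proof -
  have "z - z0 = sl (z - z0) *\<^sub>R m + rl (z - z0) *\<^sub>R n"
    unfolding vec_eq_iff forall_2 sl_def rl_def using detr
    by (simp add: algebra_simps) algebra
  then show ?thesis by (simp add: pt_def sc_def rc_def algebra_simps)
qed

lemma coords_lin: "sl m = 1" "rl m = 0" "sl n = 0" "rl n = 1"
  "sl mp = - (m \<bullet> n)" "rl mp = m \<bullet> m"
  using detr by (simp_all add: sl_def rl_def inner_vec_def sum_2 algebra_simps)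

lemma mp_decomp: "mp = (m \<bullet> m) *\<^sub>R n - (m \<bullet> n) *\<^sub>R m"
  unfolding vec_eq_iff forall_2 inner_vec_def sum_2 using detr
  by simp algebra

lemma coords_pt [simp]: "sc (pt s r) = s" "rc (pt s r) = r"
proof -
  have "pt s r - z0 = s *\<^sub>R m + r *\<^sub>R n" by (simp add: pt_def)
  moreover have "linear sl" "linear rl"
    using bounded_linear_coords by (auto dest: bounded_linear.linear)
  ultimately show "sc (pt s r) = s" "rc (pt s r) = r"
    by (simp_all add: sc_def rc_def linear_add linear_scale coords_lin)
qed

lemma norm_m: "m \<bullet> m \<ge> 1"
proof -
  have "m1 \<noteq> 0 \<or> m2 \<noteq> 0" using det by auto
  then have "m1^2 + m2^2 > 0" by (simp add: sum_power2_gt_zero_iff)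
  then have "real_of_int (m1^2 + m2^2) \<ge> 1" by (simp only: of_int_1_le_iff)
  then show ?thesis by (simp add: inner_vec_def sum_2 power2_eq_square)
qed

lemma periodic_pt:
  assumes "periodic F"
  shows "F (pt (s + 2 * pi * of_int i) (r + 2 * pi * of_int j)) = F (pt s r)"
proof -
  define l :: "int^2" where "l = vector [i * m1 + j * n1, i * m2 + j * n2]"
  have "pt (s + 2 * pi * of_int i) (r + 2 * pi * of_int j) = pt s r + period l"
    unfolding vec_eq_iff forall_2 by (simp add: pt_def l_def algebra_simps)
  then show ?thesis using periodic_shift[OF assms] by simp
qed

lemma coords_shift:
  obtains i j :: int where
    "sc (z + period l) = sc z + 2 * pi * of_int i"
    "rc (z + period l) = rc z + 2 * pi * of_int j"
proof
  show "sc (z + period l) = sc z + 2 * pi * of_int (l $ 1 * n2 - l $ 2 * n1)"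
    "rc (z + period l) = rc z + 2 * pi * of_int (m1 * l $ 2 - m2 * l $ 1)"
    by (simp_all add: sc_def rc_def sl_def rl_def algebra_simps)
qed

lemma periodic_coords:
  assumes "\<And>s r. F (s + 2 * pi) r = F s r" "\<And>s r. F s (r + 2 * pi) = F s r"
  shows "periodic (\<lambda>z. F (sc z) (rc z))"
proof -
  note s = periodic_int[of "\<lambda>s. F s r" "2 * pi" for r, OF assms(1)]
    and r = periodic_int[of "F s" "2 * pi" for s, OF assms(2)]
  show ?thesis
    unfolding periodic_def
  proof (intro allI)
    fix z and l :: "int^2"
    obtain i j where "sc (z + period l) = sc z + 2 * pi * of_int i"
      "rc (z + period l) = rc z + 2 * pi * of_int j"
      by (rule coords_shift)
    then show "F (sc (z + period l)) (rc (z + period l))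
      = F (sc z) (rc z)"
      by (simp add: s r)
  qed
qed

lemma coords_deriv:
  "((\<lambda>z. (sc z, rc z)) has_derivative (\<lambda>v. (sl v, rl v))) (at z)"
proof -
  have "((\<lambda>z. z - z0) has_derivative (\<lambda>v. v)) (at z)" by (auto intro!: derivative_eq_intros)
  from bounded_linear.has_derivative[OF bounded_linear_coords(1) this]
    bounded_linear.has_derivative[OF bounded_linear_coords(2) this]
  show ?thesis unfolding sc_def rc_def by (rule has_derivative_Pair)
qed

lemma partials_dderiv:
  assumes "partials F Fs Fr"
  shows "dderiv (\<lambda>z. F (sc z) (rc z)) v z = Fs (sc z) (rc z) * sl v + Fr (sc z) (rc z) * rl v"
proof -
  have "((\<lambda>p. F (fst p) (snd p)) has_derivative
      (\<lambda>h. Fs (sc z) (rc z) * fst h + Fr (sc z) (rc z) * snd h)) (at (sc z, rc z))"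
    using assms by (simp add: partials_def)
  from has_derivative_compose[OF coords_deriv this]
  show ?thesis by (subst dderiv_eq) simp_all
qed

lemma partials_dderiv_m:
  assumes "partials F Fs Fr"
  shows "dderiv (\<lambda>z. F (sc z) (rc z)) m = (\<lambda>z. Fs (sc z) (rc z))"
    "dderiv (\<lambda>z. F (sc z) (rc z)) mp = (\<lambda>z. (m \<bullet> m) * Fr (sc z) (rc z) - (m \<bullet> n) * Fs (sc z) (rc z))"
  by (rule ext, subst partials_dderiv[OF assms], simp add: coords_lin)+

lemma partials_dderiv_dderiv:
  assumes 1: "partials F Fs Fr" and 2: "partials Fs Fss Fsr" and 3: "partials Fr Fsr Frr"
  shows "dderiv (dderiv (\<lambda>z. F (sc z) (rc z)) m) m z = Fss (sc z) (rc z)"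
    "dderiv (dderiv (\<lambda>z. F (sc z) (rc z)) mp) mp z = (m \<bullet> m)^2 * Frr (sc z) (rc z)
      - 2 * (m \<bullet> m) * (m \<bullet> n) * Fsr (sc z) (rc z) + (m \<bullet> n)^2 * Fss (sc z) (rc z)"
proof -
  show "dderiv (dderiv (\<lambda>z. F (sc z) (rc z)) m) m z = Fss (sc z) (rc z)"
    unfolding partials_dderiv_m(1)[OF 1] partials_dderiv_m(1)[OF 2] ..
  have 4: "partials (\<lambda>s r. (m \<bullet> m) * Fr s r - (m \<bullet> n) * Fs s r)
      (\<lambda>s r. (m \<bullet> m) * Fsr s r - (m \<bullet> n) * Fss s r) (\<lambda>s r. (m \<bullet> m) * Frr s r - (m \<bullet> n) * Fsr s r)"
    by (rule partials_cong[OF partials_add[OF partials_cmult[OF 3, of "m \<bullet> m"] partials_cmult[OF 2, of "- (m \<bullet> n)"]]]) simp_all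
  show "dderiv (dderiv (\<lambda>z. F (sc z) (rc z)) mp) mp z = (m \<bullet> m)^2 * Frr (sc z) (rc z)
      - 2 * (m \<bullet> m) * (m \<bullet> n) * Fsr (sc z) (rc z) + (m \<bullet> n)^2 * Fss (sc z) (rc z)"
    unfolding partials_dderiv_m(2)[OF 1] partials_dderiv_m(2)[OF 4] by (simp add: algebra_simps power2_eq_square)
qed

lemma smooth_coords:
  assumes "smooth (h :: real \<Rightarrow> real)"
  shows "smooth (\<lambda>z. h (sc z))" "smooth (\<lambda>z. h (rc z))"
proof -
  have "sc = (\<lambda>z. - sl z0 + sl z)" "rc = (\<lambda>z. - rl z0 + rl z)"
    by (simp_all add: sc_def rc_def sl_def rl_def algebra_simps fun_eq_iff)
  note eq = this
  show "smooth (\<lambda>z. h (sc z))" "smooth (\<lambda>z. h (rc z))"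
    unfolding eq by (rule smooth_compose_affine[OF _ assms], rule bounded_linear_coords)+
qed

end

subsection \<open>Periodic functions of one variable\<close>

lemma real_period_rep:
  fixes x :: real assumes "L > 0"
  obtains i :: int where "0 \<le> x + L * of_int i" "x + L * of_int i < L"
proof
  have "0 \<le> L * (x / L - \<lfloor>x / L\<rfloor>)" using assms by simp
  then show "0 \<le> x + L * of_int (- \<lfloor>x / L\<rfloor>)" using assms by (simp add: algebra_simps)
  have "L * (x / L - \<lfloor>x / L\<rfloor>) < L * 1" using assms by (intro mult_strict_left_mono) (linarith, simp)
  then show "x + L * of_int (- \<lfloor>x / L\<rfloor>) < L" using assms by (simp add: algebra_simps)
qed

lemma periodic_real_bounded:
  fixes f :: "real \<Rightarrow> 'b::real_normed_vector"
  assumes "\<And>x. f (x + L) = f x" "L > 0" "continuous_on UNIV f"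
  shows "bounded (range f)"
proof -
  have "compact (f ` {0..L})"
    by (intro compact_continuous_image continuous_on_subset[OF assms(3)]) auto
  moreover have "range f \<subseteq> f ` {0..L}"
  proof
    fix y assume "y \<in> range f"
    then obtain x where y: "y = f x" by blast
    obtain i :: int where "0 \<le> x + L * of_int i" "x + L * of_int i < L"
      using real_period_rep[OF assms(2)] by blast
    then have "f (x + L * of_int i) \<in> f ` {0..L}" by (intro imageI) auto
    then show "y \<in> f ` {0..L}" using periodic_int[of f L x i, OF assms(1)] y by simp
  qed
  ultimately show ?thesis by (rule bounded_subset[OF compact_imp_bounded])
qed

lemma periodic_antiderivative:
  fixes f :: "real \<Rightarrow> 'b::euclidean_space"
  assumes per: "\<And>x. f (x + L) = f x" and L: "L > 0" and cont: "continuous_on UNIV f"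
    and int: "integral {0..L} f = 0"
  obtains F where "\<And>x. (F has_vector_derivative f x) (at x)" "\<And>x. F (x + L) = F x"
proof -
  have "\<exists>F. \<forall>x::real. - \<infinity> < ereal x \<longrightarrow> ereal x < \<infinity> \<longrightarrow> (F has_vector_derivative f x) (at x)"
  proof (rule einterval_antiderivative)
    show "isCont f x" for x using cont by (simp add: continuous_on_eq_continuous_at)
  qed simp
  then obtain F where "\<forall>x::real. - \<infinity> < ereal x \<longrightarrow> ereal x < \<infinity> \<longrightarrow> (F has_vector_derivative f x) (at x)"
    by (rule exE)
  then have F: "\<And>x. (F has_vector_derivative f x) (at x)" by simp
  have "((\<lambda>x. F (x + L) - F x) has_vector_derivative 0) (at x)" for x
  proof -
    have "((\<lambda>x. F (x + L)) has_vector_derivative f (x + L)) (at x)"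
    proof -
      have "((\<lambda>x. x + L) has_real_derivative 1) (at x)"
        by (auto intro!: derivative_eq_intros)
      then have "((\<lambda>x. x + L) has_vector_derivative 1) (at x)"
        by (simp only: has_real_derivative_iff_has_vector_derivative)
      from vector_diff_chain_at[OF this F] show ?thesis by (simp add: o_def)
    qed
    from has_vector_derivative_diff[OF this F[of x]] show ?thesis by (simp add: per)
  qed
  then obtain c where c: "\<And>x. F (x + L) - F x = c"
    using has_vector_derivative_zero_constant[of UNIV "\<lambda>x. F (x + L) - F x"] by auto
  have "(f has_integral (F L - F 0)) {0..L}"
    using L by (intro fundamental_theorem_of_calculus has_vector_derivative_at_within[OF F]) simp
  from integral_unique[OF this] have "F L - F 0 = 0" using int by simp
  then have "c = 0" using c[of 0] by simp
  then have "F (x + L) = F x" for x using c[of x] by simp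
  with F show ?thesis by (rule that)
qed

definition mean :: "(real \<Rightarrow> 'b::euclidean_space) \<Rightarrow> 'b" where
  "mean f = (1 / (2 * pi)) *\<^sub>R integral {0..2 * pi} f"

lemma mean_const [simp]: "mean (\<lambda>s. c) = c"
  by (simp add: mean_def)

lemma integrable_period: "continuous_on UNIV f \<Longrightarrow> f integrable_on {0..2 * pi}"
  for f :: "real \<Rightarrow> 'b::euclidean_space"
  by (rule integrable_continuous_real[OF continuous_on_subset[OF _ subset_UNIV]])

lemma mean_add:
  assumes "continuous_on UNIV f" "continuous_on UNIV g"
  shows "mean (\<lambda>s. f s + g s) = mean f + mean g"
  unfolding mean_def integral_add[OF integrable_period[OF assms(1)] integrable_period[OF assms(2)]]
  by (rule scaleR_add_right)

lemma mean_linear: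
  assumes "bounded_linear h" "continuous_on UNIV f"
  shows "mean (\<lambda>s. h (f s)) = h (mean f)"
  using integral_linear[OF integrable_period[OF assms(2)] assms(1)]
  unfolding mean_def o_def by (simp add: linear_scale[OF bounded_linear.linear[OF assms(1)]])

lemma mean_cmult: "continuous_on UNIV f \<Longrightarrow> mean (\<lambda>s. c * f s) = c * mean f" for f :: "real \<Rightarrow> real"
  using mean_linear[OF bounded_linear_mult_right] .

lemma mean_zero_antiderivative:
  fixes f :: "real \<Rightarrow> 'b::euclidean_space"
  assumes per: "\<And>x. f (x + 2 * pi) = f x" and cont: "continuous_on UNIV f"
  obtains F where "\<And>x. (F has_vector_derivative (f x - mean f)) (at x)" "\<And>x. F (x + 2 * pi) = F x"
proof (rule periodic_antiderivative[of "\<lambda>x. f x - mean f" "2 * pi"])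
  have "mean (\<lambda>x. f x + - mean f) = 0"
    unfolding mean_add[OF cont continuous_on_const] by simp
  then show "integral {0..2 * pi} (\<lambda>x. f x - mean f) = 0"
    by (simp add: mean_def)
  show "continuous_on UNIV (\<lambda>x. f x - mean f)"
    by (intro continuous_on_diff cont continuous_on_const)
qed (use per in auto)

text \<open>The oscillating part \<open>f - mean f\<close> has a periodic, hence bounded primitive,
  so its averages decay like \<open>1 / S\<close>.\<close>

lemma average_tendsto_mean:
  fixes f :: "real \<Rightarrow> 'b::euclidean_space"
  assumes per: "\<And>x. f (x + 2 * pi) = f x" and cont: "continuous_on UNIV f" and c: "c \<noteq> 0"
  shows "((\<lambda>S. (1 / S) *\<^sub>R integral {0..S} (\<lambda>t. f (a + c * t))) \<longlongrightarrow> mean f) at_top"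
proof -
  obtain F where F: "\<And>x. (F has_vector_derivative (f x - mean f)) (at x)" "\<And>x. F (x + 2 * pi) = F x"
    by (rule mean_zero_antiderivative[OF per cont]) (rule that)
  have "continuous_on UNIV F"
    using has_vector_derivative_continuous[OF F(1)] by (simp add: continuous_on_eq_continuous_within)
  then have "bounded (range F)"
    by (intro periodic_real_bounded[of F "2 * pi", OF F(2)]) simp
  then obtain B where B: "\<And>x. norm (F x) \<le> B" unfolding bounded_iff by auto
  have dF: "((\<lambda>t. (1 / c) *\<^sub>R F (a + c * t)) has_vector_derivative (f (a + c * t) - mean f)) (at t)" for t
  proof -
    have "((\<lambda>t. a + c * t) has_real_derivative c) (at t)"
      by (auto intro!: derivative_eq_intros)
    then have "((\<lambda>t. a + c * t) has_vector_derivative c) (at t)"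
      by (simp only: has_real_derivative_iff_has_vector_derivative)
    from vector_diff_chain_at[OF this F(1)]
    have "((\<lambda>t. F (a + c * t)) has_vector_derivative c *\<^sub>R (f (a + c * t) - mean f)) (at t)"
      by (simp add: o_def)
    from bounded_linear.has_vector_derivative[OF bounded_linear_scaleR_right this, of "1 / c"]
    show ?thesis using c by simp
  qed
  have eq: "(1 / S) *\<^sub>R integral {0..S} (\<lambda>t. f (a + c * t)) - mean f
      = (1 / (c * S)) *\<^sub>R (F (a + c * S) - F a)" if S: "S > 0" for S
  proof -
    have "((\<lambda>t. f (a + c * t) - mean f) has_integral ((1 / c) *\<^sub>R F (a + c * S) - (1 / c) *\<^sub>R F (a + c * 0))) {0..S}"
      by (rule fundamental_theorem_of_calculus[where f = "\<lambda>t. (1 / c) *\<^sub>R F (a + c * t)"])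
        (use S has_vector_derivative_at_within[OF dF] in auto)
    from has_integral_add[OF this has_integral_const_real[of "mean f" 0 S]]
    have "((\<lambda>t. f (a + c * t)) has_integral ((1 / c) *\<^sub>R F (a + c * S) - (1 / c) *\<^sub>R F a + S *\<^sub>R mean f)) {0..S}"
      using S by simp
    then have int: "integral {0..S} (\<lambda>t. f (a + c * t)) = (1 / c) *\<^sub>R F (a + c * S) - (1 / c) *\<^sub>R F a + S *\<^sub>R mean f"
      by (rule integral_unique)
    show ?thesis unfolding int using S
      by (simp add: scaleR_right_distrib scaleR_right_diff_distrib mult.commute)
  qed
  have "((\<lambda>S. 2 * B / \<bar>c\<bar> * inverse S) \<longlongrightarrow> 2 * B / \<bar>c\<bar> * 0) at_top"
    by (intro tendsto_mult_left tendsto_inverse_0_at_top filterlim_ident)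
  then have "((\<lambda>S. 2 * B / \<bar>c\<bar> * inverse S) \<longlongrightarrow> 0) at_top" by simp
  moreover have "eventually (\<lambda>S. norm ((1 / S) *\<^sub>R integral {0..S} (\<lambda>t. f (a + c * t)) - mean f)
      \<le> 2 * B / \<bar>c\<bar> * inverse S) at_top"
    using eventually_gt_at_top[of 0]
  proof eventually_elim
    case (elim S)
    have 1: "norm (F (a + c * S) - F a) \<le> B + B"
      by (intro order_trans[OF norm_triangle_ineq4] add_mono B)
    have "norm ((1 / (c * S)) *\<^sub>R (F (a + c * S) - F a)) = (1 / \<bar>c * S\<bar>) * norm (F (a + c * S) - F a)"
      by (simp only: norm_scaleR abs_divide abs_one)
    also have "\<dots> \<le> (1 / \<bar>c * S\<bar>) * (B + B)"
      by (rule mult_left_mono[OF 1]) simp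
    also have "\<dots> = 2 * B / \<bar>c\<bar> * inverse S"
      using elim by (simp add: abs_mult divide_inverse)
    finally show ?case unfolding eq[OF elim] .
  qed
  ultimately have "((\<lambda>S. (1 / S) *\<^sub>R integral {0..S} (\<lambda>t. f (a + c * t)) - mean f) \<longlongrightarrow> 0) at_top"
    by (rule Lim_null_comparison[rotated])
  then show ?thesis by (rule Lim_null[THEN iffD2])
qed

definition circle_smooth :: "(real \<Rightarrow> real) \<Rightarrow> bool" where
  "circle_smooth c \<longleftrightarrow> smooth c \<and> (\<forall>x. c (x + 2 * pi) = c x)"

lemma circle_smooth_const: "circle_smooth (\<lambda>s. a)"
  by (simp add: circle_smooth_def smooth_const)

lemma circle_smooth_add: "circle_smooth f \<Longrightarrow> circle_smooth g \<Longrightarrow> circle_smooth (\<lambda>s. f s + g s)"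
  by (simp add: circle_smooth_def smooth_add)

lemma circle_smooth_diff: "circle_smooth f \<Longrightarrow> circle_smooth g \<Longrightarrow> circle_smooth (\<lambda>s. f s - g s)"
  by (simp add: circle_smooth_def smooth_diff)

lemma circle_smooth_mult: "circle_smooth f \<Longrightarrow> circle_smooth g \<Longrightarrow> circle_smooth (\<lambda>s. f s * g s)"
  by (simp add: circle_smooth_def smooth_mult)

lemma circle_smooth_power: "circle_smooth f \<Longrightarrow> circle_smooth (\<lambda>s. f s ^ k)"
  by (simp add: circle_smooth_def smooth_power)

lemmas circle_smooth_intros = circle_smooth_const circle_smooth_add circle_smooth_diff
  circle_smooth_mult circle_smooth_power

lemma circle_smooth_continuous: "circle_smooth f \<Longrightarrow> continuous_on S f"
  by (simp add: circle_smooth_def smooth_continuous)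

lemma circle_smooth_bounded: "circle_smooth f \<Longrightarrow> bounded (range f)"
  by (rule periodic_real_bounded[where L = "2 * pi"]) (auto simp: circle_smooth_def smooth_continuous)

lemma circle_smooth_deriv:
  assumes "circle_smooth f"
  obtains f' where "circle_smooth f'" "\<And>s. (f has_real_derivative f' s) (at s)"
proof -
  obtain g where g: "\<And>x. (f has_real_derivative g x) (at x)" "smooth g"
    using assms unfolding circle_smooth_def by (auto elim: smooth_deriv)
  have "g (x + 2 * pi) = g x" for x
  proof -
    have "((\<lambda>x. f (x + 2 * pi)) has_real_derivative g (x + 2 * pi)) (at x)"
      using DERIV_shift[of f "g (x + 2 * pi)" x "2 * pi"] g(1) by blast
    moreover have "(\<lambda>x. f (x + 2 * pi)) = f" using assms by (auto simp: circle_smooth_def)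
    ultimately show ?thesis using DERIV_unique[OF _ g(1)[of x]] by simp
  qed
  then show ?thesis using that[of g] g by (simp add: circle_smooth_def)
qed

lemma mean_deriv:
  assumes "circle_smooth f" "\<And>s. (f has_real_derivative f' s) (at s)"
  shows "mean f' = 0"
proof -
  have "(f' has_integral (f (2 * pi) - f 0)) {0..2 * pi}"
  proof (rule fundamental_theorem_of_calculus)
    show "(f has_vector_derivative f' x) (at x within {0..2 * pi})" for x
      using has_field_derivative_at_within[OF assms(2)]
      by (simp only: has_real_derivative_iff_has_vector_derivative)
  qed simp
  moreover have "f (2 * pi) = f 0" using assms(1) unfolding circle_smooth_def by (metis add_0)
  ultimately show ?thesis by (simp add: mean_def integral_unique)
qed

text \<open>The free constant of integration is exposed as the mean \<open>w\<close>; it is the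
  freedom that later makes the equations for \<open>\<rho>\<close> solvable.\<close>

lemma circle_smooth_primitive:
  assumes "circle_smooth f"
  obtains F where "circle_smooth F" "\<And>s. (F has_real_derivative (f s - mean f)) (at s)" "mean F = w"
proof -
  obtain F where F: "\<And>x. (F has_vector_derivative (f x - mean f)) (at x)" "\<And>x. F (x + 2 * pi) = F x"
  proof (rule mean_zero_antiderivative)
    show "f (x + 2 * pi) = f x" for x using assms by (simp add: circle_smooth_def)
  qed (use circle_smooth_continuous[OF assms] that in auto)
  have d: "(F has_real_derivative (f s - mean f)) (at s)" for s
    using F(1) by (simp add: has_real_derivative_iff_has_vector_derivative)
  have "smooth F"
    by (rule smooth_real_deriv[OF d]) (use assms in \<open>auto simp: circle_smooth_def intro: smooth_intros\<close>)
  then have "circle_smooth F" using F(2) by (simp add: circle_smooth_def)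
  then have "circle_smooth (\<lambda>s. F s + (w - mean F))"
    by (intro circle_smooth_intros)
  moreover have "((\<lambda>s. F s + (w - mean F)) has_real_derivative (f s - mean f)) (at s)" for s
    using d[of s] by (auto intro!: derivative_eq_intros)
  moreover have "mean (\<lambda>s. F s + (w - mean F)) = w"
    using circle_smooth_continuous[OF \<open>circle_smooth F\<close>] by (subst mean_add) auto
  ultimately show ?thesis by (rule that)
qed

subsection \<open>Expansion in the transversal variable\<close>

lemma periodic_dderiv:
  assumes "periodic F" "smooth F" shows "periodic (dderiv F v)"
  unfolding periodic_def
proof (intro allI)
  fix z and l :: "int^2"
  define w where "w = period l"
  have "((\<lambda>z. z + w) has_derivative (\<lambda>v. v)) (at z)" by (auto intro!: derivative_eq_intros)
  from has_derivative_compose[OF this smooth_has_derivative[OF assms(2)]]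
  have "((\<lambda>z. F (z + w)) has_derivative (\<lambda>v. dderiv F v (z + w))) (at z)" .
  moreover have "(\<lambda>z. F (z + w)) = F" using assms(1) by (auto simp: periodic_def w_def)
  ultimately show "dderiv F v (z + period l) = dderiv F v z"
    using dderiv_eq[of F "\<lambda>v. dderiv F v (z + w)" z v] by (simp add: w_def)
qed

context lattice
begin

lemma pt_deriv:
  fixes F :: "real^2 \<Rightarrow> real"
  assumes "smooth F"
  shows "((\<lambda>r. F (pt s r)) has_real_derivative dderiv F n (pt s r)) (at r)"
    "((\<lambda>s. F (pt s r)) has_real_derivative dderiv F m (pt s r)) (at s)"
proof -
  have "((\<lambda>r. pt s r) has_derivative (\<lambda>h. h *\<^sub>R n)) (at r)"
    "((\<lambda>s. pt s r) has_derivative (\<lambda>h. h *\<^sub>R m)) (at s)"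
    unfolding pt_def by (auto intro!: derivative_eq_intros)
  from this[THEN has_derivative_compose, OF smooth_has_derivative[OF assms]]
  show "((\<lambda>r. F (pt s r)) has_real_derivative dderiv F n (pt s r)) (at r)"
    "((\<lambda>s. F (pt s r)) has_real_derivative dderiv F m (pt s r)) (at s)"
    unfolding has_field_derivative_def by (simp_all add: dderiv_scale[OF assms] mult_commute_abs)
qed

definition nderiv :: "nat \<Rightarrow> (real^2 \<Rightarrow> real) \<Rightarrow> real^2 \<Rightarrow> real" where
  "nderiv j F = ((\<lambda>F. dderiv F n) ^^ j) F"

lemma nderiv_smooth: "smooth F \<Longrightarrow> smooth (nderiv j F)"
  by (induction j) (auto simp: nderiv_def smooth_dderiv)

lemma nderiv_periodic: "periodic F \<Longrightarrow> smooth F \<Longrightarrow> periodic (nderiv j F)"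
proof (induction j)
  case (Suc j)
  then show ?case using periodic_dderiv[of "nderiv j F"] nderiv_smooth[of F j] by (simp add: nderiv_def)
qed (simp add: nderiv_def)

lemma circle_smooth_pt:
  assumes "periodic F" "smooth F" shows "circle_smooth (\<lambda>s. F (pt s r))"
proof -
  have "bounded_linear (\<lambda>s. s *\<^sub>R m)" by (rule bounded_linear_scaleR_left)
  from smooth_compose_affine[OF this assms(2), of "z0 + r *\<^sub>R n"]
  have "smooth (\<lambda>s. F (pt s r))" by (simp add: pt_def algebra_simps)
  then show ?thesis using periodic_pt[OF assms(1), of _ 1 r 0] by (simp add: circle_smooth_def)
qed

text \<open>Taylor expansion with Lagrange remainder along \<open>n\<close>; the derivative of order
  \<open>N\<close> is bounded on the compact torus, whence the constant is uniform in
  \<open>s\<close>.\<close>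

lemma taylor_vanish:
  assumes "periodic F" "smooth F"
  shows "vanish N (\<lambda>k s r. F (pt s r) - (\<Sum>j<N. nderiv j F (pt s 0) / fact j * r ^ j))"
proof -
  obtain B where B: "B > 0" "\<And>z. norm (nderiv N F z) \<le> B"
    using periodic_continuous_bounded[OF nderiv_periodic[OF assms] smooth_continuous[OF nderiv_smooth[OF assms(2)]]]
    by blast
  show ?thesis
  proof (rule vanish_I[where C = "B / fact N"])
    fix s r :: real
    have "\<forall>j r. ((\<lambda>r. nderiv j F (pt s r)) has_real_derivative nderiv (Suc j) F (pt s r)) (at r)"
      using pt_deriv(1)[OF nderiv_smooth[OF assms(2)]] by (simp add: nderiv_def)
    from Maclaurin_all_le[of "\<lambda>j r. nderiv j F (pt s r)", OF refl this, of r N]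
    obtain t where "F (pt s r) = (\<Sum>j<N. nderiv j F (pt s 0) / fact j * r ^ j) + nderiv N F (pt s t) / fact N * r ^ N"
      by (auto simp: nderiv_def)
    moreover have "\<bar>nderiv N F (pt s t) / fact N * r ^ N\<bar> \<le> B / fact N * \<bar>r\<bar> ^ N"
      using B(2)[of "pt s t"] by (auto simp: abs_mult power_abs intro!: mult_right_mono divide_right_mono)
    ultimately show "\<bar>F (pt s r) - (\<Sum>j<N. nderiv j F (pt s 0) / fact j * r ^ j)\<bar> \<le> B / fact N * \<bar>r\<bar> ^ N"
      by simp
  qed
qed

lemma vanish_nderiv: "periodic F \<Longrightarrow> smooth F \<Longrightarrow> vanish 0 (\<lambda>k s r. nderiv j F (pt s 0))"
  by (rule vanish_bounded[OF circle_smooth_bounded[OF circle_smooth_pt[OF nderiv_periodic nderiv_smooth]]])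

lemma taylor_vanish_1:
  assumes "periodic F" "smooth F"
  shows "vanish 1 (\<lambda>k s r. F (pt s r) - F (pt s 0))"
  using taylor_vanish[OF assms, of 1] by (simp add: nderiv_def)

end

section \<open>Powers of the transversal variable as polynomials in its sine\<close>

lemma vanish_id: "vanish 1 (\<lambda>k s r. r)"
  by (rule vanish_I[where C = 1]) auto

lemma vanish_sin_3: "vanish 3 (\<lambda>k s r. r - sin r)"
proof (rule vanish_I[where C = "1 / 6"])
  fix r :: real
  have "(\<Sum>m<3. sin_coeff m * r ^ m) = r"
    by (simp add: lessThan_nat_numeral lessThan_Suc sin_coeff_def)
  then show "\<bar>r - sin r\<bar> \<le> 1 / 6 * \<bar>r\<bar> ^ 3"
    using Maclaurin_sin_bound[of r 3] by (simp add: abs_minus_commute fact_numeral)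
qed

lemma vanish_sin_cube: "vanish 5 (\<lambda>k s r. r ^ 3 - sin r ^ 3)"
proof -
  have 1: "vanish 2 (\<lambda>k s r. r ^ 2)" by (rule vanish_power[OF vanish_id]) simp
  have 2: "vanish 2 (\<lambda>k s r. r * sin r)" by (rule vanish_mult[OF vanish_id vanish_sin]) simp
  have 3: "vanish 2 (\<lambda>k s r. sin r ^ 2)" by (rule vanish_sin_power) simp
  have "vanish 5 (\<lambda>k s r. (r - sin r) * (r ^ 2 + r * sin r + sin r ^ 2))"
    by (rule vanish_mult[OF vanish_sin_3 vanish_add[OF vanish_add[OF 1 2] 3]]) simp
  then show ?thesis
    by (rule vanish_cong) (simp add: power2_eq_square power3_eq_cube algebra_simps)
qed

text \<open>The beginning of the arcsine series, obtained from the sine series by replacing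
  \<open>r ^ 3\<close> with \<open>sin r ^ 3\<close>.\<close>

lemma vanish_sin_5: "vanish 5 (\<lambda>k s r. r - sin r - sin r ^ 3 / 6)"
proof -
  have 5: "vanish 5 (\<lambda>k s r. r - r ^ 3 / 6 - sin r)"
  proof (rule vanish_I[where C = "1 / 120"])
    fix r :: real
    have "(\<Sum>m<5. sin_coeff m * r ^ m) = r - r ^ 3 / 6"
      by (simp add: lessThan_nat_numeral lessThan_Suc sin_coeff_def fact_numeral)
    then show "\<bar>r - r ^ 3 / 6 - sin r\<bar> \<le> 1 / 120 * \<bar>r\<bar> ^ 5"
      using Maclaurin_sin_bound[of r 5] by (simp add: abs_minus_commute fact_numeral)
  qed
  show ?thesis
    by (rule vanish_cong[OF vanish_add[OF 5 vanish_times[OF vanish_const[of "1 / 6"] vanish_sin_cube]]])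
      (simp add: algebra_simps)
qed

text \<open>The square of the truncated arcsine series, which explains
  \<open>1 / 3 = 2 * (1 / 6)\<close>.\<close>

lemma vanish_sin_sq: "vanish 5 (\<lambda>k s r. r ^ 2 - sin r ^ 2 - sin r ^ 4 / 3)"
proof -
  have 1: "vanish 5 (\<lambda>k s r. (r - sin r - sin r ^ 3 / 6) * (r + sin r))"
    by (rule vanish_times'[OF vanish_sin_5 vanish_add[OF vanish_0[OF vanish_id] vanish_0[OF vanish_sin]]])
  have 2: "vanish 5 (\<lambda>k s r. sin r ^ 3 * (r - sin r))"
    by (rule vanish_mult[OF vanish_sin_power[of 3] vanish_sin_3]) auto
  show ?thesis
  proof (rule vanish_cong[OF vanish_add[OF 1 vanish_times[OF vanish_const[of "1 / 6"] 2]]])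
    show "r ^ 2 - sin r ^ 2 - sin r ^ 4 / 3 =
      (r - sin r - sin r ^ 3 / 6) * (r + sin r) + 1 / 6 * (sin r ^ 3 * (r - sin r))" for r :: real
      by (simp add: eval_nat_numeral algebra_simps)
  qed
qed

lemma vanish_sin_fourth: "vanish 5 (\<lambda>k s r. r ^ 4 - sin r ^ 4)"
proof -
  have 1: "vanish 2 (\<lambda>k s r. r ^ 2)" by (rule vanish_power[OF vanish_id]) simp
  have 3: "vanish 2 (\<lambda>k s r. sin r ^ 2)" by (rule vanish_sin_power) simp
  have "vanish 5 (\<lambda>k s r. (r - sin r) * ((r + sin r) * (r ^ 2 + sin r ^ 2)))"
    by (rule vanish_mult[OF vanish_sin_3 vanish_times[OF vanish_add[OF vanish_0[OF vanish_id] vanish_0[OF vanish_sin]] vanish_add[OF 1 3]]]) simp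
  then show ?thesis
    by (rule vanish_cong) (simp add: eval_nat_numeral algebra_simps)
qed

context lattice
begin

lemma taylor_vanish_2:
  assumes "periodic F" "smooth F"
  shows "vanish 2 (\<lambda>k s r. F (pt s r) - (F (pt s 0) + dderiv F n (pt s 0) * sin r))"
proof -
  have "vanish 2 (\<lambda>k s r. (F (pt s r) - (\<Sum>j<2. nderiv j F (pt s 0) / fact j * r ^ j)) + nderiv 1 F (pt s 0) * (r - sin r))"
    by (intro vanish_add taylor_vanish assms vanish_times[OF vanish_nderiv[OF assms]] vanish_weaken[OF vanish_sin_3]) simp
  then show ?thesis
    by (rule vanish_cong) (simp add: nderiv_def eval_nat_numeral algebra_simps)
qed

text \<open>Taylor coefficients converted to powers of \<open>sin r\<close>. Since \<open>r\<close>
  is \<open>sin r + sin r ^ 3 / 6\<close> and \<open>r ^ 2\<close> is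
  \<open>sin r ^ 2 + sin r ^ 4 / 3\<close> up to order five, the first derivative reappears in the
  cubic coefficient and the second one in the quartic.\<close>

definition sin_coef :: "(real^2 \<Rightarrow> real) \<Rightarrow> nat \<Rightarrow> real \<Rightarrow> real" where
  "sin_coef F j s = (if j = 0 then F (pt s 0) else if j = 1 then nderiv 1 F (pt s 0)
    else if j = 2 then nderiv 2 F (pt s 0) / 2 else if j = 3 then nderiv 3 F (pt s 0) / 6 + nderiv 1 F (pt s 0) / 6
    else if j = 4 then nderiv 4 F (pt s 0) / 24 + nderiv 2 F (pt s 0) / 6 else 0)"

lemma circle_smooth_sin_coef:
  assumes "periodic F" "smooth F" shows "circle_smooth (sin_coef F j)"
proof -
  have 1: "circle_smooth (\<lambda>s. nderiv i F (pt s 0) * c)" for i c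
    by (intro circle_smooth_intros circle_smooth_pt nderiv_periodic nderiv_smooth assms)
  have 0: "circle_smooth (\<lambda>s. F (pt s 0))"
    by (rule circle_smooth_pt[OF assms])
  consider "j = 0" | "j = 1" | "j = 2" | "j = 3" | "j = 4" | "j > 4" by linarith
  then show ?thesis
  proof cases
    assume "j = 0"
    then have "sin_coef F j = (\<lambda>s. F (pt s 0))" by (simp add: sin_coef_def fun_eq_iff)
    then show ?thesis using 0 by (simp only:)
  next
    assume "j = 1"
    then have "sin_coef F j = (\<lambda>s. nderiv 1 F (pt s 0) * 1)" by (simp add: sin_coef_def fun_eq_iff)
    then show ?thesis using 1 by (simp only:)
  next
    assume "j = 2"
    then have "sin_coef F j = (\<lambda>s. nderiv 2 F (pt s 0) * (1 / 2))" by (simp add: sin_coef_def fun_eq_iff)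
    then show ?thesis using 1 by (simp only:)
  next
    assume "j = 3"
    then have "sin_coef F j = (\<lambda>s. nderiv 3 F (pt s 0) * (1 / 6) + nderiv 1 F (pt s 0) * (1 / 6))"
      by (simp add: sin_coef_def fun_eq_iff)
    then show ?thesis using circle_smooth_add[OF 1 1] by (simp only:)
  next
    assume "j = 4"
    then have "sin_coef F j = (\<lambda>s. nderiv 4 F (pt s 0) * (1 / 24) + nderiv 2 F (pt s 0) * (1 / 6))"
      by (simp add: sin_coef_def fun_eq_iff)
    then show ?thesis using circle_smooth_add[OF 1 1] by (simp only:)
  next
    assume "j > 4"
    then have "sin_coef F j = (\<lambda>s. 0)" by (simp add: sin_coef_def fun_eq_iff)
    then show ?thesis using circle_smooth_const by (simp only:)
  qed
qed

lemma taylor_vanish_5: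
  assumes "periodic F" "smooth F"
  shows "vanish 5 (\<lambda>k s r. F (pt s r) - (sin_coef F 0 s + sin_coef F 1 s * sin r + sin_coef F 2 s * sin r ^ 2
    + sin_coef F 3 s * sin r ^ 3 + sin_coef F 4 s * sin r ^ 4))"
proof -
  note D = vanish_nderiv[OF assms]
  have "vanish 5 (\<lambda>k s r. (F (pt s r) - (\<Sum>j<5. nderiv j F (pt s 0) / fact j * r ^ j))
    + nderiv 1 F (pt s 0) * (r - sin r - sin r ^ 3 / 6)
    + 1 / 2 * (nderiv 2 F (pt s 0) * (r ^ 2 - sin r ^ 2 - sin r ^ 4 / 3))
    + 1 / 6 * (nderiv 3 F (pt s 0) * (r ^ 3 - sin r ^ 3))
    + 1 / 24 * (nderiv 4 F (pt s 0) * (r ^ 4 - sin r ^ 4)))"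
    by (intro vanish_add taylor_vanish assms vanish_times[OF vanish_const] vanish_times[OF D]
        vanish_sin_5 vanish_sin_sq vanish_sin_cube vanish_sin_fourth)
  then show ?thesis
    by (rule vanish_cong) (simp add: sin_coef_def nderiv_def lessThan_nat_numeral lessThan_Suc fact_numeral field_simps)
qed

end

subsection \<open>Quasimodes on the torus\<close>

lemma set_integral_cell_const:
  assumes "S \<in> sets lebesgue"
  shows "(LINT z:torus_cell \<inter> S|lebesgue. b) = b * measure lebesgue (torus_cell \<inter> S)"
    "set_integrable lebesgue (torus_cell \<inter> S) (\<lambda>z. b::real)"
proof -
  have fin: "emeasure lebesgue (torus_cell \<inter> S) < \<infinity>"
    using torus_cell_finite emeasure_mono[of "torus_cell \<inter> S" torus_cell lebesgue] by (auto intro: le_less_trans)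
  then show "(LINT z:torus_cell \<inter> S|lebesgue. b) = b * measure lebesgue (torus_cell \<inter> S)"
    "set_integrable lebesgue (torus_cell \<inter> S) (\<lambda>z. b::real)"
    using assms by (simp_all add: set_lebesgue_integral_def set_integrable_def)
qed

lemma L2_local_bound:
  assumes u: "u \<in> L2_torus" and S: "S \<in> sets lebesgue" and b: "\<And>z. z \<in> S \<Longrightarrow> norm (u z) \<le> b"
  shows "(LINT z:torus_cell \<inter> S|lebesgue. (norm (u z))^2) \<le> b^2 * measure lebesgue torus_cell"
proof -
  have "(LINT z:torus_cell \<inter> S|lebesgue. (norm (u z))^2) \<le> (LINT z:torus_cell \<inter> S|lebesgue. b^2)"
    using b by (intro set_integral_mono set_integrable_subset_cell[OF L2_torusD(3)[OF u] S] set_integral_cell_const S)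
      (auto intro: power_mono)
  also have "\<dots> = b^2 * measure lebesgue (torus_cell \<inter> S)"
    by (rule set_integral_cell_const[OF S])
  also have "\<dots> \<le> b^2 * measure lebesgue torus_cell"
  proof (rule mult_left_mono)
    show "measure lebesgue (torus_cell \<inter> S) \<le> measure lebesgue torus_cell"
      using torus_cell_finite S by (intro measure_mono_fmeasurable) (auto simp: fmeasurable_def)
  qed simp
  finally show ?thesis .
qed

lemma L2_norm_sq_le:
  assumes u: "u \<in> L2_torus" and w: "w \<in> L2_torus" and "\<And>z. norm (w z) \<le> a * norm (u z) + b"
  shows "(L2_norm w)^2 \<le> 2 * a^2 * (L2_norm u)^2 + 2 * b^2 * measure lebesgue torus_cell"
proof -
  note iu = L2_torusD(3)[OF u] and iw = L2_torusD(3)[OF w]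
  note ib = set_integral_cell_const[of UNIV, simplified]
  have "(L2_norm w)^2 \<le> (LINT z:torus_cell|lebesgue. 2 * a^2 * (norm (u z))^2 + 2 * b^2)"
    unfolding L2_norm_sq
  proof (rule set_integral_mono[OF iw])
    show "set_integrable lebesgue torus_cell (\<lambda>z. 2 * a^2 * (norm (u z))^2 + 2 * b^2)"
      by (intro set_integral_add set_integrable_mult_right iu ib)
    show "(norm (w z))^2 \<le> 2 * a^2 * (norm (u z))^2 + 2 * b^2" for z
    proof -
      have "(norm (w z))^2 \<le> (a * norm (u z) + b)^2"
        using assms(3)[of z] by (intro power_mono) auto
      also have "\<dots> \<le> 2 * (a * norm (u z))^2 + 2 * b^2"
        using zero_le_power2[of "a * norm (u z) - b"] by (simp add: power2_eq_square algebra_simps)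
      finally show ?thesis by (simp add: power_mult_distrib)
    qed
  qed
  also have "\<dots> = 2 * a^2 * (L2_norm u)^2 + 2 * b^2 * measure lebesgue torus_cell"
    unfolding L2_norm_sq using iu ib by (subst set_integral_add) auto
  finally show ?thesis .
qed

lemma L2_norm_lower:
  assumes u: "u \<in> L2_torus" and h: "0 \<le> h" and S: "cbox z1 (z1 + vec h) \<subseteq> torus_cell"
    and b: "0 \<le> b" "\<And>z. z \<in> cbox z1 (z1 + vec h) \<Longrightarrow> b \<le> norm (u z)"
  shows "b^2 * h^2 \<le> (L2_norm u)^2"
proof -
  let ?S = "cbox z1 (z1 + vec h) :: (real^2) set"
  have SS: "?S \<in> sets lebesgue" by auto
  have "cbox z1 (z1 + vec h) \<noteq> {}" using h by (auto simp: interval_ne_empty_cart)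
  then have "measure lebesgue ?S = h^2"
    by (simp add: content_cbox_cart power2_eq_square)
  moreover have "torus_cell \<inter> ?S = ?S" using S by blast
  ultimately have "b^2 * h^2 = (LINT z:torus_cell \<inter> ?S|lebesgue. b^2)"
    using set_integral_cell_const(1)[OF SS, of "b^2"] by metis
  also have "\<dots> \<le> (LINT z:torus_cell \<inter> ?S|lebesgue. (norm (u z))^2)"
    using b by (intro set_integral_mono set_integrable_subset_cell[OF L2_torusD(3)[OF u] SS] set_integral_cell_const SS)
      (auto intro: power_mono)
  also have "\<dots> \<le> (L2_norm u)^2" by (rule L2_local_mono[OF u SS])
  finally show ?thesis .
qed

text \<open>The cell contains its lower edges and is open at the upper ones, so a small square that
  extends upwards from any of its points remains inside.\<close>

lemma cell_square:
  assumes "z \<in> torus_cell"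
  obtains h0 where "h0 > 0" "\<And>h. 0 \<le> h \<Longrightarrow> h < h0 \<Longrightarrow> cbox z (z + vec h) \<subseteq> torus_cell"
proof
  let ?h = "min (2 * pi - z $ 1) (2 * pi - z $ 2)"
  show "?h > 0" using assms by (auto simp: torus_cell_def)
  show "cbox z (z + vec h) \<subseteq> torus_cell" if "0 \<le> h" "h < ?h" for h
  proof
    fix y assume y: "y \<in> cbox z (z + vec h)"
    then have 1: "z $ i \<le> y $ i" "y $ i \<le> z $ i + h" for i by (auto simp: mem_box_cart)
    have 2: "0 \<le> z $ i" for i using assms by (simp add: torus_cell_def)
    have 3: "z $ i + h < 2 * pi" for i using that exhaust_2[of i] by auto
    have "0 \<le> y $ i \<and> y $ i < 2 * pi" for i using 1[of i] 2[of i] 3[of i] by linarith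
    then show "y \<in> torus_cell" unfolding torus_cell_def by simp
  qed
qed

text \<open>In \<open>quasimode\<close> the primed functions are mere names with algebraic
  relations. The hypotheses added here turn them into derivatives and tie \<open>f\<close>,
  \<open>p\<close>, \<open>v\<close> to the potentials on the torus.\<close>

locale torus_quasimode =
  lattice m1 m2 n1 n2 z0 +
  quasimode \<mu> d \<sigma> c c2 c3 t0 t1 M e b \<alpha> \<alpha>' \<phi> \<phi>' \<phi>'' \<rho> \<rho>' \<rho>'' \<eta> \<eta>' \<eta>'' \<beta>0 \<beta>0' \<beta>1 v0 f fs p ps pr v
  for m1 m2 n1 n2 :: int and z0 :: "real^2"
    and \<mu> d \<sigma> c c2 c3 t0 t1 M e :: real and b :: "nat \<Rightarrow> real"
    and \<alpha> \<alpha>' \<phi> \<phi>' \<phi>'' \<rho> \<rho>' \<rho>'' :: "nat \<Rightarrow> real \<Rightarrow> real"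
    and \<eta> \<eta>' \<eta>'' \<beta>0 \<beta>0' \<beta>1 v0 :: "real \<Rightarrow> real"
    and f fs p ps pr v :: "real \<Rightarrow> real \<Rightarrow> real" +
  fixes A :: "real^2 \<Rightarrow> real^2" and V :: "real^2 \<Rightarrow> real" and \<delta> :: real
  assumes A: "torus_smooth A" and V: "torus_smooth V"
    and \<mu>: "\<mu> = m \<bullet> m" and d: "d = m \<bullet> n"
    and f_eq: "f = (\<lambda>s r. A (pt s r) \<bullet> m)" and fs_eq: "fs = (\<lambda>s r. dderiv (\<lambda>z. A z \<bullet> m) m (pt s r))"
    and p_eq: "p = (\<lambda>s r. A (pt s r) \<bullet> mp)" and ps_eq: "ps = (\<lambda>s r. dderiv (\<lambda>z. A z \<bullet> mp) m (pt s r))"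
    and pr_eq: "pr = (\<lambda>s r. dderiv (\<lambda>z. A z \<bullet> mp) n (pt s r))" and v_eq: "v = (\<lambda>s r. V (pt s r))"
    and d\<phi>: "\<And>j s. (\<phi> j has_real_derivative \<phi>' j s) (at s)" "\<And>j s. (\<phi>' j has_real_derivative \<phi>'' j s) (at s)"
    and d\<rho>: "\<And>j s. (\<rho> j has_real_derivative \<rho>' j s) (at s)" "\<And>j s. (\<rho>' j has_real_derivative \<rho>'' j s) (at s)"
    and d\<eta>: "\<And>s. (\<eta> has_real_derivative \<eta>' s) (at s)" "\<And>s. (\<eta>' has_real_derivative \<eta>'' s) (at s)"
    and circle: "\<And>j. circle_smooth (\<phi> j)" "\<And>j. circle_smooth (\<rho> j)" "circle_smooth \<eta>"
    and \<delta>: "\<delta> > 0" "\<And>r. \<bar>r\<bar> \<le> pi \<Longrightarrow>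
      \<delta> * r^2 \<le> c * sin r ^ 2 / 2 + c2 * sin r ^ 3 / 3 + c3 * sin r ^ 4 / 4 + M * (1 - cos r) ^ 3"
begin

section \<open>Partial derivatives of the ansatz in adapted coordinates\<close>

lemma sin_power_deriv: "((\<lambda>r. a * sin r ^ j) has_real_derivative a * (real j * sin r ^ (j - 1) * cos r)) (at r)"
  by (auto intro!: derivative_eq_intros)

lemmas partials_sin = partials_prod[OF _ sin_power_deriv[of 1, simplified]]

lemma sin_power_cos_deriv: "((\<lambda>r. sin r ^ j * cos r) has_real_derivative
    (real j * sin r ^ (j - 1) * cos r ^ 2 - sin r ^ Suc j)) (at r)"
  by (auto intro!: derivative_eq_intros simp: power2_eq_square)

lemma partials_ph: "partials ph ph_s ph_r"
  by (rule partials_cong[OF partials_add[OF partials_add[OF partials_add[OF partials_add[OF partials_fst[OF d\<phi>(1)[of 0]]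
    partials_sin[OF d\<phi>(1)[of 1], of 1]] partials_sin[OF d\<phi>(1)[of 2], of 2]] partials_sin[OF d\<phi>(1)[of 3], of 3]] partials_sin[OF d\<phi>(1)[of 4], of 4]]])
    (simp_all add: ph_def ph_s_def ph_r_def algebra_simps)

lemma partials_ph_s: "partials ph_s ph_ss ph_sr"
  by (rule partials_cong[OF partials_add[OF partials_add[OF partials_add[OF partials_add[OF partials_fst[OF d\<phi>(2)[of 0]]
    partials_sin[OF d\<phi>(2)[of 1], of 1]] partials_sin[OF d\<phi>(2)[of 2], of 2]] partials_sin[OF d\<phi>(2)[of 3], of 3]] partials_sin[OF d\<phi>(2)[of 4], of 4]]])
    (simp_all add: ph_s_def ph_ss_def ph_sr_def algebra_simps)

lemma partials_ph_r: "partials ph_r ph_sr ph_rr"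
  by (rule partials_cong[OF partials_add[OF partials_add[OF partials_add[OF partials_prod[OF d\<phi>(1)[of 1] sin_power_cos_deriv[of 0]]
    partials_cmult[OF partials_prod[OF d\<phi>(1)[of 2] sin_power_cos_deriv[of 1]], of 2]]
    partials_cmult[OF partials_prod[OF d\<phi>(1)[of 3] sin_power_cos_deriv[of 2]], of 3]]
    partials_cmult[OF partials_prod[OF d\<phi>(1)[of 4] sin_power_cos_deriv[of 3]], of 4]]])
    (simp_all add: ph_r_def ph_sr_def ph_rr_def power2_eq_square power3_eq_cube eval_nat_numeral algebra_simps)

lemma partials_X: "partials (X k) (X_s k) (X_r k)"
proof -
  have 1: "((\<lambda>r. - (k * \<Phi> r + t0 * sin r + t1 * sin r ^ 2 / 2)) has_real_derivative - (k * \<Phi>' r + \<tau> r)) (at r)" for r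
    unfolding \<Phi>_def \<Phi>'_def \<tau>_def Q_def
    by (auto intro!: derivative_eq_intros simp: power2_eq_square power3_eq_cube field_simps)
  show ?thesis
    by (rule partials_cong[OF partials_add[OF partials_add[OF partials_snd[OF 1]
      partials_cmult[OF partials_add[OF partials_sin[OF d\<rho>(1)[of 1], of 1] partials_sin[OF d\<rho>(1)[of 2], of 2]], of "\<sigma> / k"]]
      partials_cmult[OF partials_fst[OF d\<rho>(1)[of 0]], of "\<sigma> / k^2"]]])
      (simp_all add: X_def X_s_def X_r_def algebra_simps)
qed

lemma partials_X_s: "partials (X_s k) (X_ss k) (X_sr k)"
  by (rule partials_cong[OF partials_add[OF
      partials_cmult[OF partials_add[OF partials_sin[OF d\<rho>(2)[of 1], of 1] partials_sin[OF d\<rho>(2)[of 2], of 2]], of "\<sigma> / k"]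
      partials_cmult[OF partials_fst[OF d\<rho>(2)[of 0]], of "\<sigma> / k^2"]]])
      (simp_all add: X_s_def X_ss_def X_sr_def algebra_simps)

lemma partials_X_r: "partials (X_r k) (X_sr k) (X_rr k)"
proof -
  have 1: "((\<lambda>r. - (k * \<Phi>' r + \<tau> r)) has_real_derivative - (k * \<Phi>'' r + \<tau>' r)) (at r)" for r
    unfolding \<Phi>'_def \<Phi>''_def \<tau>_def \<tau>'_def Q_def
    by (auto intro!: derivative_eq_intros simp: power2_eq_square power3_eq_cube algebra_simps)
  show ?thesis
    by (rule partials_cong[OF partials_add[OF partials_snd[OF 1]
      partials_cmult[OF partials_add[OF partials_prod[OF d\<rho>(1)[of 1] sin_power_cos_deriv[of 0]]
         partials_cmult[OF partials_prod[OF d\<rho>(1)[of 2] sin_power_cos_deriv[of 1]], of 2]], of "\<sigma> / k"]]])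
      (simp_all add: X_r_def X_sr_def X_rr_def power2_eq_square algebra_simps)
qed

text \<open>
  The parameter \<open>k\<close> is used with \<open>k^2 = N \<mu>\<close> only; then the linear part is \<open>\<sigma> N (m \<bullet> (z - z0))\<close>, which is
  periodic modulo \<open>2 \<pi>\<close>.
\<close>

definition phase_fn :: "real \<Rightarrow> real \<Rightarrow> real \<Rightarrow> real" where
  "phase_fn k s r = \<sigma> * k^2 * s + \<sigma> * k^2 / \<mu> * d * r + ph s r + \<sigma> / k^2 * \<eta> s"

lemma \<mu>_ge: "\<mu> \<ge> 1"
  using norm_m \<mu> by simp

lemma partials_phase_fn: "partials (phase_fn k) (\<lambda>s r. \<sigma> * k^2 + ph_s s r + \<sigma> / k^2 * \<eta>' s) (\<lambda>s r. \<sigma> * k^2 / \<mu> * d + ph_r s r)"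
proof -
  have 1: "((\<lambda>s. \<sigma> * k^2 * s) has_real_derivative \<sigma> * k^2) (at s)"
    and 2: "((\<lambda>r. \<sigma> * k^2 / \<mu> * d * r) has_real_derivative \<sigma> * k^2 / \<mu> * d) (at s)" for s
    using \<mu>_ge by (auto intro!: derivative_eq_intros)
  show ?thesis
    by (rule partials_cong[OF partials_add[OF partials_add[OF partials_add[OF partials_fst[OF 1] partials_snd[OF 2]] partials_ph]
        partials_cmult[OF partials_fst[OF d\<eta>(1)], of "\<sigma> / k^2"]]])
      (simp_all add: phase_fn_def algebra_simps)
qed

lemma partials_phase_fn_s: "partials (\<lambda>s r. \<sigma> * k^2 + ph_s s r + \<sigma> / k^2 * \<eta>' s) (\<lambda>s r. ph_ss s r + \<sigma> / k^2 * \<eta>'' s) ph_sr"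
  by (rule partials_cong[OF partials_add[OF partials_add[OF partials_fst[OF DERIV_const] partials_ph_s]
        partials_cmult[OF partials_fst[OF d\<eta>(2)], of "\<sigma> / k^2"]]]) simp_all

lemma partials_phase_fn_r: "partials (\<lambda>s r. \<sigma> * k^2 / \<mu> * d + ph_r s r) ph_sr ph_rr"
  by (rule partials_cong[OF partials_add[OF partials_fst[OF DERIV_const] partials_ph_r]]) simp_all

definition mode :: "real \<Rightarrow> real^2 \<Rightarrow> complex" where
  "mode k z = exp (of_real (X k (sc z) (rc z)) + \<i> * of_real (phase_fn k (sc z) (rc z)))"

lemma smooth_circle_sc: "circle_smooth h \<Longrightarrow> smooth (\<lambda>z. h (sc z))"
  by (rule smooth_coords) (simp add: circle_smooth_def)

lemma smooth_sin_rc: "smooth (\<lambda>z. sin (rc z))" "smooth (\<lambda>z. cos (rc z))"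
  by (rule smooth_coords, rule smooth_sin_cos)+

lemma smooth_X: "smooth (\<lambda>z. X k (sc z) (rc z))"
  unfolding X_def \<Phi>_def divide_inverse
  by (intro smooth_intros smooth_circle_sc circle smooth_sin_rc)

lemma smooth_phase_fn: "smooth (\<lambda>z. phase_fn k (sc z) (rc z))"
proof -
  have "smooth (\<lambda>x::real. x)"
    by (rule smooth_real_deriv[OF DERIV_ident smooth_const])
  then have "smooth sc" "smooth rc"
    using smooth_coords[of "\<lambda>x. x"] by simp_all
  then show ?thesis
    unfolding phase_fn_def ph_def
    by (intro smooth_intros circle[THEN smooth_circle_sc] smooth_sin_rc)
qed

text \<open>The slope of the linear phase in \<open>r\<close> is such that its derivative along
  \<open>mp\<close> vanishes, so the large frequency occurs only in the momentum along
  \<open>m\<close>.\<close>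

lemma schroedinger_mode:
  "of_real \<mu> * schroedinger_expr A V (mode k) z =
    mode k z * (of_real (P_re k (sc z) (rc z)) - \<i> * of_real (P_im k (sc z) (rc z)))"
proof -
  interpret P: phase A V "\<lambda>z. X k (sc z) (rc z)" "\<lambda>z. phase_fn k (sc z) (rc z)"
    by unfold_locales (auto intro: smooth_X smooth_phase_fn torus_smoothD A)
  have mode: "mode k = P.u" by (auto simp: mode_def P.u_def fun_eq_iff)
  let ?s = "sc z" and ?r = "rc z"
  have A_mp: "dderiv (\<lambda>z. A z \<bullet> mp) mp z = \<mu> * pr ?s ?r - d * ps ?s ?r"
  proof -
    have "dderiv (\<lambda>z. A z \<bullet> mp) mp z = dderiv (\<lambda>z. A z \<bullet> mp) ((m \<bullet> m) *\<^sub>R n + (- (m \<bullet> n)) *\<^sub>R m) z"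
      by (subst (2) mp_decomp) simp
    also have "\<dots> = (m \<bullet> m) * dderiv (\<lambda>z. A z \<bullet> mp) n z + (- (m \<bullet> n)) * dderiv (\<lambda>z. A z \<bullet> mp) m z"
      by (simp only: dderiv_add[OF P.smooth_A_inner] dderiv_scale[OF P.smooth_A_inner] real_scaleR_def)
    finally show ?thesis by (simp add: pr_eq ps_eq \<mu> d)
  qed
  have qm: "P.q m z = of_real (\<sigma> * k^2 + ph_s ?s ?r + \<sigma> / k^2 * \<eta>' ?s - f ?s ?r) - \<i> * of_real (X_s k ?s ?r)"
    unfolding P.q_def partials_dderiv_m(1)[OF partials_X] partials_dderiv_m(1)[OF partials_phase_fn] by (simp add: f_eq)
  have qp: "P.q mp z = of_real (\<mu> * ph_r ?s ?r - d * (ph_s ?s ?r + \<sigma> / k^2 * \<eta>' ?s) - p ?s ?r)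
      - \<i> * of_real (\<mu> * X_r k ?s ?r - d * X_s k ?s ?r)"
    unfolding P.q_def partials_dderiv_m(2)[OF partials_X] partials_dderiv_m(2)[OF partials_phase_fn] \<mu>[symmetric] d[symmetric]
    using \<mu>_ge by (simp add: p_eq algebra_simps)
  have q'm: "P.q' m z = of_real (ph_ss ?s ?r + \<sigma> / k^2 * \<eta>'' ?s - fs ?s ?r) - \<i> * of_real (X_ss k ?s ?r)"
    unfolding P.q'_def partials_dderiv_dderiv(1)[OF partials_X partials_X_s partials_X_r] partials_dderiv_dderiv(1)[OF partials_phase_fn partials_phase_fn_s partials_phase_fn_r]
    by (simp add: fs_eq)
  have q'p: "P.q' mp z = of_real (\<mu>^2 * ph_rr ?s ?r - 2 * \<mu> * d * ph_sr ?s ?r + d^2 * (ph_ss ?s ?r + \<sigma> / k^2 * \<eta>'' ?s)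
      - (\<mu> * pr ?s ?r - d * ps ?s ?r))
      - \<i> * of_real (\<mu>^2 * X_rr k ?s ?r - 2 * \<mu> * d * X_sr k ?s ?r + d^2 * X_ss k ?s ?r)"
    unfolding P.q'_def partials_dderiv_dderiv(2)[OF partials_X partials_X_s partials_X_r] partials_dderiv_dderiv(2)[OF partials_phase_fn partials_phase_fn_s partials_phase_fn_r]
      A_mp \<mu>[symmetric] d[symmetric] by simp
  have Vz: "V z = v ?s ?r" by (simp add: v_eq)
  have alg: "(of_real a1 - \<i> * of_real x1)^2 + (of_real a2 - \<i> * of_real x2)^2
      - \<i> * ((of_real g1 - \<i> * of_real y1) + (of_real g2 - \<i> * of_real y2)) + of_real w
    = of_real (a1^2 + a2^2 - x1^2 - x2^2 - y1 - y2 + w)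
      - \<i> * of_real (2 * (a1 * x1 + a2 * x2) + g1 + g2)" for a1 a2 x1 x2 g1 g2 y1 y2 w :: real
    by (simp add: complex_eq_iff power2_eq_square)
  have "of_real (m \<bullet> m) * schroedinger_expr A V P.u z =
    P.u z * ((P.q m z)^2 + (P.q mp z)^2 - \<i> * (P.q' m z + P.q' mp z) + of_real ((m \<bullet> m) * V z))"
    by (rule P.schroedinger_u[OF mp_eq])
  then have 1: "of_real \<mu> * schroedinger_expr A V P.u z =
    P.u z * (((P.q m z)^2 + (P.q mp z)^2 - \<i> * (P.q' m z + P.q' mp z)) + of_real (\<mu> * v ?s ?r))"
    unfolding \<mu>[symmetric] Vz .
  show ?thesis
    unfolding mode 1 unfolding qm qp q'm q'p alg P_re_def P_im_def add.assoc ..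
qed

lemma norm_mode: "norm (mode k z) = exp (X k (sc z) (rc z))"
  by (simp add: mode_def norm_exp_eq_Re)

end

section \<open>Smooth functions as elements of the graph of the operator\<close>

lemma torus_smooth_magnetic:
  assumes A: "torus_smooth A" and u: "torus_smooth u"
  shows "torus_smooth (magnetic_deriv A j u)"
proof (rule torus_smoothI)
  have eq: "magnetic_deriv A j u = (\<lambda>z. (1 / \<i>) * dderiv u (axis j 1) z - of_real (A z $ j) * u z)"
    by (simp add: magnetic_deriv_def dderiv_def fun_eq_iff)
  note As = torus_smoothD[OF A] and us = torus_smoothD[OF u]
  have Aj: "smooth (\<lambda>z. of_real (A z $ j) :: complex)"
    by (intro smooth_linear[OF bounded_linear_of_real] smooth_linear[OF bounded_linear_vec_nth] As)
  show "smooth (magnetic_deriv A j u)"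
    unfolding eq by (intro smooth_diff smooth_mult smooth_const smooth_dderiv us Aj)
  show "periodic (magnetic_deriv A j u)"
    unfolding eq using As(1) us(1) periodic_dderiv[OF us] unfolding periodic_def by simp
qed

lemma torus_smooth_schroedinger:
  assumes A: "torus_smooth A" and V: "torus_smooth V" and u: "torus_smooth u"
  shows "torus_smooth (schroedinger_expr A V u)"
proof (rule torus_smoothI)
  have eq: "schroedinger_expr A V u = (\<lambda>z. magnetic_deriv A 1 (magnetic_deriv A 1 u) z
      + magnetic_deriv A 2 (magnetic_deriv A 2 u) z + of_real (V z) * u z)"
    by (simp add: schroedinger_expr_def sum_2 fun_eq_iff)
  note t = torus_smooth_magnetic[OF A torus_smooth_magnetic[OF A u]]
  note Vs = torus_smoothD[OF V] and us = torus_smoothD[OF u]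
  have Vj: "smooth (\<lambda>z. of_real (V z) :: complex)"
    by (intro smooth_linear[OF bounded_linear_of_real] Vs)
  show "smooth (schroedinger_expr A V u)"
    unfolding eq by (intro smooth_add smooth_mult us Vj torus_smoothD(2)[OF t])
  show "periodic (schroedinger_expr A V u)"
    unfolding eq using Vs(1) us(1) torus_smoothD(1)[OF t] unfolding periodic_def by simp
qed

lemma smooth_schroedinger_graph:
  assumes A: "torus_smooth A" and V: "torus_smooth V" and u: "torus_smooth u"
  shows "(u, schroedinger_expr A V u) \<in> schroedinger_graph A V"
  unfolding schroedinger_graph_def
  using torus_smooth_L2[OF u] torus_smooth_L2[OF torus_smooth_schroedinger[OF assms]] u
  by (auto simp: L2_norm_def intro!: exI[of _ "\<lambda>n. u"])

context torus_quasimode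
begin

lemma periodic_mode:
  assumes k: "k^2 = real N * \<mu>"
  shows "periodic (mode k)"
proof -
  have \<sigma>i: "\<exists>i::int. \<sigma> = of_int i"
  proof -
    have "\<sigma> = 1 \<or> \<sigma> = - 1" using \<sigma> by (simp add: power2_eq_1_iff)
    then show ?thesis by (auto intro: exI[of _ 1] exI[of _ "- 1"])
  qed
  then obtain si :: int where si: "\<sigma> = of_int si" by blast
  define a where "a = si * int N * (m1 * m1 + m2 * m2)"
  define a' where "a' = si * int N * (m1 * n1 + m2 * n2)"
  have a: "\<sigma> * k^2 = of_int a"
    unfolding k \<mu> a_def si by (simp add: inner_vec_def sum_2)
  have a': "\<sigma> * k^2 / \<mu> * d = of_int a'"
    using \<mu>_ge unfolding k d a'_def si by (simp add: inner_vec_def sum_2)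
  have per: "\<phi> j (s + 2 * pi) = \<phi> j s" "\<rho> j (s + 2 * pi) = \<rho> j s" "\<eta> (s + 2 * pi) = \<eta> s" for j s
    using circle by (auto simp: circle_smooth_def)
  have X1: "X k (s + 2 * pi) r = X k s r" "X k s (r + 2 * pi) = X k s r" for s r
    by (simp_all add: X_def \<Phi>_def per)
  have ph: "ph (s + 2 * pi) r = ph s r" "ph s (r + 2 * pi) = ph s r" for s r
    by (simp_all add: ph_def per)
  have Y1: "phase_fn k (s + 2 * pi) r = phase_fn k s r + 2 * of_int a * pi" for s r
    unfolding phase_fn_def a' unfolding a ph per by (simp add: algebra_simps)
  have Y2: "phase_fn k s (r + 2 * pi) = phase_fn k s r + 2 * of_int a' * pi" for s r
    unfolding phase_fn_def a' unfolding a ph per by (simp add: algebra_simps)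
  have e: "exp (of_real x + \<i> * of_real (y + 2 * of_int i * pi)) = exp (of_real x + \<i> * of_real y)" for x y :: real and i :: int
    using exp_plus_2pin[of "of_real x + \<i> * of_real y" i] by (simp add: algebra_simps)
  have "periodic (\<lambda>z. (\<lambda>s r. exp (of_real (X k s r) + \<i> * of_real (phase_fn k s r)) :: complex) (sc z) (rc z))"
    by (rule periodic_coords) (simp_all only: X1 Y1 Y2 e)
  then show ?thesis unfolding mode_def[abs_def] .
qed

lemma torus_smooth_mode:
  assumes k: "k^2 = real N * \<mu>"
  shows "torus_smooth (mode k)"
proof (rule torus_smoothI[OF periodic_mode[OF k]])
  show "smooth (mode k)"
    unfolding mode_def[abs_def]
    by (intro smooth_intros smooth_linear[OF bounded_linear_of_real] smooth_X smooth_phase_fn)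
qed

section \<open>Size of the residual and distribution of the mass\<close>

lemma period_rep:
  obtains i :: int where "\<bar>rc z + 2 * pi * of_int i\<bar> \<le> pi"
proof -
  obtain i :: int where "0 \<le> (rc z + pi) + 2 * pi * of_int i" "(rc z + pi) + 2 * pi * of_int i < 2 * pi"
    by (rule real_period_rep[of "2 * pi" "rc z + pi"]) auto
  then show ?thesis by (intro that[of i]) linarith
qed

text \<open>
  The exponent \<open>9/20\<close> lies above \<open>2/5\<close>, so that \<open>k^2 r^5\<close> tends to \<open>0\<close>, and below \<open>1/2\<close>, so that \<open>k r^2\<close>
  tends to infinity at the boundary of the region.
\<close>

lemma weight_small:
  assumes k: "k \<ge> 1" and r: "\<bar>r\<bar> \<le> k powr (-9/20)"
  shows "weight k r \<le> 4 * k powr (-1/4)"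
proof -
  let ?a = "k powr (-9/20)"
  have pw: "?a ^ j = k powr (real j * (-9/20))" for j
    using k by (simp add: powr_realpow[symmetric] powr_powr mult.commute)
  have "1 / k \<le> k powr (-1/4)"
  proof -
    have "1 / k = k powr (-1)" using k by (simp add: powr_minus_divide)
    also have "\<dots> \<le> k powr (-1/4)" using k by (intro powr_mono) auto
    finally show ?thesis .
  qed
  moreover have "\<bar>r\<bar> \<le> k powr (-1/4)"
    using r powr_mono[of "-9/20" "-1/4" k] k by linarith
  moreover have "k * \<bar>r\<bar> ^ 3 \<le> k powr (-1/4)"
  proof -
    have "k * \<bar>r\<bar> ^ 3 \<le> k powr 1 * ?a ^ 3" using k r by (auto intro!: mult_mono power_mono)
    also have "\<dots> = k powr (1 + 3 * (-9/20))" using k unfolding pw powr_add by simp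
    also have "\<dots> \<le> k powr (-1/4)" using k by (intro powr_mono) auto
    finally show ?thesis .
  qed
  moreover have "k^2 * \<bar>r\<bar> ^ 5 \<le> k powr (-1/4)"
  proof -
    have "k^2 * \<bar>r\<bar> ^ 5 \<le> k powr 2 * ?a ^ 5"
      using k r by (auto intro!: mult_mono power_mono simp: powr_numeral)
    also have "\<dots> = k powr (2 + 5 * (-9/20))" using k unfolding pw powr_add by simp
    also have "\<dots> \<le> k powr (-1/4)" using k by (intro powr_mono) auto
    finally show ?thesis .
  qed
  ultimately show ?thesis unfolding weight_def by linarith
qed

lemma weight_large:
  assumes k: "k \<ge> 1" and r: "\<bar>r\<bar> \<le> pi"
  shows "weight k r \<le> (1 + pi + pi ^ 3 + pi ^ 5) * k^2"
proof -
  have k2: "1 \<le> k^2" "k \<le> k^2"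
    using k self_le_power[of k 2] by (auto intro: one_le_power)
  have "1 / k \<le> 1" using k by simp
  then have "1 / k \<le> 1 * k^2" using k2 by linarith
  moreover have "\<bar>r\<bar> \<le> pi * k^2"
    using mult_mono[OF r k2(1)] by simp
  moreover have "k * \<bar>r\<bar> ^ 3 \<le> k^2 * pi ^ 3"
    using k k2 r by (intro mult_mono power_mono) auto
  moreover have "k^2 * \<bar>r\<bar> ^ 5 \<le> k^2 * pi ^ 5"
    using r by (intro mult_left_mono power_mono) auto
  ultimately show ?thesis unfolding weight_def by (simp add: algebra_simps)
qed

lemma \<Phi>_growth: "\<bar>r\<bar> \<le> pi \<Longrightarrow> \<delta> * r^2 \<le> \<Phi> r"
  unfolding \<Phi>_def by (rule \<delta>(2))

definition defect :: "real \<Rightarrow> real^2 \<Rightarrow> complex" where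
  "defect k z = schroedinger_expr A V (mode k) z - of_real (E k / \<mu>) * mode k z"

text \<open>For \<open>\<bar>r\<bar> \<le> k powr (-9/20)\<close> the remainders are small relative
  to the mode. Farther out they can reach size \<open>k^2\<close>, but there \<open>k * r^2\<close>
  exceeds \<open>k powr (1/10)\<close> and the mode itself is exponentially small, which gives the
  additive term.\<close>

lemma pointwise_error:
  obtains C where "\<And>k N z. k \<ge> 1 \<Longrightarrow> k^2 = real N * \<mu> \<Longrightarrow>
    norm (defect k z)
      \<le> C * k powr (-1/4) * norm (mode k z) + C * (k^2 * exp (- (\<delta> * k powr (1/10))))"
proof -
  obtain C1 where C1: "\<And>k s r. k \<ge> 1 \<Longrightarrow> \<bar>r\<bar> \<le> pi \<Longrightarrow> \<bar>P_re k s r - E k\<bar> \<le> C1 * weight k r"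
    by (rule P_re_bound) (rule that)
  obtain C2 where C2: "\<And>k s r. k \<ge> 1 \<Longrightarrow> \<bar>r\<bar> \<le> pi \<Longrightarrow> \<bar>P_im k s r\<bar> \<le> C2 * weight k r"
    by (rule P_im_bound) (rule that)
  obtain C3 where C3: "\<And>k s r. k \<ge> 1 \<Longrightarrow> \<bar>r\<bar> \<le> pi \<Longrightarrow> X k s r \<le> C3 - k * \<delta> * r^2"
    by (rule X_upper, erule \<Phi>_growth) (rule that)
  define D where "D = \<bar>C1\<bar> + \<bar>C2\<bar>"
  define C where "C = max (D * 4) (D * (1 + pi + pi ^ 3 + pi ^ 5) * exp C3)"
  have D0: "D \<ge> 0" by (simp add: D_def)
  have C0: "C \<ge> 0" using D0 by (simp add: C_def)
  have near: "norm (defect k z)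
      \<le> C * k powr (-1/4) * norm (mode k z) + C * (k^2 * exp (- (\<delta> * k powr (1/10))))"
    if k: "k \<ge> 1" and r: "\<bar>rc z\<bar> \<le> pi" for k z
  proof -
    let ?s = "sc z" and ?r = "rc z"
    have w0: "weight k ?r \<ge> 0" using k by (simp add: weight_def)
    have mu: "\<mu> > 0" using \<mu>_ge by simp
    have "of_real \<mu> * defect k z
        = mode k z * (of_real (P_re k ?s ?r - E k) - \<i> * of_real (P_im k ?s ?r))"
      using schroedinger_mode[of k z] mu by (simp add: defect_def algebra_simps)
    from arg_cong[OF this, of norm]
    have "\<mu> * norm (defect k z)
        = norm (mode k z) * norm (of_real (P_re k ?s ?r - E k) - \<i> * of_real (P_im k ?s ?r))"
      using mu by (simp only: norm_mult norm_of_real abs_of_pos)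
    also have "\<dots> \<le> norm (mode k z) * (D * weight k ?r)"
    proof (rule mult_left_mono)
      have "norm (of_real (P_re k ?s ?r - E k) - \<i> * of_real (P_im k ?s ?r) :: complex)
          \<le> norm (of_real (P_re k ?s ?r - E k) :: complex) + norm (\<i> * of_real (P_im k ?s ?r))"
        by (rule norm_triangle_ineq4)
      also have "\<dots> = \<bar>P_re k ?s ?r - E k\<bar> + \<bar>P_im k ?s ?r\<bar>"
        by (simp only: norm_mult norm_of_real norm_ii mult_1)
      also have "\<dots> \<le> C1 * weight k ?r + C2 * weight k ?r" by (intro add_mono C1 C2 k r)
      also have "\<dots> \<le> \<bar>C1\<bar> * weight k ?r + \<bar>C2\<bar> * weight k ?r"
        using w0 by (intro add_mono mult_right_mono) auto
      finally show "norm (of_real (P_re k ?s ?r - E k) - \<i> * of_real (P_im k ?s ?r) :: complex) \<le> D * weight k ?r"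
        by (simp add: D_def algebra_simps)
    qed simp
    finally have "1 * norm (defect k z) \<le> norm (mode k z) * (D * weight k ?r)"
      by (rule order_trans[OF mult_right_mono[OF \<mu>_ge norm_ge_zero]])
    also have "\<dots> \<le> C * k powr (-1/4) * norm (mode k z) + C * (k^2 * exp (- (\<delta> * k powr (1/10))))"
    proof (cases "\<bar>?r\<bar> \<le> k powr (-9/20)")
      case True
      have "D * weight k ?r \<le> D * (4 * k powr (-1/4))"
        by (intro mult_left_mono weight_small k True D0)
      also have "\<dots> \<le> C * k powr (-1/4)"
        unfolding mult.assoc[symmetric] by (intro mult_right_mono) (auto simp: C_def)
      finally have "norm (mode k z) * (D * weight k ?r) \<le> norm (mode k z) * (C * k powr (-1/4))"
        by (intro mult_left_mono) auto
      moreover have "0 \<le> C * (k^2 * exp (- (\<delta> * k powr (1/10))))" using C0 by simp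
      ultimately show ?thesis by (simp add: algebra_simps)
    next
      case False
      have "k powr (1/10) = k * (k powr (-9/20))^2"
      proof -
        have "k * (k powr (-9/20))^2 = k powr 1 * k powr (2 * (-9/20))"
          using k by (simp add: powr_powr flip: powr_realpow)
        also have "\<dots> = k powr (1/10)" using k unfolding powr_add[symmetric] by simp
        finally show ?thesis by simp
      qed
      also have "\<dots> \<le> k * ?r^2"
        using False k power_mono[of "k powr (-9/20)" "\<bar>?r\<bar>" 2] by (intro mult_left_mono) auto
      finally have "\<delta> * k powr (1/10) \<le> \<delta> * (k * ?r^2)" using \<delta> by (intro mult_left_mono) auto
      then have "X k ?s ?r \<le> C3 + - (\<delta> * k powr (1/10))"
        using C3[OF k r, of ?s] by (simp add: mult.commute mult.left_commute)
      then have nu: "norm (mode k z) \<le> exp C3 * exp (- (\<delta> * k powr (1/10)))"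
        unfolding norm_mode exp_add[symmetric] by simp
      have dw: "D * weight k ?r \<le> D * ((1 + pi + pi ^ 3 + pi ^ 5) * k^2)"
        by (intro mult_left_mono weight_large k r D0)
      have "norm (mode k z) * (D * weight k ?r)
          \<le> (exp C3 * exp (- (\<delta> * k powr (1/10)))) * (D * ((1 + pi + pi ^ 3 + pi ^ 5) * k^2))"
        using D0 w0 by (intro mult_mono[OF nu dw]) auto
      also have "\<dots> = (D * (1 + pi + pi ^ 3 + pi ^ 5) * exp C3) * (k^2 * exp (- (\<delta> * k powr (1/10))))"
        by (simp only: ac_simps)
      also have "\<dots> \<le> C * (k^2 * exp (- (\<delta> * k powr (1/10))))"
        by (intro mult_right_mono) (auto simp: C_def)
      finally have "norm (mode k z) * (D * weight k ?r) \<le> C * (k^2 * exp (- (\<delta> * k powr (1/10))))" .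
      moreover have "0 \<le> C * k powr (-1/4) * norm (mode k z)" using C0 by simp
      ultimately show ?thesis by linarith
    qed
    finally show ?thesis by simp
  qed
  show ?thesis
  proof (rule that)
    fix k :: real and N :: nat and z
    assume k: "k \<ge> 1" "k^2 = real N * \<mu>"
    \<comment> \<open>The estimates hold within one period of \<open>r\<close>; mode and residual
      are periodic on the torus, so every point can be moved there.\<close>
    obtain i :: int where i: "\<bar>rc z + 2 * pi * of_int i\<bar> \<le> pi" by (rule period_rep)
    define z' where "z' = pt (sc z) (rc z + 2 * pi * of_int i)"
    have shift: "F z' = F z" if "periodic F" for F :: "real^2 \<Rightarrow> complex"
      using periodic_pt[OF that, of "sc z" 0 "rc z" i] by (simp add: z'_def)
    have "torus_smooth (schroedinger_expr A V (mode k))"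
      by (intro torus_smooth_schroedinger A V torus_smooth_mode[OF k(2)])
    from shift[OF torus_smoothD(1)[OF this]] shift[OF periodic_mode[OF k(2)]]
    show "norm (defect k z)
      \<le> C * k powr (-1/4) * norm (mode k z) + C * (k^2 * exp (- (\<delta> * k powr (1/10))))"
      using near[OF k(1), of z'] i by (simp add: z'_def defect_def)
  qed
qed

lemma mode_upper:
  obtains C where "\<And>k N z r1. k \<ge> 1 \<Longrightarrow> k^2 = real N * \<mu> \<Longrightarrow> r1 > 0 \<Longrightarrow>
     (\<forall>i::int. r1 \<le> \<bar>rc z + 2 * pi * of_int i\<bar>) \<Longrightarrow> norm (mode k z) \<le> exp C * exp (- (\<delta> * r1^2 * k))"
proof -
  obtain C3 where C3: "\<And>k s r. k \<ge> 1 \<Longrightarrow> \<bar>r\<bar> \<le> pi \<Longrightarrow> X k s r \<le> C3 - k * \<delta> * r^2"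
    by (rule X_upper, erule \<Phi>_growth) (rule that)
  show ?thesis
  proof (rule that)
    fix k r1 :: real and N :: nat and z
    assume k: "k \<ge> 1" "k^2 = real N * \<mu>" and r1: "r1 > 0" "\<forall>i::int. r1 \<le> \<bar>rc z + 2 * pi * of_int i\<bar>"
    obtain i :: int where i: "\<bar>rc z + 2 * pi * of_int i\<bar> \<le> pi" by (rule period_rep)
    let ?r = "rc z + 2 * pi * of_int i"
    have "mode k z = mode k (pt (sc z) ?r)"
      using periodic_pt[OF periodic_mode[OF k(2)], of "sc z" 0 "rc z" i] by simp
    then have "norm (mode k z) = exp (X k (sc z) ?r)" by (simp add: norm_mode)
    also have "X k (sc z) ?r \<le> C3 + - (\<delta> * r1^2 * k)"
    proof -
      have "r1^2 \<le> ?r^2" using power_mono[OF r1(2)[rule_format, of i], of 2] r1(1) by simp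
      then have "k * \<delta> * r1^2 \<le> k * \<delta> * ?r^2" using k \<delta> by (intro mult_left_mono) auto
      then show ?thesis using C3[OF k(1) i, of "sc z"] by (simp add: mult.commute mult.left_commute)
    qed
    finally show "norm (mode k z) \<le> exp C3 * exp (- (\<delta> * r1^2 * k))"
      by (simp add: exp_add[symmetric])
  qed
qed

text \<open>On a square of side \<open>1 / k\<close> at a lattice translate of \<open>z0\<close> the
  modulus of the mode is bounded below. The resulting loss of a power of \<open>k\<close> is
  harmless against exponentially small errors.\<close>

lemma mode_lower:
  obtains a k0 where "a > 0" "\<And>k N. k \<ge> k0 \<Longrightarrow> k \<ge> 1 \<Longrightarrow> k^2 = real N * \<mu> \<Longrightarrow> a * (1 / k)^2 \<le> (L2_norm (mode k))^2"
proof -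
  obtain C where C: "\<And>k s r. k \<ge> 1 \<Longrightarrow> \<bar>r\<bar> \<le> pi \<Longrightarrow> - C * (1 + k * r^2) \<le> X k s r"
    by (rule X_lower) (rule that)
  obtain l where z1: "z0 + period l \<in> torus_cell"
    by (rule torus_cell_rep)
  define w where "w = period l"
  obtain h0 where h0: "h0 > 0" "\<And>h. 0 \<le> h \<Longrightarrow> h < h0 \<Longrightarrow> cbox (z0 + w) (z0 + w + vec h) \<subseteq> torus_cell"
    using cell_square[OF z1[folded w_def]] by blast
  define B where "B = \<bar>real_of_int m1\<bar> + \<bar>real_of_int m2\<bar>"
  define b' where "b' = exp (- (\<bar>C\<bar> * (1 + B^2)))"
  \<comment> \<open>\<open>2 / h0\<close> makes the square of side \<open>1 / k\<close> fit into the
    cell, \<open>B / pi\<close> keeps \<open>rc\<close> within one period on it.\<close>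
  define k0 where "k0 = max (2 / h0) (B / pi)"
  show ?thesis
  proof (rule that)
    show "b'^2 > 0" by (simp add: b'_def)
    fix k :: real and N :: nat
    assume k: "k \<ge> k0" "k \<ge> 1" "k^2 = real N * \<mu>"
    define h where "h = 1 / k"
    have h: "0 \<le> h" "h < h0" "B * h \<le> pi"
    proof -
      show "0 \<le> h" using k by (simp add: h_def)
      have "2 / h0 \<le> k" "B / pi \<le> k" using k by (auto simp: k0_def)
      then have 1: "2 \<le> k * h0" "B \<le> k * pi" using h0 by (auto simp: pos_divide_le_eq)
      then have "1 < k * h0" by linarith
      then show "h < h0" using k by (simp add: h_def pos_divide_less_eq mult.commute)
      show "B * h \<le> pi" using k 1 by (simp add: h_def pos_divide_le_eq mult.commute)
    qed
    have "b'^2 * h^2 \<le> (L2_norm (mode k))^2"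
    proof (rule L2_norm_lower[OF torus_smooth_L2[OF torus_smooth_mode[OF k(3)]] h(1) h0(2)[OF h(1,2)]])
      show "0 \<le> b'" by (simp add: b'_def)
      fix z assume z: "z \<in> cbox (z0 + w) (z0 + w + vec h)"
      have zi: "0 \<le> (z - w - z0) $ i" "(z - w - z0) $ i \<le> h" for i
        using z by (auto simp: mem_box_cart algebra_simps)
      have "\<bar>rc (z - w)\<bar> \<le> \<bar>m1 * (z - w - z0) $ 2\<bar> + \<bar>m2 * (z - w - z0) $ 1\<bar>"
        unfolding rc_def rl_def by (rule abs_triangle_ineq4)
      also have "\<dots> \<le> \<bar>real_of_int m1\<bar> * h + \<bar>real_of_int m2\<bar> * h"
        unfolding abs_mult using zi by (intro add_mono mult_left_mono) auto
      finally have r: "\<bar>rc (z - w)\<bar> \<le> B * h" by (simp add: B_def algebra_simps)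
      have "k * (rc (z - w))^2 \<le> k * (B * h)^2"
        using power_mono[OF r, of 2] k by (intro mult_left_mono) auto
      also have "\<dots> = B^2 / k" using k(2) by (simp add: h_def power2_eq_square)
      also have "\<dots> \<le> B^2" using k(2) by (simp add: divide_le_eq mult_le_cancel_left1)
      finally have kr: "k * (rc (z - w))^2 \<le> B^2" .
      have "- (\<bar>C\<bar> * (1 + B^2)) \<le> - C * (1 + k * (rc (z - w))^2)"
      proof -
        have "C * (1 + k * (rc (z - w))^2) \<le> \<bar>C\<bar> * (1 + B^2)"
          using kr k by (intro mult_mono) auto
        then show ?thesis by simp
      qed
      also have "\<dots> \<le> X k (sc (z - w)) (rc (z - w))"
        using r h by (intro C k(2)) auto
      finally have "b' \<le> norm (mode k (z - w))" by (simp add: b'_def norm_mode)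
      moreover have "mode k (z - w + w) = mode k (z - w)"
        unfolding w_def by (rule periodic_shift[OF periodic_mode[OF k(3)]])
      ultimately show "b' \<le> norm (mode k z)" by simp
    qed
    then show "b'^2 * (1 / k)^2 \<le> (L2_norm (mode k))^2" by (simp add: h_def)
  qed
qed

lemma quasimodes:
  assumes \<omega>: "\<omega> \<in> sets lebesgue" and r1: "r1 > 0" "\<And>z. z \<in> \<omega> \<Longrightarrow> \<forall>i::int. r1 \<le> \<bar>rc z + 2 * pi * of_int i\<bar>"
    and eps: "\<epsilon> > 0"
  shows "localized_quasimode A V \<omega> \<epsilon>"
proof -
  obtain C where C: "\<And>k N z. k \<ge> 1 \<Longrightarrow> k^2 = real N * \<mu> \<Longrightarrow>
    norm (defect k z)
      \<le> C * k powr (-1/4) * norm (mode k z) + C * (k^2 * exp (- (\<delta> * k powr (1/10))))"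
    by (rule pointwise_error) (rule that)
  obtain C' where C': "\<And>k N z r1. k \<ge> 1 \<Longrightarrow> k^2 = real N * \<mu> \<Longrightarrow> r1 > 0 \<Longrightarrow>
     (\<forall>i::int. r1 \<le> \<bar>rc z + 2 * pi * of_int i\<bar>) \<Longrightarrow> norm (mode k z) \<le> exp C' * exp (- (\<delta> * r1^2 * k))"
    by (rule mode_upper) (rule that)
  obtain a k0 where a: "a > 0" "\<And>k N. k \<ge> k0 \<Longrightarrow> k \<ge> 1 \<Longrightarrow> k^2 = real N * \<mu> \<Longrightarrow> a * (1 / k)^2 \<le> (L2_norm (mode k))^2"
    by (rule mode_lower) (rule that)
  define vol where "vol = measure lebesgue torus_cell"
  define \<kappa> where "\<kappa> N = sqrt (real N * \<mu>)" for N
  \<comment> \<open>\<open>L1\<close> bounds the squared residual and \<open>L2\<close> the mass on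
    \<open>\<omega>\<close>, both relative to the squared norm of the mode. The factors
    \<open>k^2 / a\<close> are due to the lower bound for that norm.\<close>
  define L1 where "L1 k = 2 * C^2 * (k powr (-1/4))^2 + 2 * C^2 * vol / a * ((k^2 * exp (- (\<delta> * k powr (1/10))))^2 * k^2)" for k
  define L2 where "L2 k = (exp C')^2 * vol / a * ((exp (- (\<delta> * r1^2 * k)))^2 * k^2)" for k
  have \<kappa>: "filterlim \<kappa> at_top sequentially"
    unfolding \<kappa>_def using \<mu>_ge
    by (intro filterlim_compose[OF sqrt_at_top] filterlim_at_top_mult_tendsto_pos[OF tendsto_const _ filterlim_real_sequentially]) auto
  have l1: "((\<lambda>k::real. (k powr (-1/4))^2) \<longlongrightarrow> 0) at_top" by real_asymp
  have l2: "((\<lambda>k::real. (k^2 * exp (- (\<delta> * k powr (1/10))))^2 * k^2) \<longlongrightarrow> 0) at_top"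
    using \<delta>(1) by real_asymp
  have "((\<lambda>k::real. (exp (- (g * k)))^2 * k^2) \<longlongrightarrow> 0) at_top" if "g > 0" for g :: real
    using that by real_asymp
  then have l3: "((\<lambda>k::real. (exp (- (\<delta> * r1^2 * k)))^2 * k^2) \<longlongrightarrow> 0) at_top"
    using \<delta>(1) r1(1) by simp
  have "(L1 \<longlongrightarrow> 2 * C^2 * 0 + 2 * C^2 * vol / a * 0) at_top"
    unfolding L1_def by (intro tendsto_add tendsto_mult_left l1 l2)
  then have "eventually (\<lambda>k. L1 k < \<epsilon>^2) at_top"
    by (rule order_tendstoD) (use eps in simp)
  moreover have "(L2 \<longlongrightarrow> (exp C')^2 * vol / a * 0) at_top"
    unfolding L2_def by (intro tendsto_mult_left l3)
  then have "eventually (\<lambda>k. L2 k < \<epsilon>) at_top"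
    by (rule order_tendstoD) (use eps in simp)
  ultimately have "eventually (\<lambda>k. L1 k < \<epsilon>^2 \<and> L2 k < \<epsilon> \<and> k \<ge> k0 \<and> k \<ge> 1) at_top"
    using eventually_ge_at_top[of k0] eventually_ge_at_top[of 1] by eventually_elim simp
  then have "eventually (\<lambda>N. L1 (\<kappa> N) < \<epsilon>^2 \<and> L2 (\<kappa> N) < \<epsilon> \<and> \<kappa> N \<ge> k0 \<and> \<kappa> N \<ge> 1) sequentially"
    using \<kappa> by (rule eventually_compose_filterlim)
  then obtain N where N: "L1 (\<kappa> N) < \<epsilon>^2" "L2 (\<kappa> N) < \<epsilon>" "\<kappa> N \<ge> k0" "\<kappa> N \<ge> 1"
    using eventually_happens'[OF sequentially_bot] by blast
  define k where "k = \<kappa> N"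
  have k: "k \<ge> 1" "k^2 = real N * \<mu>" using N \<mu>_ge by (auto simp: k_def \<kappa>_def)
  define S where "S = (L2_norm (mode k))^2"
  have low: "a * (1 / k)^2 \<le> S"
    unfolding S_def by (rule a(2)[OF _ k]) (use N in \<open>simp add: k_def\<close>)
  have "0 < a * (1 / k)^2" using a(1) k(1) by simp
  with low have S0: "S > 0" by linarith
  \<comment> \<open>Multiplying the absolute error terms by this quantity turns them into multiples
    of \<open>S\<close>.\<close>
  have one: "1 \<le> k^2 / a * S"
  proof -
    have "k^2 / a * (a * (1 / k)^2) \<le> k^2 / a * S" using a(1) by (intro mult_left_mono low) simp
    then show ?thesis using a(1) k(1) by (simp add: power_divide)
  qed
  have sm: "torus_smooth (mode k)" by (rule torus_smooth_mode[OF k(2)])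
  have uL: "mode k \<in> L2_torus" by (rule torus_smooth_L2[OF sm])
  have wL: "defect k \<in> L2_torus"
    unfolding defect_def[abs_def] by (intro L2_diff L2_scale uL torus_smooth_L2[OF torus_smooth_schroedinger[OF A V sm]])
  have vol0: "vol \<ge> 0" by (simp add: vol_def)
  have "(L2_norm (defect k))^2 \<le> 2 * (C * k powr (-1/4))^2 * S + 2 * (C * (k^2 * exp (- (\<delta> * k powr (1/10)))))^2 * vol"
    unfolding S_def vol_def by (rule L2_norm_sq_le[OF uL wL]) (rule C[OF k])
  also have "\<dots> \<le> 2 * (C * k powr (-1/4))^2 * S
      + 2 * (C * (k^2 * exp (- (\<delta> * k powr (1/10)))))^2 * vol * (k^2 / a * S)"
    using mult_left_mono[OF one, of "2 * (C * (k^2 * exp (- (\<delta> * k powr (1/10)))))^2 * vol"] vol0 by simp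
  also have "\<dots> = L1 k * S" by (simp add: L1_def power_mult_distrib algebra_simps)
  also have "\<dots> \<le> \<epsilon>^2 * S" using N(1) S0 by (intro mult_right_mono) (auto simp: k_def)
  also have "\<dots> = (\<epsilon> * L2_norm (mode k))^2" by (simp add: S_def power_mult_distrib)
  finally have 1: "L2_norm (defect k) \<le> \<epsilon> * L2_norm (mode k)"
    by (rule power2_le_imp_le) (use eps in simp)
  have "(LINT z:torus_cell \<inter> \<omega>|lebesgue. (norm (mode k z))^2) \<le> (exp C' * exp (- (\<delta> * r1^2 * k)))^2 * vol"
    unfolding vol_def by (rule L2_local_bound[OF uL \<omega>]) (rule C'[OF k r1])
  also have "\<dots> \<le> (exp C' * exp (- (\<delta> * r1^2 * k)))^2 * vol * (k^2 / a * S)"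
    using mult_left_mono[OF one, of "(exp C' * exp (- (\<delta> * r1^2 * k)))^2 * vol"] vol0 by simp
  also have "\<dots> = L2 k * S" by (simp add: L2_def power_mult_distrib algebra_simps)
  also have "\<dots> \<le> \<epsilon> * S" using N(2) S0 by (intro mult_right_mono) (auto simp: k_def)
  finally have 2: "(LINT z:torus_cell \<inter> \<omega>|lebesgue. (norm (mode k z))^2) \<le> \<epsilon> * (L2_norm (mode k))^2"
    by (simp add: S_def)
  have "L2_norm (mode k) \<noteq> 0" using S0 unfolding S_def by auto
  then have "L2_norm (mode k) > 0" using L2_norm_nonneg[of "mode k"] by linarith
  then show ?thesis using 1 2 smooth_schroedinger_graph[OF A V sm] unfolding defect_def[abs_def] localized_quasimode_def by blast
qed

end

subsection \<open>Choice of the coefficients\<close>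

context lattice
begin

text \<open>
  The coefficients of the quasimode are found order by order: \<open>c\<close>, \<open>c2\<close>, \<open>c3\<close>, \<open>t0\<close>, \<open>t1\<close> solve
  the equations averaged along the geodesic, and \<open>\<phi>\<close>, \<open>\<rho>\<close>, \<open>\<eta>\<close> are primitives of the oscillating
  parts.  The sign of the frequency is chosen opposite to that of the second derivative, so that
  the critical point becomes a potential well.
\<close>

lemma quasimodes_exist:
  fixes A :: "real^2 \<Rightarrow> real^2" and V :: "real^2 \<Rightarrow> real"
  assumes A: "torus_smooth A" and V: "torus_smooth V"
    and b1: "mean (sin_coef (\<lambda>z. A z \<bullet> m) 1) = 0" and b2: "mean (sin_coef (\<lambda>z. A z \<bullet> m) 2) \<noteq> 0"
    and \<omega>: "\<omega> \<in> sets lebesgue" and r1: "r1 > 0" "\<And>z. z \<in> \<omega> \<Longrightarrow> \<forall>i::int. r1 \<le> \<bar>rc z + 2 * pi * of_int i\<bar>"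
    and eps: "\<epsilon> > 0"
  shows "localized_quasimode A V \<omega> \<epsilon>"
proof -
  define \<mu> where "\<mu> = m \<bullet> m"
  define d where "d = m \<bullet> n"
  have mu: "\<mu> \<ge> 1" using norm_m by (simp add: \<mu>_def)
  have inner: "periodic (\<lambda>z. A z \<bullet> v)" "smooth (\<lambda>z. A z \<bullet> v)" for v
    using torus_smoothD[OF A] by (auto simp: periodic_def intro: smooth_linear[OF bounded_linear_inner_left])
  have Vp: "periodic V" "smooth V" using torus_smoothD[OF V] by auto
  have dinner: "periodic (dderiv (\<lambda>z. A z \<bullet> v) w)" "smooth (dderiv (\<lambda>z. A z \<bullet> v) w)" for v w
    by (intro periodic_dderiv smooth_dderiv inner)+
  define \<alpha> where "\<alpha> j = sin_coef (\<lambda>z. A z \<bullet> m) j" for j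
  have cs\<alpha>: "circle_smooth (\<alpha> j)" for j
    unfolding \<alpha>_def by (rule circle_smooth_sin_coef[OF inner])
  have "\<forall>j. \<exists>g. circle_smooth g \<and> (\<forall>s. (\<alpha> j has_real_derivative g s) (at s))"
    using circle_smooth_deriv[OF cs\<alpha>] by metis
  then obtain \<alpha>' where \<alpha>': "\<And>j. circle_smooth (\<alpha>' j)" "\<And>j s. (\<alpha> j has_real_derivative \<alpha>' j s) (at s)"
    by metis
  define b where "b j = mean (\<alpha> j)" for j
  define \<beta>0 where "\<beta>0 s = A (pt s 0) \<bullet> mp" for s
  define \<beta>0' where "\<beta>0' s = dderiv (\<lambda>z. A z \<bullet> mp) m (pt s 0)" for s
  define \<beta>1 where "\<beta>1 s = dderiv (\<lambda>z. A z \<bullet> mp) n (pt s 0)" for s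
  define v0 where "v0 s = V (pt s 0)" for s
  have cs: "circle_smooth \<beta>0" "circle_smooth \<beta>0'" "circle_smooth \<beta>1" "circle_smooth v0"
    unfolding \<beta>0_def[abs_def] \<beta>0'_def[abs_def] \<beta>1_def[abs_def] v0_def[abs_def]
    by (intro circle_smooth_pt inner dinner Vp)+
  have d\<beta>0: "(\<beta>0 has_real_derivative \<beta>0' s) (at s)" for s
    unfolding \<beta>0_def[abs_def] \<beta>0'_def by (rule pt_deriv(2)[OF inner(2)])
  \<comment> \<open>These constants of integration give \<open>B0\<close> and \<open>B1\<close> mean
    zero; otherwise the primitives \<open>\<rho>\<close> would not be periodic.\<close>
  define w where "w j = (if j = 1 then mean \<beta>0 / \<mu> else mean \<beta>1 / (2 * \<mu>))" for j :: nat
  have "\<forall>j. \<exists>g. circle_smooth g \<and> (\<forall>s. (g has_real_derivative (\<alpha> j s - b j)) (at s)) \<and> mean g = w j"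
    using circle_smooth_primitive[OF cs\<alpha>] unfolding b_def by metis
  then obtain \<phi> where \<phi>: "\<And>j. circle_smooth (\<phi> j)" "\<And>j s. (\<phi> j has_real_derivative (\<alpha> j s - b j)) (at s)"
      "\<And>j. mean (\<phi> j) = w j"
    by metis
  define \<phi>' where "\<phi>' j s = \<alpha> j s - b j" for j s
  have cs\<phi>': "circle_smooth (\<phi>' j)" for j
    unfolding \<phi>'_def[abs_def] by (intro circle_smooth_intros cs\<alpha>)
  have mean\<phi>': "mean (\<phi>' j) = 0" for j
    using mean_deriv[OF \<phi>(1,2)] unfolding \<phi>'_def[abs_def] .
  define B0 where "B0 s = \<beta>0 s - \<mu> * \<phi> 1 s + d * \<phi>' 0 s" for s
  define B0' where "B0' s = \<beta>0' s - \<mu> * \<phi>' 1 s + d * \<alpha>' 0 s" for s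
  define B1 where "B1 s = \<beta>1 s - 2 * \<mu> * \<phi> 2 s + d * \<phi>' 1 s" for s
  have csB: "circle_smooth B0" "circle_smooth B0'" "circle_smooth B1"
    unfolding B0_def[abs_def] B0'_def[abs_def] B1_def[abs_def]
    by (intro circle_smooth_intros cs \<phi>(1) cs\<phi>' \<alpha>')+
  note cont = circle_smooth_continuous[of _ UNIV]
  have mean3: "mean (\<lambda>s. x * g1 s + y * g2 s + z * g3 s) = x * mean g1 + y * mean g2 + z * mean g3"
    if "circle_smooth g1" "circle_smooth g2" "circle_smooth g3" for x y z :: real and g1 g2 g3
    using that
    by (simp add: mean_add mean_cmult cont circle_smooth_add circle_smooth_mult circle_smooth_const)
  have "mean (\<lambda>s. 1 * \<beta>0 s + (- \<mu>) * \<phi> 1 s + d * \<phi>' 0 s) = 0"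
    using mu by (subst mean3) (auto simp: cs \<phi> cs\<phi>' mean\<phi>' w_def)
  then have mB0: "mean B0 = 0" by (simp add: B0_def[abs_def])
  have "mean (\<lambda>s. 1 * \<beta>1 s + (- (2 * \<mu>)) * \<phi> 2 s + d * \<phi>' 1 s) = 0"
    using mu by (subst mean3) (auto simp: cs \<phi> cs\<phi>' mean\<phi>' w_def)
  then have mB1: "mean B1 = 0" by (simp add: B1_def[abs_def])
  have d\<phi>: "(\<phi> j has_real_derivative \<phi>' j s) (at s)" for j s
    using \<phi>(2) by (simp add: \<phi>'_def)
  have d\<phi>': "(\<phi>' j has_real_derivative \<alpha>' j s) (at s)" for j s
    unfolding \<phi>'_def[abs_def] using \<alpha>'(2)[of j s] by (auto intro!: derivative_eq_intros)
  have dB0: "(B0 has_real_derivative B0' s) (at s)" for s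
    unfolding B0_def[abs_def] B0'_def
    by (intro DERIV_add DERIV_diff DERIV_cmult d\<beta>0 d\<phi> d\<phi>')
  have mB0': "mean B0' = 0" by (rule mean_deriv[OF csB(1) dB0])
  define \<sigma> where "\<sigma> = (if b 2 > 0 then - 1 else 1 :: real)"
  have \<sigma>: "\<sigma>^2 = 1" by (simp add: \<sigma>_def)
  have \<sigma>b: "- \<sigma> * b 2 > 0" using b2 by (auto simp: \<sigma>_def b_def \<alpha>_def)
  define c where "c = sqrt (- 2 * \<sigma> * b 2) / \<mu>"
  have c0: "c > 0" using \<sigma>b mu by (simp add: c_def)
  have c2: "\<mu>^2 * c^2 = - 2 * \<sigma> * b 2"
    using \<sigma>b mu by (simp add: c_def power_divide)
  define c2' where "c2' = - \<sigma> * b 3 / (\<mu>^2 * c)"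
  have c3: "\<mu>^2 * (2 * c * c2') = - 2 * \<sigma> * b 3" using c0 mu by (simp add: c2'_def)
  define c3' where "c3' = (c^2 - c2'^2 - 2 * \<sigma> * b 4 / \<mu>^2) / (2 * c)"
  have c4: "\<mu>^2 * (c2'^2 + 2 * c * c3' - c^2) = - 2 * \<sigma> * b 4"
    using c0 mu by (simp add: c3'_def)
  define t0 where "t0 = c2' / c"
  have t0: "c * t0 = c2'" using c0 by (simp add: t0_def)
  define t1 where "t1 = ((3 * c3' - 2 * c) / 2 - t0 * c2') / c"
  have t1: "3 * c3' - 2 * c = 2 * (t0 * c2' + t1 * c)" using c0 by (simp add: t1_def field_simps)
  obtain M \<delta> where \<delta>: "\<delta> > 0" "\<And>r. \<bar>r\<bar> \<le> pi \<Longrightarrow>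
    \<delta> * r^2 \<le> c * sin r ^ 2 / 2 + c2' * sin r ^ 3 / 3 + c3' * sin r ^ 4 / 4 + M * (1 - cos r) ^ 3"
    by (rule phase_growth[OF c0, of c2' c3']) (rule that)
  define \<rho>' where "\<rho>' j s = (if j = 1 then - \<mu> * c * B0 s else if j = 2 then - \<mu> * (c2' * B0 s + c * B1 s)
    else (\<mu> * B1 s - d * B0' s - 2 * \<mu> * t0 * B0 s) / 2)" for j :: nat and s
  \<comment> \<open>The common shape allows smoothness and mean zero to be derived once, from the
    same properties of \<open>B0\<close>, \<open>B0'\<close> and \<open>B1\<close>.\<close>
  have \<rho>'_eq: "\<exists>x y z. \<rho>' j = (\<lambda>s. x * B0 s + y * B0' s + z * B1 s)" for j
  proof -
    consider "j = 1" | "j = 2" | "j \<noteq> 1" "j \<noteq> 2" by blast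
    then show ?thesis
    proof cases
      case 1
      then have "\<rho>' j = (\<lambda>s. (- \<mu> * c) * B0 s + 0 * B0' s + 0 * B1 s)"
        by (simp add: \<rho>'_def fun_eq_iff)
      then show ?thesis by blast
    next
      case 2
      then have "\<rho>' j = (\<lambda>s. (- \<mu> * c2') * B0 s + 0 * B0' s + (- \<mu> * c) * B1 s)"
        by (simp add: \<rho>'_def fun_eq_iff algebra_simps)
      then show ?thesis by blast
    next
      case 3
      then have "\<rho>' j = (\<lambda>s. (- (\<mu> * t0)) * B0 s + (- (d / 2)) * B0' s + (\<mu> / 2) * B1 s)"
        by (simp add: \<rho>'_def fun_eq_iff field_simps)
      then show ?thesis by blast
    qed
  qed
  have cs\<rho>': "circle_smooth (\<rho>' j)" and m\<rho>': "mean (\<rho>' j) = 0" for j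
  proof -
    obtain x y z where eq: "\<rho>' j = (\<lambda>s. x * B0 s + y * B0' s + z * B1 s)" using \<rho>'_eq by blast
    show "circle_smooth (\<rho>' j)" unfolding eq by (intro circle_smooth_intros csB)
    show "mean (\<rho>' j) = 0" unfolding eq mean3[OF csB] by (simp add: mB0 mB1 mB0')
  qed
  have "\<forall>j. \<exists>g. circle_smooth g \<and> (\<forall>s. (g has_real_derivative \<rho>' j s) (at s))"
    using circle_smooth_primitive[OF cs\<rho>'] unfolding m\<rho>' diff_0_right by metis
  then obtain \<rho> where \<rho>: "\<And>j. circle_smooth (\<rho> j)" "\<And>j s. (\<rho> j has_real_derivative \<rho>' j s) (at s)" by metis
  have "\<forall>j. \<exists>g. circle_smooth g \<and> (\<forall>s. (\<rho>' j has_real_derivative g s) (at s))"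
    using circle_smooth_deriv[OF cs\<rho>'] by metis
  then obtain \<rho>'' where \<rho>'': "\<And>j. circle_smooth (\<rho>'' j)" "\<And>j s. (\<rho>' j has_real_derivative \<rho>'' j s) (at s)" by metis
  define g where "g s = - (1 / 2) * (B0 s)^2 + (- (\<mu> / 2)) * v0 s" for s
  have csg: "circle_smooth g"
    unfolding g_def[abs_def] by (intro circle_smooth_intros csB cs)
  \<comment> \<open>The mean is the part of the equation for \<open>\<eta>\<close> that no periodic
    primitive removes; it becomes part of the energy.\<close>
  define e where "e = - 2 * mean g"
  define \<eta>' where "\<eta>' s = g s - mean g" for s
  obtain \<eta> where \<eta>: "circle_smooth \<eta>" "\<And>s. (\<eta> has_real_derivative \<eta>' s) (at s)"
    using circle_smooth_primitive[OF csg] unfolding \<eta>'_def by metis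
  have cs\<eta>': "circle_smooth \<eta>'" unfolding \<eta>'_def[abs_def] by (intro circle_smooth_intros csg)
  obtain \<eta>'' where \<eta>'': "circle_smooth \<eta>''" "\<And>s. (\<eta>' has_real_derivative \<eta>'' s) (at s)"
    using circle_smooth_deriv[OF cs\<eta>'] by metis
  note bdd = circle_smooth_bounded
  \<comment> \<open>The parameter \<open>\<phi>''\<close> is instantiated by
    \<open>\<alpha>'\<close>, because \<open>\<phi>'\<close> differs from \<open>\<alpha>\<close>
    only by the constants \<open>b\<close>.\<close>
  interpret torus_quasimode m1 m2 n1 n2 z0 \<mu> d \<sigma> c c2' c3' t0 t1 M e b \<alpha> \<alpha>' \<phi> \<phi>' \<alpha>' \<rho> \<rho>' \<rho>'' \<eta> \<eta>' \<eta>'' \<beta>0 \<beta>0' \<beta>1 v0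
    "\<lambda>s r. A (pt s r) \<bullet> m" "\<lambda>s r. dderiv (\<lambda>z. A z \<bullet> m) m (pt s r)" "\<lambda>s r. A (pt s r) \<bullet> mp"
    "\<lambda>s r. dderiv (\<lambda>z. A z \<bullet> mp) m (pt s r)" "\<lambda>s r. dderiv (\<lambda>z. A z \<bullet> mp) n (pt s r)" "\<lambda>s r. V (pt s r)" A V \<delta>
  proof (intro torus_quasimode.intro quasimode.intro torus_quasimode_axioms.intro)
    show "lattice m1 m2 n1 n2" by (rule lattice_axioms)
    show "vanish 5 (\<lambda>k s r. A (pt s r) \<bullet> m - (\<alpha> 0 s + \<alpha> 1 s * sin r + \<alpha> 2 s * (sin r)^2 + \<alpha> 3 s * sin r ^ 3 + \<alpha> 4 s * sin r ^ 4))"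
      unfolding \<alpha>_def by (rule taylor_vanish_5[OF inner])
    have "\<alpha>' 0 s = dderiv (\<lambda>z. A z \<bullet> m) m (pt s 0)" for s
    proof -
      have "\<alpha> 0 = (\<lambda>s. A (pt s 0) \<bullet> m)" by (simp add: \<alpha>_def sin_coef_def fun_eq_iff)
      then show ?thesis using DERIV_unique[OF \<alpha>'(2)[of 0 s]] pt_deriv(2)[OF inner(2)[of m], where s = s and r = 0] by simp
    qed
    then show "vanish 1 (\<lambda>k s r. dderiv (\<lambda>z. A z \<bullet> m) m (pt s r) - \<alpha>' 0 s)"
      using taylor_vanish_1[OF dinner] by simp
    show "vanish 2 (\<lambda>k s r. A (pt s r) \<bullet> mp - (\<beta>0 s + \<beta>1 s * sin r))"
      unfolding \<beta>0_def \<beta>1_def by (rule taylor_vanish_2[OF inner])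
    show "vanish 1 (\<lambda>k s r. dderiv (\<lambda>z. A z \<bullet> mp) m (pt s r) - \<beta>0' s)"
      unfolding \<beta>0'_def by (rule taylor_vanish_1[OF dinner])
    show "vanish 1 (\<lambda>k s r. dderiv (\<lambda>z. A z \<bullet> mp) n (pt s r) - \<beta>1 s)"
      unfolding \<beta>1_def by (rule taylor_vanish_1[OF dinner])
    show "vanish 1 (\<lambda>k s r. V (pt s r) - v0 s)"
      unfolding v0_def by (rule taylor_vanish_1[OF Vp])
    show "b 1 = 0" using b1 by (simp add: b_def \<alpha>_def)
    show "\<rho>' 1 s = - \<mu> * c * (\<beta>0 s - \<mu> * \<phi> 1 s + d * \<phi>' 0 s)" for s
      by (simp add: \<rho>'_def B0_def)
    show "\<rho>' 2 s = - \<mu> * (c2' * (\<beta>0 s - \<mu> * \<phi> 1 s + d * \<phi>' 0 s) + c * (\<beta>1 s - 2 * \<mu> * \<phi> 2 s + d * \<phi>' 1 s))" for s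
      by (simp add: \<rho>'_def B0_def B1_def)
    show "2 * \<rho>' 0 s = \<mu> * (\<beta>1 s - 2 * \<mu> * \<phi> 2 s + d * \<phi>' 1 s)
        - d * (\<beta>0' s - \<mu> * \<phi>' 1 s + d * \<alpha>' 0 s) - 2 * \<mu> * t0 * (\<beta>0 s - \<mu> * \<phi> 1 s + d * \<phi>' 0 s)" for s
      by (simp add: \<rho>'_def B0_def B1_def B0'_def)
    show "2 * \<eta>' s = e - (\<beta>0 s - \<mu> * \<phi> 1 s + d * \<phi>' 0 s)^2 - \<mu> * v0 s" for s
      by (simp add: \<eta>'_def e_def g_def B0_def)
    show "\<phi>' j s = \<alpha> j s - b j" for j s by (simp add: \<phi>'_def)
    show "(\<phi> j has_real_derivative \<phi>' j s) (at s)" for j s by (rule d\<phi>)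
  qed (rule \<sigma> c2 c3 c4 t0 t1 A V \<mu>_def d_def refl d\<phi>' \<phi>(1) \<rho> \<rho>''(2) \<eta> \<eta>''(2) \<delta>(1)
      bdd[OF \<phi>(1)] bdd[OF cs\<phi>'] bdd[OF \<alpha>'(1)] bdd[OF \<rho>(1)] bdd[OF cs\<rho>'] bdd[OF \<rho>''(1)]
      bdd[OF \<eta>(1)] bdd[OF cs\<eta>'] bdd[OF \<eta>''(1)] cs[THEN bdd] | erule \<delta>(2))+
  show ?thesis by (rule quasimodes[OF \<omega> r1 eps])
qed

end

subsection \<open>The average of the potential and the observation set\<close>

lemma one_minus_cos_le: "1 - cos x \<le> x^2 / 2" for x :: real
proof -
  have "1 - cos x = 2 * (sin (x / 2))^2"
    using cos_double_sin[of "x / 2"] by simp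
  also have "\<dots> \<le> 2 * (\<bar>x / 2\<bar>)^2"
    using power_mono[OF abs_sin_x_le_abs_x[of "x / 2"], of 2] by simp
  finally show ?thesis by (simp add: power_divide)
qed

lemma closure_periodic:
  assumes "periodic (\<lambda>z. z \<in> W)" "z \<in> closure W"
  shows "z + period l \<in> closure W"
proof -
  define w where "w = period l"
  have "(2 * pi) *\<^sub>R (\<chi> i. real_of_int ((- l) $ i)) = - w"
    by (simp add: w_def vec_eq_iff)
  then have 1: "z + w \<in> W \<longleftrightarrow> z \<in> W" "z - w \<in> W \<longleftrightarrow> z \<in> W" for z
    using periodic_shift[OF assms(1), of z l] periodic_shift[OF assms(1), of z "- l"] by (simp_all add: w_def)
  have "(+) w ` W = W"
  proof
    show "(+) w ` W \<subseteq> W" using 1(1) by (auto simp: add.commute)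
    show "W \<subseteq> (+) w ` W"
    proof
      fix z assume "z \<in> W"
      then have "z = w + (z - w)" "z - w \<in> W" using 1(2) by auto
      then show "z \<in> (+) w ` W" by (rule image_eqI)
    qed
  qed
  then have "(+) w ` closure W = closure W" using closure_translation[of w W] by simp
  then have "w + z \<in> closure W" using assms(2) by blast
  then show ?thesis by (simp add: w_def add.commute)
qed

text \<open>Division by the gcd makes the integer vector primitive, and Bezout completes it to a
  basis of determinant one. The sign \<open>sg\<close> orients it along \<open>g\<close>, so that
  normalising it gives \<open>g\<close> and not its opposite.\<close>

lemma periodic_direction_lattice:
  assumes "periodic_direction g"
  obtains m1 m2 n1 n2 :: int where "m1 * n2 - m2 * n1 = 1"
    "g = (1 / norm (vector [real_of_int m1, real_of_int m2] :: real^2)) *\<^sub>R vector [real_of_int m1, real_of_int m2]"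
proof -
  obtain l :: "int^2" and c where g: "norm g = 1" "l \<noteq> 0" "g = c *\<^sub>R (\<chi> i. real_of_int (l $ i))"
    using assms unfolding periodic_direction_def by blast
  define D where "D = gcd (l $ 1) (l $ 2)"
  have "l $ 1 \<noteq> 0 \<or> l $ 2 \<noteq> 0"
    using g(2) by (auto simp: vec_eq_iff forall_2)
  then have D: "D > 0" unfolding D_def by simp
  have c: "c \<noteq> 0" using g(1,3) by auto
  define sg :: int where "sg = (if c > 0 then 1 else - 1)"
  define m1 where "m1 = sg * (l $ 1 div D)"
  define m2 where "m2 = sg * (l $ 2 div D)"
  have sg: "sg * sg = 1" by (simp add: sg_def)
  have l: "l $ 1 = D * (sg * m1)" "l $ 2 = D * (sg * m2)"
    using sg by (simp_all add: m1_def m2_def D_def mult.assoc[symmetric])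
  obtain u v where "u * (l $ 1) + v * (l $ 2) = D"
    unfolding D_def using bezout_int by blast
  then have "D * (sg * (u * m1 + v * m2)) = D * 1"
    unfolding l by (simp add: algebra_simps)
  then have "sg * (u * m1 + v * m2) = 1" using D by simp
  then have det: "m1 * (sg * u) - m2 * (- (sg * v)) = 1" by (simp add: algebra_simps)
  let ?m = "vector [real_of_int m1, real_of_int m2] :: real^2"
  define a where "a = c * D * sg"
  have gm: "g = a *\<^sub>R ?m"
    unfolding g(3) vec_eq_iff forall_2 a_def by (simp add: l)
  have a0: "a > 0"
    using c D by (auto simp: a_def sg_def zero_less_mult_iff mult_less_0_iff)
  have "a * norm ?m = 1" using g(1) a0 unfolding gm by simp
  moreover from this have "norm ?m \<noteq> 0" by auto
  ultimately have "a = 1 / norm ?m" by (simp add: nonzero_eq_divide_eq)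
  with gm have "g = (1 / norm ?m) *\<^sub>R ?m" by simp
  with det show ?thesis by (rule that)
qed

context lattice
begin

definition dir :: "real^2" where "dir = (1 / norm m) *\<^sub>R m"

lemma norm_m_pos: "norm m > 0"
  using norm_m by auto

text \<open>At unit speed along \<open>dir\<close> the coordinate \<open>s\<close> advances at rate
  \<open>1 / norm m\<close> while \<open>r\<close> is fixed, so the long-time average is the mean
  over one period of \<open>s\<close>.\<close>

lemma averaged_potential_eq:
  assumes A: "torus_smooth A"
  shows "averaged_potential A dir z = mean (\<lambda>s. A (pt s (rc z)) \<bullet> m) / norm m"
proof -
  let ?f = "\<lambda>s. A (pt s (rc z))"
  note As = torus_smoothD[OF A]
  have per: "?f (s + 2 * pi) = ?f s" for s
    using periodic_pt[OF As(1), of s 1 "rc z" 0] by simp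
  have cont: "continuous_on UNIV ?f"
    by (rule continuous_on_compose2[OF smooth_continuous[OF As(2), of UNIV]])
      (auto simp: pt_def intro!: continuous_intros)
  have "z + t *\<^sub>R dir = pt (sc z + (1 / norm m) * t) (rc z)" for t
    by (subst pt_coords[of z, symmetric], unfold pt_def dir_def) (simp add: algebra_simps)
  then have "geodesic_average dir A z = mean ?f"
    unfolding geodesic_average_def
    using average_tendsto_mean[OF per cont, of "1 / norm m" "sc z"] norm_m_pos
    by (intro tendsto_Lim) auto
  then have "averaged_potential A dir z = mean ?f \<bullet> dir" by (simp add: averaged_potential_def)
  also have "\<dots> = mean ?f \<bullet> m / norm m" by (simp add: dir_def)
  also have "mean ?f \<bullet> m = mean (\<lambda>s. ?f s \<bullet> m)"
    using mean_linear[OF bounded_linear_inner_left cont] by simp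
  finally show ?thesis .
qed

lemma mean_pt_deriv:
  assumes "smooth F"
  shows "((\<lambda>r. mean (\<lambda>s. F (pt s r))) has_real_derivative mean (\<lambda>s. dderiv F n (pt s r))) (at r)"
proof -
  have "((\<lambda>r. integral (cbox 0 (2 * pi)) (\<lambda>s. F (pt s r))) has_field_derivative
      integral (cbox 0 (2 * pi)) (\<lambda>s. dderiv F n (pt s r))) (at r within UNIV)"
  proof (rule leibniz_rule_field_derivative)
    show "((\<lambda>r. F (pt s r)) has_field_derivative dderiv F n (pt s r)) (at r within UNIV)" for r s
      using pt_deriv(1)[OF assms] by simp
    have c: "continuous_on UNIV (\<lambda>s. F (pt s r))" for r
      by (rule continuous_on_compose2[OF smooth_continuous[OF assms, of UNIV]])
        (auto simp: pt_def intro!: continuous_intros)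
    show "(\<lambda>s. F (pt s r)) integrable_on cbox 0 (2 * pi)" for r
      using integrable_period[OF c[of r]] by simp
    have "continuous_on (UNIV \<times> cbox 0 (2 * pi)) (\<lambda>x. dderiv F n (pt (snd x) (fst x)))"
      by (rule continuous_on_compose2[OF smooth_continuous[OF smooth_dderiv[OF assms], of UNIV]])
        (auto simp: pt_def intro!: continuous_intros)
    then show "continuous_on (UNIV \<times> cbox 0 (2 * pi)) (\<lambda>(r, s). dderiv F n (pt s r))"
      by (simp add: case_prod_beta)
  qed auto
  from DERIV_cmult[OF this, of "1 / (2 * pi)"] show ?thesis by (simp add: mean_def)
qed

text \<open>Along \<open>perp dir\<close> the coordinate \<open>r\<close> grows at rate
  \<open>norm m\<close>, and the accompanying shift in \<open>s\<close> disappears in the mean. The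
  first two derivatives of the averaged potential are therefore positive multiples of the two
  means.\<close>

lemma critical_point_coefs:
  assumes A: "torus_smooth A" and crit: "nondegenerate_critical_point (averaged_potential A dir) dir z0"
  shows "mean (sin_coef (\<lambda>z. A z \<bullet> m) 1) = 0" "mean (sin_coef (\<lambda>z. A z \<bullet> m) 2) \<noteq> 0"
proof -
  define F where "F z = A z \<bullet> m" for z
  have F: "smooth F"
    unfolding F_def[abs_def] using torus_smoothD(2)[OF A] by (rule smooth_linear[OF bounded_linear_inner_left])
  let ?l = "norm m"
  define a where "a j r = mean (\<lambda>s. nderiv j F (pt s r))" for j r
  have da: "(a j has_real_derivative a (Suc j) r) (at r)" for j r
    using mean_pt_deriv[OF nderiv_smooth[OF F, of j], of r] unfolding a_def[abs_def] by (simp add: nderiv_def)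
  define h where "h y = averaged_potential A dir (z0 + y *\<^sub>R perp dir)" for y
  have "perp dir = (1 / ?l) *\<^sub>R mp"
    by (simp add: perp_def dir_def mp_eq vec_eq_iff forall_2)
  then have "rc (z0 + y *\<^sub>R perp dir) = y * ?l" for y
  proof -
    have "linear rl" using bounded_linear_coords by (auto dest: bounded_linear.linear)
    then have "rc (z0 + y *\<^sub>R perp dir) = y * (1 / ?l) * (m \<bullet> m)"
      by (simp add: rc_def \<open>perp dir = (1 / ?l) *\<^sub>R mp\<close> linear_scale coords_lin)
    then show ?thesis using norm_m_pos by (simp add: dot_square_norm power2_eq_square)
  qed
  then have h: "h = (\<lambda>y. a 0 (?l * y) / ?l)"
    by (simp add: h_def averaged_potential_eq[OF A] a_def nderiv_def F_def fun_eq_iff mult.commute)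
  have chain: "((\<lambda>y. a j (?l * y)) has_real_derivative a (Suc j) (?l * y) * ?l) (at y)" for j y
    by (rule DERIV_chain2[OF da]) (auto intro!: derivative_eq_intros)
  have "(h has_real_derivative a 1 (?l * y)) (at y)" for y
    unfolding h using DERIV_cdivide[OF chain[of 0 y], of ?l] norm_m_pos by simp
  then have dh: "deriv h = (\<lambda>y. a 1 (?l * y))" by (auto intro: DERIV_imp_deriv)
  have ddh: "deriv (deriv h) 0 = a 2 0 * ?l"
    unfolding dh using DERIV_imp_deriv[OF chain[of 1 0]] by (simp add: numeral_2_eq_2)
  have "deriv h 0 = 0" "deriv (deriv h) 0 \<noteq> 0"
    using crit unfolding nondegenerate_critical_point_def Let_def h_def[abs_def] by auto
  then have a: "a 1 0 = 0" "a 2 0 \<noteq> 0" unfolding ddh by (auto simp: dh)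
  have "sin_coef F 1 = (\<lambda>s. nderiv 1 F (pt s 0))" "sin_coef F 2 = (\<lambda>s. (1 / 2) * nderiv 2 F (pt s 0))"
    by (simp_all add: sin_coef_def fun_eq_iff)
  moreover have "continuous_on UNIV (\<lambda>s. nderiv 2 F (pt s 0))"
    by (rule continuous_on_compose2[OF smooth_continuous[OF nderiv_smooth[OF F], of UNIV]])
      (auto simp: pt_def intro!: continuous_intros)
  ultimately have "mean (sin_coef F 1) = a 1 0" "mean (sin_coef F 2) = 1 / 2 * a 2 0"
    unfolding a_def using mean_cmult[of "\<lambda>s. nderiv 2 F (pt s 0)" "1 / 2"] by simp_all
  then show "mean (sin_coef (\<lambda>z. A z \<bullet> m) 1) = 0" "mean (sin_coef (\<lambda>z. A z \<bullet> m) 2) \<noteq> 0"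
    using a unfolding F_def[abs_def] by simp_all
qed

text \<open>\<open>1 - cos (rc z)\<close> is a function on the torus that vanishes exactly on the
  geodesic through \<open>z0\<close>, so compactness gives it a positive lower bound
  \<open>t\<close> on the closure of \<open>W\<close>. The distance \<open>sqrt (2 * t)\<close> then
  follows from \<open>1 - cos x \<le> x^2 / 2\<close>.\<close>

lemma geodesic_separation:
  assumes W: "periodic (\<lambda>z. z \<in> W)" and disj: "geodesic dir z0 \<inter> closure W = {}"
  obtains r1 where "r1 > 0" "\<And>z. z \<in> W \<Longrightarrow> \<forall>i::int. r1 \<le> \<bar>rc z + 2 * pi * of_int i\<bar>"
proof -
  define K where "K = closure W \<inter> cbox (vec 0) (vec (2 * pi))"
  have K: "compact K" unfolding K_def by (intro closed_Int_compact) auto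
  have pos: "1 - cos (rc z) > 0" if z: "z \<in> closure W" for z
  proof (rule ccontr)
    assume "\<not> 1 - cos (rc z) > 0"
    then have "cos (rc z) = 1" using cos_le_one[of "rc z"] by linarith
    then obtain i :: int where i: "rc z = of_int i * 2 * pi" using cos_one_2pi_int by auto
    \<comment> \<open>Translation by \<open>- i\<close> periods along \<open>n\<close> moves the
      line \<open>r = 2 * pi * i\<close> to \<open>r = 0\<close>, the geodesic through
      \<open>z0\<close>.\<close>
    define l :: "int^2" where "l = vector [- i * n1, - i * n2]"
    have "pt (sc z) 0 = z + period l"
      by (subst (2) pt_coords[of z, symmetric], unfold pt_def i)
        (simp add: l_def vec_eq_iff forall_2)
    then have "pt (sc z) 0 \<in> closure W" using closure_periodic[OF W z, of l] by simp
    moreover have "pt (sc z) 0 = z0 + (sc z * norm m) *\<^sub>R dir"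
      using norm_m_pos by (simp add: pt_def dir_def)
    then have "pt (sc z) 0 \<in> geodesic dir z0" unfolding geodesic_def by blast
    ultimately show False using disj by blast
  qed
  obtain t where t: "t > 0" "\<And>z. z \<in> K \<Longrightarrow> t \<le> 1 - cos (rc z)"
  proof (cases "K = {}")
    case True
    then show ?thesis using that[of 1] by simp
  next
    case False
    have "continuous_on K (\<lambda>z. 1 - cos (rc z))"
      using smooth_continuous[OF smooth_coords(2)[OF smooth_sin_cos(2)]]
      by (intro continuous_on_diff continuous_on_const) 
    from continuous_attains_inf[OF K False this]
    obtain x where x: "x \<in> K" "\<forall>y\<in>K. 1 - cos (rc x) \<le> 1 - cos (rc y)" by blast
    show ?thesis
    proof (rule that)
      show "1 - cos (rc x) > 0" using x(1) by (intro pos) (simp add: K_def)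
      show "1 - cos (rc x) \<le> 1 - cos (rc y)" if "y \<in> K" for y using x(2) that by blast
    qed
  qed
  show ?thesis
  proof (rule that)
    show "sqrt (2 * t) > 0" using t by simp
    fix z assume z: "z \<in> W"
    show "\<forall>i::int. sqrt (2 * t) \<le> \<bar>rc z + 2 * pi * of_int i\<bar>"
    proof
      fix i :: int
      obtain l where l: "z + period l \<in> torus_cell"
        by (rule torus_cell_rep)
      define y where "y = z + period l"
      have "y \<in> K"
        using l closure_periodic[OF W closure_subset[THEN subsetD, OF z], of l] torus_cell_subset
        by (auto simp: K_def y_def)
      moreover have "periodic (\<lambda>z. (\<lambda>s r. cos r) (sc z) (rc z))"
        by (rule periodic_coords) auto
      then have "cos (rc y) = cos (rc z)"
        unfolding y_def by (rule periodic_shift)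
      moreover have "cos (rc z + 2 * pi * of_int i) = cos (rc z)"
        by (rule periodic_int) simp
      ultimately have "t \<le> (rc z + 2 * pi * of_int i)^2 / 2"
        using t(2)[of y] one_minus_cos_le[of "rc z + 2 * pi * of_int i"] by simp
      then show "sqrt (2 * t) \<le> \<bar>rc z + 2 * pi * of_int i\<bar>"
        by (intro real_le_lsqrt) simp_all
    qed
  qed
qed

end

theorem theorem1p8:
  fixes A :: "real^2 \<Rightarrow> real^2" and V :: "real^2 \<Rightarrow> real"
    and \<omega> :: "(real^2) set"
    and U :: "real \<Rightarrow> (real^2 \<Rightarrow> complex) \<Rightarrow> (real^2 \<Rightarrow> complex)"
  assumes "torus_smooth A" and "torus_smooth V"
    and "torus_open \<omega>" and "\<omega> \<noteq> {}"
    and "schroedinger_propagator A V U"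
    and "\<exists>g. periodic_direction g
           \<and> (\<exists>z. geodesic g z \<inter> closure \<omega> = {})
           \<and> (\<exists>z. nondegenerate_critical_point (averaged_potential A g) g z
                  \<and> geodesic g z \<inter> closure \<omega> = {})"
  shows "\<forall>T>0. \<not> observable U \<omega> T"
proof (intro allI impI)
  fix T :: real assume T: "T > 0"
  obtain g z where g: "periodic_direction g"
    and z: "nondegenerate_critical_point (averaged_potential A g) g z" "geodesic g z \<inter> closure \<omega> = {}"
    using assms(6) by blast
  obtain m1 m2 n1 n2 :: int where det: "m1 * n2 - m2 * n1 = 1"
    and gm: "g = (1 / norm (vector [real_of_int m1, real_of_int m2] :: real^2)) *\<^sub>R vector [real_of_int m1, real_of_int m2]"
    by (rule periodic_direction_lattice[OF g]) (rule that)
  \<comment> \<open>The origin of the coordinates is the critical point, so that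
    \<open>r = 0\<close> is the geodesic on which the modes concentrate.\<close>
  interpret lattice m1 m2 n1 n2 z by unfold_locales (rule det)
  have g_dir: "g = dir" by (simp add: gm dir_def m_def)
  have \<omega>: "open \<omega>" "periodic (\<lambda>z. z \<in> \<omega>)" using assms(3) by (auto simp: torus_open_def)
  obtain r1 where r1: "r1 > 0" "\<And>z. z \<in> \<omega> \<Longrightarrow> \<forall>i::int. r1 \<le> \<bar>rc z + 2 * pi * of_int i\<bar>"
    using geodesic_separation[OF \<omega>(2)] z(2) unfolding g_dir by blast
  show "\<not> observable U \<omega> T"
  proof (rule not_observable_of_quasimodes[OF assms(5) assms(3) T])
    have "\<omega> \<in> sets lebesgue" using \<omega>(1) by auto
    then show "localized_quasimode A V \<omega> \<epsilon>" if "\<epsilon> > 0" for \<epsilon> :: real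
      using that r1 by (intro quasimodes_exist[OF assms(1,2) critical_point_coefs[OF assms(1)]] z(1)[unfolded g_dir])
  qed
qed

end
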